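(* Let $D=2$. Let $W_m\to\infty$ ($W_m>0$), $d_m\uparrow\pi$ ($0<d_m<\pi$), and $\rho_m<1$ be sequences such that for every $m$ and every $x\in\mathbb R$, $$\bigl|\mathfrak b_{h_{W_m}}(x)-\mathfrak b_{h_{W_m}}(x-d_m)\bigr|\le 2\rho_m\sqrt{\mathfrak a_{h_{W_m}}(x)\,\mathfrak a_{h_{W_m}}(x-d_m)}.$$ Choose $M_m\ge 1$ with $\tanh(M_m/2)>\rho_m^2$, and increasing thresholds $N_m\to\infty$ such that $DN_m\ge M_m$ and $$\frac{W_m+\ln M_m+1}{\ln n}\le\frac1m\qquad\text{for all } n\ge N_m .$$ For $n\ge N_1$ let $m(n)$ be the largest $m$ with $N_m\le n$, and let $h=h_{W_{m(n)}}$. Then for every sufficiently large $n$, the greedy family (defined in the context for this $n$ and $h$), followed by the two-query exactifier, gives symmetric Laurent polynomials $q_0,\ldots,q_k$ of degree less than $n$ with constant coefficient $1$, each nonnegative on the unit circle, satisfying $q_0=F_n$, $q_k=1$, and $$J\bigl(a^{(t)}-a^{(t-1)}\bigr)=(-1)^{t+1}\bigl(a^{(t)}-a^{(t-1)}\bigr)\qquad(1\le t\le k),$$ where $a^{(t)}=(a^{(t)}_1,\dots,a^{(t)}_{n-1})$ is the coefficient vector of $q_t$, and with $$k=\frac{\ln n}{\pi}+o(\log n)\qquad(n\to\infty).$$ Consequently, there is an exact quantum algorithm for $n$-element ordered search using $\frac1\pi\ln n+o(\log n)$ queries.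
   Context: **Ordered search.** For $n\ge1$ the possible inputs are the strings $x=0^j1^{n-j}\in\{0,1\}^n$ with $j\in\{0,\ldots,n-1\}$ unknown, so $x_i=\mathbf 1[i\ge j]$ for $i\in\{0,\dots,n-1\}$; the goal is to output $j$. Quantum query access is via the phase oracle $O_x|i\rangle=(-1)^{x_i}|i\rangle$. A $k$-query algorithm is a sequence of input-independent unitaries (possibly with workspace) interleaved with $k$ applications of $O_x$, followed by a measurement; it is exact if it outputs $j$ with certainty on every input. **Laurent polynomials.** A normalized symmetric Laurent polynomial of degree less than $n$ is $q(z)=1+\sum_{j=1}^{n-1}a_j(z^j+z^{-j})$ with real coefficient vector $a\in\mathbb R^{n-1}$, considered for $|z|=1$; $q\ge0$ means $q(z)\ge0$ for all $|z|=1$. $J:\mathbb R^{n-1}\to\mathbb R^{n-1}$ is reversal, $(Ja)_j=a_{n-j}$, and $P_\pm=(I\pm J)/2$. The Fejér kernel is $F_n(z)=\frac1n|1+z+\cdots+z^{n-1}|^2$, with coefficients $a_j=1-j/n$. **Known characterization (from the literature).** There is an exact $k$-query quantum algorithm for $n$-element ordered search if and only if there are nonnegative normalized symmetric Laurent polynomials $q_0,\dots,q_k$ of degree less than $n$ with $q_0=F_n$, $q_k=1$ and $J(a^{(t)}-a^{(t-1)})=(-1)^{t+1}(a^{(t)}-a^{(t-1)})$ for $1\le t\le k$. Also known from the literature: any exact algorithm needs at least $\frac1\pi(\ln n-1)$ queries. **Densities and functions.** For $W>0$, $h_W(y)=\frac{4}{3W}\cos^4\!\left(\frac{\pi y}{2W}\right)\mathbf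 1_{\{|y|<W\}}$, a probability density. For a compactly supported probability density $h$ on $\mathbb R$, $$\mathfrak a_h(x)=\int_{\mathbb R}\frac{h(y)}{2\cosh(x-y)}\,dy,\qquad \mathfrak b_h(x)=\int_{\mathbb R}\frac{h(y)}{1+e^{2(y-x)}}\,dy .$$ **Packets.** For $0<\lambda<\infty$ and $1\le j<n$, $$s_{\lambda,n}(j)=\frac{\cosh(\lambda(1/2-j/n))}{2\cosh(\lambda/2)},\qquad a_{\lambda,n}(j)=\frac{\sinh(\lambda(1/2-j/n))}{2\sinh(\lambda/2)},$$ extended to $\lambda\in\{0,\infty\}$ by limits (so $s_{0,n}(j)=\frac12$, $a_{0,n}(j)=\frac12-\frac jn$, and both vanish at $\lambda=\infty$). Let $Y$ be a real random variable with density $h$. For $\alpha\in[0,\infty]$ put $S_{\alpha e^Y}(j)=\mathbb E[s_{\alpha e^Y,n}(j)]$ and $A_{\alpha e^Y}(j)=\mathbb E[a_{\alpha e^Y,n}(j)]$ (with $\alpha e^Y=0$ if $\alpha=0$ and $=\infty$ if $\alpha=\infty$), and $$q_{S_{\alpha e^Y}+A_{\beta e^Y}}(z)=1+\sum_{j=1}^{n-1}\bigl(S_{\alpha e^Y}(j)+A_{\beta e^Y}(j)\bigr)(z^j+z^{-j}).$$ **Greedy family.** For $\alpha\in[0,\infty)$ let $$\Gamma_S(\alpha)=\sup\{\beta\in[\alpha,\infty): q_{S_{\beta e^Y}+A_{\alpha e^Y}}\ge0\},\qquad \Gamma_A(\alpha)=\sup\{\beta\in[\alpha,\infty): q_{S_{\alpha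 e^Y}+A_{\beta e^Y}}\ge0\},$$ and $\Gamma_S(\infty)=\Gamma_A(\infty)=\infty$. Set $\alpha_0=0$, $\alpha_t=\Gamma_S(\alpha_{t-1})$ for $t$ odd, $\alpha_t=\Gamma_A(\alpha_{t-1})$ for $t$ even ($t\ge 1$). The greedy path is $q_0=F_n$, $q_t=q_{S_{\alpha_te^Y}+A_{\alpha_{t-1}e^Y}}$ for $t$ odd, and $q_t=q_{S_{\alpha_{t-1}e^Y}+A_{\alpha_te^Y}}$ for $t\ge2$ even. **Two-query exactifier.** Let $\tau$ be the first index for which the coefficient vector $a^{(\tau)}$ of the greedy polynomial $q_\tau$ satisfies $2\sum_{j=1}^{n-1}|a^{(\tau)}_j|<1$. The greedy path is stopped at $q_\tau$ and continued by two more polynomials: $q_{\tau+1}$ has coefficient vector $P_-a^{(\tau)}$ if $\tau+1$ is odd and $P_+a^{(\tau)}$ if $\tau+1$ is even, and $q_{\tau+2}=1$. The total length is $k=\tau+2$. *)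

theory Defs
  imports
    "HOL-Analysis.Analysis"
    "HOL-Library.Landau_Symbols"
    "HOL-Real_Asymp.Real_Asymp"
    "Jordan_Normal_Form.Schur_Decomposition"
begin

section \<open>Quantum query algorithms for ordered search\<close>

text \<open>The input \<open>0\<^sup>j 1\<^sup>n\<^sup>-\<^sup>j\<close>, as a function of the position.\<close>

definition ordered_input :: "nat \<Rightarrow> nat \<Rightarrow> nat" where
  "ordered_input j = (\<lambda>i. if j \<le> i then 1 else 0)"

text \<open>
  The state space is \<open>\<complex>\<^sup>n \<otimes> \<complex>\<^sup>w\<close> (query register and workspace) with the basis vector
  \<open>|i\<rangle> \<otimes> |b\<rangle>\<close> stored at index \<open>i * w + b\<close>, so that the query register of the
  basis state \<open>r\<close> is \<open>r div w\<close>.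
\<close>

definition phase_oracle :: "nat \<Rightarrow> nat \<Rightarrow> (nat \<Rightarrow> nat) \<Rightarrow> complex mat" where
  "phase_oracle n w x =
     mat (n * w) (n * w) (\<lambda>(r, c). if r = c then (- 1) ^ x (r div w) else 0)"

definition unitary_mat :: "nat \<Rightarrow> complex mat \<Rightarrow> bool" where
  "unitary_mat d U \<longleftrightarrow>
     U \<in> carrier_mat d d \<and> U * mat_adjoint U = 1\<^sub>m d \<and> mat_adjoint U * U = 1\<^sub>m d"

text \<open>The state \<open>U\<^sub>t O\<^sub>x U\<^sub>t\<^sub>-\<^sub>1 \<cdots> O\<^sub>x U\<^sub>0 |0\<rangle>\<close> after \<open>t\<close> queries.\<close>

primrec query_state ::
    "nat \<Rightarrow> nat \<Rightarrow> (nat \<Rightarrow> complex mat) \<Rightarrow> (nat \<Rightarrow> nat) \<Rightarrow> nat \<Rightarrow> complex Matrix.vec" where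
  "query_state n w U x 0 = U 0 *\<^sub>v unit_vec (n * w) 0"
| "query_state n w U x (Suc t) =
     U (Suc t) *\<^sub>v (phase_oracle n w x *\<^sub>v query_state n w U x t)"

text \<open>
  After \<open>k\<close> queries the computational basis is measured, and the outcome \<open>r\<close> is
  reported as the answer \<open>out r\<close>. The unitaries, the workspace dimension and \<open>out\<close>
  do not depend on the input.
\<close>

definition answer_prob ::
    "nat \<Rightarrow> nat \<Rightarrow> (nat \<Rightarrow> complex mat) \<Rightarrow> (nat \<Rightarrow> nat) \<Rightarrow> nat \<Rightarrow> (nat \<Rightarrow> nat) \<Rightarrow> nat \<Rightarrow> real" where
  "answer_prob n w U out k x j =
     (\<Sum>r | r < n * w \<and> out r = j. (cmod (vec_index (query_state n w U x k) r))\<^sup>2)"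

definition exact_ordered_search :: "nat \<Rightarrow> nat \<Rightarrow> bool" where
  "exact_ordered_search n k \<longleftrightarrow>
     (\<exists>w U out. 0 < w \<and> (\<forall>t\<le>k. unitary_mat (n * w) (U t)) \<and>
        (\<forall>j<n. answer_prob n w U out k (ordered_input j) j = 1))"

section \<open>Normalized symmetric Laurent polynomials\<close>

text \<open>
  A normalized symmetric Laurent polynomial of degree less than \<open>n\<close> is given by a
  coefficient function, of which only the values at \<open>1, \<dots>, n - 1\<close> matter.
\<close>

definition laurent :: "nat \<Rightarrow> (nat \<Rightarrow> real) \<Rightarrow> complex \<Rightarrow> complex" where
  "laurent n a z = 1 + (\<Sum>j\<in>{1..<n}. of_real (a j) * (z ^ j + inverse z ^ j))"

definition nonneg_on_circle :: "(complex \<Rightarrow> complex) \<Rightarrow> bool" where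
  "nonneg_on_circle q \<longleftrightarrow> (\<forall>z. cmod z = 1 \<longrightarrow> q z \<in> \<real>\<^sub>\<ge>\<^sub>0)"

definition fejer :: "nat \<Rightarrow> complex \<Rightarrow> real" where
  "fejer n z = (cmod (\<Sum>i<n. z ^ i))\<^sup>2 / real n"

definition coeff_rev :: "nat \<Rightarrow> (nat \<Rightarrow> real) \<Rightarrow> nat \<Rightarrow> real" where
  "coeff_rev n a = (\<lambda>j. a (n - j))"

definition proj_plus :: "nat \<Rightarrow> (nat \<Rightarrow> real) \<Rightarrow> nat \<Rightarrow> real" where
  "proj_plus n a = (\<lambda>j. (a j + coeff_rev n a j) / 2)"

definition proj_minus :: "nat \<Rightarrow> (nat \<Rightarrow> real) \<Rightarrow> nat \<Rightarrow> real" where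
  "proj_minus n a = (\<lambda>j. (a j - coeff_rev n a j) / 2)"

section \<open>Densities\<close>

definition cos4_density :: "real \<Rightarrow> real \<Rightarrow> real" where
  "cos4_density W y = (if \<bar>y\<bar> < W then 4 / (3 * W) * cos (pi * y / (2 * W)) ^ 4 else 0)"

definition frak_a :: "(real \<Rightarrow> real) \<Rightarrow> real \<Rightarrow> real" where
  "frak_a h x = (\<integral>y. h y / (2 * cosh (x - y)) \<partial>lborel)"

definition frak_b :: "(real \<Rightarrow> real) \<Rightarrow> real \<Rightarrow> real" where
  "frak_b h x = (\<integral>y. h y / (1 + exp (2 * (y - x))) \<partial>lborel)"

section \<open>Packets\<close>

definition packet_s :: "nat \<Rightarrow> ennreal \<Rightarrow> nat \<Rightarrow> real" where
  "packet_s n l j =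
     (if l = \<infinity> then 0
      else if l = 0 then 1 / 2
      else cosh (enn2real l * (1 / 2 - real j / real n)) / (2 * cosh (enn2real l / 2)))"

definition packet_a :: "nat \<Rightarrow> ennreal \<Rightarrow> nat \<Rightarrow> real" where
  "packet_a n l j =
     (if l = \<infinity> then 0
      else if l = 0 then 1 / 2 - real j / real n
      else sinh (enn2real l * (1 / 2 - real j / real n)) / (2 * sinh (enn2real l / 2)))"

lemma packet_finite:
  assumes "0 < l"
  shows "packet_s n (ennreal l) j
      = cosh (l * (1 / 2 - real j / real n)) / (2 * cosh (l / 2))"
    and "packet_a n (ennreal l) j
      = sinh (l * (1 / 2 - real j / real n)) / (2 * sinh (l / 2))"
  using assms by (auto simp: packet_s_def packet_a_def)

text \<open>The values at \<open>0\<close> and \<open>\<infinity>\<close> are the limits of the values at finite positive parameters.\<close>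

lemma packet_tendsto_0:
  "((\<lambda>l. packet_s n (ennreal l) j) \<longlongrightarrow> packet_s n 0 j) (at_right 0)"
  "((\<lambda>l. packet_a n (ennreal l) j) \<longlongrightarrow> packet_a n 0 j) (at_right 0)"
proof -
  define c where "c = 1 / 2 - real j / real n"
  have ev: "eventually (\<lambda>l::real. l > 0) (at_right 0)"
    by (simp add: eventually_at_right_less)
  have "((\<lambda>l::real. cosh (l * c) / (2 * cosh (l / 2))) \<longlongrightarrow> 1 / 2) (at_right 0)"
    by real_asymp
  then have "((\<lambda>l. packet_s n (ennreal l) j) \<longlongrightarrow> 1 / 2) (at_right 0)"
    by (rule Lim_transform_eventually)
       (rule eventually_mono[OF ev], simp add: packet_finite c_def)
  then show "((\<lambda>l. packet_s n (ennreal l) j) \<longlongrightarrow> packet_s n 0 j) (at_right 0)"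
    by (simp add: packet_s_def)
  have "((\<lambda>l::real. sinh (l * c) / (2 * sinh (l / 2))) \<longlongrightarrow> c) (at_right 0)"
    by real_asymp
  then have "((\<lambda>l. packet_a n (ennreal l) j) \<longlongrightarrow> c) (at_right 0)"
    by (rule Lim_transform_eventually)
       (rule eventually_mono[OF ev], simp add: packet_finite c_def)
  then show "((\<lambda>l. packet_a n (ennreal l) j) \<longlongrightarrow> packet_a n 0 j) (at_right 0)"
    by (simp add: packet_a_def c_def)
qed

lemma packet_tendsto_top:
  assumes "1 \<le> j" "j < n"
  shows "((\<lambda>l. packet_s n (ennreal l) j) \<longlongrightarrow> packet_s n \<infinity> j) at_top"
    and "((\<lambda>l. packet_a n (ennreal l) j) \<longlongrightarrow> packet_a n \<infinity> j) at_top"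
proof -
  define c where "c = 1 / 2 - real j / real n"
  define p q where "p = c - 1 / 2" and "q = - c - 1 / 2"
  have pq: "p < 0" "q < 0"
    using assms by (auto simp: p_def q_def c_def field_simps)
  have ev: "eventually (\<lambda>l::real. l > 0) at_top"
    by (rule eventually_gt_at_top)
  have lim: "((\<lambda>l::real. exp (p * l)) \<longlongrightarrow> 0) at_top"
      "((\<lambda>l::real. exp (q * l)) \<longlongrightarrow> 0) at_top"
      "((\<lambda>l::real. exp (- l)) \<longlongrightarrow> 0) at_top"
    using pq by real_asymp+
  have e1: "exp (l * c) = exp (l / 2) * exp (p * l)" "exp (- (l * c)) = exp (l / 2) * exp (q * l)"
      "exp (- (l / 2)) = exp (l / 2) * exp (- l)" for l :: real
    by (simp_all add: p_def q_def algebra_simps flip: exp_add)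
  have cancel: "((X * P + X * Q) / 2) / (2 * ((X + X * E) / 2)) = (P + Q) / (2 * (1 + E))"
    if "X \<noteq> 0" for X P Q E :: real
  proof -
    have num: "(X * P + X * Q) / 2 = X * ((P + Q) / 2)" and den: "2 * ((X + X * E) / 2) = X * (1 + E)"
      by (simp_all add: algebra_simps add_divide_distrib)
    show ?thesis
      unfolding num den using that by simp
  qed
  have cosh_eq: "cosh (l * c) / (2 * cosh (l / 2)) = (exp (p * l) + exp (q * l)) / (2 * (1 + exp (- l)))"
    for l :: real
    unfolding cosh_field_def e1 by (rule cancel) simp
  have sinh_eq: "sinh (l * c) / (2 * sinh (l / 2)) = (exp (p * l) - exp (q * l)) / (2 * (1 - exp (- l)))"
    for l :: real
    using cancel[of "exp (l / 2)" "exp (p * l)" "- exp (q * l)" "- exp (- l)"]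
    unfolding sinh_field_def e1 by simp
  have "((\<lambda>l::real. (exp (p * l) + exp (q * l)) / (2 * (1 + exp (- l))))
      \<longlongrightarrow> (0 + 0) / (2 * (1 + 0))) at_top"
    by (intro tendsto_intros lim) auto
  then have "((\<lambda>l::real. cosh (l * c) / (2 * cosh (l / 2))) \<longlongrightarrow> 0) at_top"
    unfolding cosh_eq by simp
  then have "((\<lambda>l. packet_s n (ennreal l) j) \<longlongrightarrow> 0) at_top"
    by (rule Lim_transform_eventually)
       (rule eventually_mono[OF ev], simp add: packet_finite c_def)
  then show "((\<lambda>l. packet_s n (ennreal l) j) \<longlongrightarrow> packet_s n \<infinity> j) at_top"
    by (simp add: packet_s_def)
  have "((\<lambda>l::real. (exp (p * l) - exp (q * l)) / (2 * (1 - exp (- l))))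
      \<longlongrightarrow> (0 - 0) / (2 * (1 - 0))) at_top"
    by (intro tendsto_intros lim) auto
  then have "((\<lambda>l::real. sinh (l * c) / (2 * sinh (l / 2))) \<longlongrightarrow> 0) at_top"
    unfolding sinh_eq by simp
  then have "((\<lambda>l. packet_a n (ennreal l) j) \<longlongrightarrow> 0) at_top"
    by (rule Lim_transform_eventually)
       (rule eventually_mono[OF ev], simp add: packet_finite c_def)
  then show "((\<lambda>l. packet_a n (ennreal l) j) \<longlongrightarrow> packet_a n \<infinity> j) at_top"
    by (simp add: packet_a_def)
qed

text \<open>
  \<open>scale_law h f \<alpha> = E [f (\<alpha> e\<^sup>Y)]\<close>, where the real random variable \<open>Y\<close> has density \<open>h\<close>.
  In \<open>ennreal\<close> one has \<open>0 * e\<^sup>Y = 0\<close> and \<open>\<infinity> * e\<^sup>Y = \<infinity>\<close>.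
\<close>

definition scale_law :: "(real \<Rightarrow> real) \<Rightarrow> (ennreal \<Rightarrow> real) \<Rightarrow> ennreal \<Rightarrow> real" where
  "scale_law h f \<alpha> =
     (\<integral>y. f (\<alpha> * ennreal (exp y)) \<partial>density lborel (\<lambda>y. ennreal (h y)))"

definition mixed_S :: "nat \<Rightarrow> (real \<Rightarrow> real) \<Rightarrow> ennreal \<Rightarrow> nat \<Rightarrow> real" where
  "mixed_S n h \<alpha> j = scale_law h (\<lambda>l. packet_s n l j) \<alpha>"

definition mixed_A :: "nat \<Rightarrow> (real \<Rightarrow> real) \<Rightarrow> ennreal \<Rightarrow> nat \<Rightarrow> real" where
  "mixed_A n h \<alpha> j = scale_law h (\<lambda>l. packet_a n l j) \<alpha>"

text \<open>The coefficients of \<open>q\<close> with subscript \<open>S\<^bsub>\<alpha> exp Y\<^esub> + A\<^bsub>\<beta> exp Y\<^esub>\<close>.\<close>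

definition SA_coeff :: "nat \<Rightarrow> (real \<Rightarrow> real) \<Rightarrow> ennreal \<Rightarrow> ennreal \<Rightarrow> nat \<Rightarrow> real" where
  "SA_coeff n h \<alpha> \<beta> j = mixed_S n h \<alpha> j + mixed_A n h \<beta> j"

section \<open>The greedy path and the two-query exactifier\<close>

definition Gamma_S :: "nat \<Rightarrow> (real \<Rightarrow> real) \<Rightarrow> ennreal \<Rightarrow> ennreal" where
  "Gamma_S n h \<alpha> =
     (if \<alpha> = \<infinity> then \<infinity>
      else Sup {\<beta>. \<alpha> \<le> \<beta> \<and> \<beta> < \<infinity> \<and> nonneg_on_circle (laurent n (SA_coeff n h \<beta> \<alpha>))})"

definition Gamma_A :: "nat \<Rightarrow> (real \<Rightarrow> real) \<Rightarrow> ennreal \<Rightarrow> ennreal" where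
  "Gamma_A n h \<alpha> =
     (if \<alpha> = \<infinity> then \<infinity>
      else Sup {\<beta>. \<alpha> \<le> \<beta> \<and> \<beta> < \<infinity> \<and> nonneg_on_circle (laurent n (SA_coeff n h \<alpha> \<beta>))})"

primrec greedy_scale :: "nat \<Rightarrow> (real \<Rightarrow> real) \<Rightarrow> nat \<Rightarrow> ennreal" where
  "greedy_scale n h 0 = 0"
| "greedy_scale n h (Suc t) =
     (if odd (Suc t) then Gamma_S n h (greedy_scale n h t)
      else Gamma_A n h (greedy_scale n h t))"

text \<open>The coefficients at \<open>t = 0\<close> are those of the Fejer kernel.\<close>

definition greedy_coeff :: "nat \<Rightarrow> (real \<Rightarrow> real) \<Rightarrow> nat \<Rightarrow> nat \<Rightarrow> real" where
  "greedy_coeff n h t =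
     (if t = 0 then (\<lambda>j. 1 - real j / real n)
      else if odd t then SA_coeff n h (greedy_scale n h t) (greedy_scale n h (t - 1))
      else SA_coeff n h (greedy_scale n h (t - 1)) (greedy_scale n h t))"

definition exactifiable :: "nat \<Rightarrow> (nat \<Rightarrow> real) \<Rightarrow> bool" where
  "exactifiable n a \<longleftrightarrow> 2 * (\<Sum>j\<in>{1..<n}. \<bar>a j\<bar>) < 1"

definition stop_index :: "nat \<Rightarrow> (real \<Rightarrow> real) \<Rightarrow> nat" where
  "stop_index n h = (LEAST t. exactifiable n (greedy_coeff n h t))"

definition path_length :: "nat \<Rightarrow> (real \<Rightarrow> real) \<Rightarrow> nat" where
  "path_length n h = stop_index n h + 2"

definition path_coeff :: "nat \<Rightarrow> (real \<Rightarrow> real) \<Rightarrow> nat \<Rightarrow> nat \<Rightarrow> real" where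
  "path_coeff n h t =
     (let \<tau> = stop_index n h in
      if t \<le> \<tau> then greedy_coeff n h t
      else if t = \<tau> + 1 then
        (if odd (\<tau> + 1) then proj_minus n (greedy_coeff n h \<tau>)
         else proj_plus n (greedy_coeff n h \<tau>))
      else (\<lambda>j. 0))"

end

(*
  Positivity.  With m = l / n the packet polynomials have closed forms over cosh m - cos theta, and
  q_{S + A} is a quadratic form in (cos (n theta / 2), sin (n theta / 2)); it is nonnegative as soon
  as the difference of two conjugate Poisson kernels is dominated by the geometric mean of two
  Poisson kernels.  Expanding cot ((theta + i m) / 2) into partial fractions exhibits every kernel
  as a sum of rescaled copies of the kernels on the line, so the overlap hypothesis gives this
  domination by the Cauchy-Schwarz inequality, exactly and for every n, once the scale exceeds
  M e^W.  Hence a greedy step multiplies the scale by at least e^d beyond M e^W, and by at least 2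
  always (the latter holds packet by packet); starting from e^(-W), the scale 5 n e^W, where the
  coefficients are summable to less than 1/2, is reached after ln n / d + O(W + ln M + 1) steps.

  Lower bound.  The functional sum_{j <= n/2} a_j / (j + 1) is about ln n on the Fejer kernel and 0
  at the end of the path.  The reversal symmetry of the increments turns its change in one step into
  a functional supported on j >= n/2, which Fejer-Riesz and Hilbert's inequality bound by pi.

  Algorithm.  Shifts of the Fejer-Riesz factors of the q_t are the states; consecutive Gram matrices
  agree by the reversal symmetry, so unitaries connecting them exist, and no workspace is needed.
*)

theory Submission
  imports Defs "HOL-Computational_Algebra.Fundamental_Theorem_Algebra"
begin

section \<open>Unitaries from equal Gram matrices\<close>

text \<open>The overlap hypothesis is one on the line because the summand 2t/(t^2+\<mu>^2) at \<mu>
  = s e^Y depends, up to the factor 2/t, only on Y - ln(|t|/s). Averaging over Y gives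
  \<open>frak_b\<close> at ln(|t|/s), the companion summand gives \<open>frak_a\<close>, and
  multiplying s by e^d translates the argument by d for all t = \<theta> + 2 pi k at once. What does
  not rescale is the factor tanh(l/2) that finite n puts in front of the Poisson kernels. M is the
  threshold beyond which it is at least \<rho>^2, so the slack \<rho> < 1 pays for it. Below the
  threshold the crude factor 2 is enough, as it costs only O(W + ln M) steps; scale 0 cannot be
  doubled, hence a separate first step. Greedy scales are suprema and only bounded from below, which
  bounds k from above. The claim on k is two-sided, so a lower bound valid for every admissible path
  is needed too. An o(log n) error tolerates additive constants, and these are chosen for
  convenience. The logarithmic lower bound and the passage from polynomials to algorithms are proved
  rather than assumed, in the form needed.\<close>

lemma mat_adjoint_index:
  assumes "A \<in> carrier_mat n m" "i < m" "j < n"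
  shows "mat_adjoint A $$ (i, j) = cnj (A $$ (j, i))"
  using assms unfolding mat_adjoint_def
  by (subst mat_of_rows_index) (auto simp: col_def)

lemma mat_adjoint_carrier: "A \<in> carrier_mat n m \<Longrightarrow> mat_adjoint A \<in> carrier_mat m n"
  unfolding mat_adjoint_def by auto

text \<open>For square matrices a right inverse is also a left inverse, so orthonormality of the
  rows alone has to be checked.\<close>

lemma unitary_matI:
  assumes A: "A \<in> carrier_mat n n"
    and rows: "\<And>i j. i < n \<Longrightarrow> j < n \<Longrightarrow>
      (\<Sum>k<n. A $$ (i, k) * cnj (A $$ (j, k))) = (if i = j then 1 else 0)"
  shows "unitary_mat n A"
proof -
  have adj: "mat_adjoint A \<in> carrier_mat n n"
    using mat_adjoint_carrier[OF A] .
  have "A * mat_adjoint A = 1\<^sub>m n"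
  proof (rule eq_matI)
    fix i j assume ij: "i < dim_row (1\<^sub>m n :: complex mat)" "j < dim_col (1\<^sub>m n :: complex mat)"
    have "(A * mat_adjoint A) $$ (i, j) = (\<Sum>k<n. A $$ (i, k) * mat_adjoint A $$ (k, j))"
      using ij A adj by (auto simp: scalar_prod_def lessThan_atLeast0)
    also have "\<dots> = (\<Sum>k<n. A $$ (i, k) * cnj (A $$ (j, k)))"
      using ij by (intro sum.cong) (auto simp: mat_adjoint_index[OF A])
    finally show "(A * mat_adjoint A) $$ (i, j) = 1\<^sub>m n $$ (i, j)"
      using rows ij by auto
  qed (use A adj in auto)
  with mat_mult_left_right_inverse[OF A adj this] A show ?thesis
    by (auto simp: unitary_mat_def)
qed

lemma unitary_mat_one: "unitary_mat n (1\<^sub>m n)"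
proof (rule unitary_matI)
  fix i j assume ij: "i < n" "j < n"
  have "(\<Sum>k<n. 1\<^sub>m n $$ (i, k) * cnj (1\<^sub>m n $$ (j, k))) = (\<Sum>k<n. if i = k then (if i = j then 1 else 0) else (0::complex))"
    using ij by (intro sum.cong) auto
  then show "(\<Sum>k<n. 1\<^sub>m n $$ (i, k) * cnj (1\<^sub>m n $$ (j, k))) = (if i = j then 1 else (0::complex))"
    using ij by simp
qed auto

lemma unitary_mat_mult:
  assumes "unitary_mat n A" "unitary_mat n B"
  shows "unitary_mat n (A * B)"
proof (rule unitary_matI)
  have car: "A \<in> carrier_mat n n" "B \<in> carrier_mat n n"
    and AA: "A * mat_adjoint A = 1\<^sub>m n" and BB: "B * mat_adjoint B = 1\<^sub>m n"
    using assms by (auto simp: unitary_mat_def)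
  note adj = car[THEN mat_adjoint_carrier]
  show "A * B \<in> carrier_mat n n" using car by auto
  have row: "(\<Sum>k<n. C $$ (i, k) * cnj (D $$ (j, k))) = (C * mat_adjoint D) $$ (i, j)"
    if "C \<in> carrier_mat n n" "D \<in> carrier_mat n n" "i < n" "j < n" for C D :: "complex mat" and i j
    using that mat_adjoint_carrier[OF that(2)]
    by (auto simp: scalar_prod_def lessThan_atLeast0 mat_adjoint_index[OF that(2)] intro!: sum.cong)
  have adjm: "mat_adjoint (A * B) = mat_adjoint B * mat_adjoint A"
  proof (rule eq_matI)
    fix i j assume "i < dim_row (mat_adjoint B * mat_adjoint A)" "j < dim_col (mat_adjoint B * mat_adjoint A)"
    then have ij: "i < n" "j < n" using adj by auto
    have "mat_adjoint (A * B) $$ (i, j) = cnj ((A * B) $$ (j, i))"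
      using car ij by (subst mat_adjoint_index[of _ n n]) auto
    also have "\<dots> = (\<Sum>k<n. cnj (B $$ (k, i)) * cnj (A $$ (j, k)))"
      using car ij by (auto simp: scalar_prod_def lessThan_atLeast0 mult.commute)
    also have "\<dots> = (mat_adjoint B * mat_adjoint A) $$ (i, j)"
      using car adj ij
      by (auto simp: scalar_prod_def lessThan_atLeast0 mat_adjoint_index[OF car(1)] mat_adjoint_index[OF car(2)]
          intro!: sum.cong)
    finally show "mat_adjoint (A * B) $$ (i, j) = (mat_adjoint B * mat_adjoint A) $$ (i, j)" .
  qed (use car adj mat_adjoint_carrier[of "A * B" n n] in auto)
  have "(A * B) * mat_adjoint (A * B) = 1\<^sub>m n"
  proof -
    have "(A * B) * mat_adjoint (A * B) = A * (B * mat_adjoint B) * mat_adjoint A"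
      unfolding adjm using car adj by (simp add: assoc_mult_mat[of _ n n _ n _ n])
    also have "\<dots> = 1\<^sub>m n" using AA BB car by simp
    finally show ?thesis .
  qed
  then show "(\<Sum>k<n. (A * B) $$ (i, k) * cnj ((A * B) $$ (j, k))) = (if i = j then 1 else 0)"
    if "i < n" "j < n" for i j
    using row[of "A * B" "A * B" i j] that car by auto
qed

text \<open>With \<open>w = a - b\<close>, the reflection \<open>I - w w\<^sup>* / \<langle>a, w\<rangle>\<close> is unitary because
  \<open>\<parallel>a\<parallel> = \<parallel>b\<parallel>\<close> gives \<open>2 Re \<langle>a, w\<rangle> = \<parallel>w\<parallel>\<^sup>2\<close>.\<close>

lemma householder:
  fixes a b :: "nat \<Rightarrow> complex"
  assumes norm_eq: "(\<Sum>i<n. a i * cnj (a i)) = (\<Sum>i<n. b i * cnj (b i))"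
  shows "\<exists>H. unitary_mat n H \<and> H *\<^sub>v Matrix.vec n a = Matrix.vec n b \<and>
    (\<forall>u. (\<Sum>i<n. u i * cnj (a i)) = (\<Sum>i<n. u i * cnj (b i)) \<longrightarrow> H *\<^sub>v Matrix.vec n u = Matrix.vec n u)"
proof (cases "\<forall>i<n. a i = b i")
  case True
  have "unitary_mat n (1\<^sub>m n)"
    by (rule unitary_mat_one)
  moreover have "Matrix.vec n a = Matrix.vec n b" using True by auto
  ultimately show ?thesis by (intro exI[of _ "1\<^sub>m n"]) auto
next
  case False
  define w where "w i = a i - b i" for i
  define q where "q = (\<Sum>i<n. w i * cnj (w i))"
  define s where "s = (\<Sum>i<n. a i * cnj (w i))"
  have q_ne: "q \<noteq> 0"
  proof
    assume "q = 0"
    have "q = of_real (\<Sum>i<n. (cmod (w i))\<^sup>2)"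
      unfolding q_def of_real_sum by (intro sum.cong refl complex_norm_square[symmetric])
    with \<open>q = 0\<close> have "complex_of_real (\<Sum>i<n. (cmod (w i))\<^sup>2) = 0" by (simp only:)
    then have "(\<Sum>i<n. (cmod (w i))\<^sup>2) = 0" by (simp only: of_real_eq_0_iff)
    then have "\<forall>i<n. w i = 0" by (subst (asm) sum_nonneg_eq_0_iff) auto
    with False show False by (auto simp: w_def)
  qed
  have q_eq: "s + cnj s = q"
    using norm_eq unfolding s_def q_def w_def
    by (simp add: algebra_simps sum_subtractf sum.distrib)
  have s_ne: "s \<noteq> 0" using q_ne q_eq by auto
  define H where "H = mat n n (\<lambda>(i, j). (if i = j then 1 else 0) - w i * cnj (w j) / s)"
  have H: "H \<in> carrier_mat n n" by (simp add: H_def)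
  have app: "H *\<^sub>v Matrix.vec n u = Matrix.vec n (\<lambda>i. u i - (\<Sum>j<n. u j * cnj (w j)) / s * w i)" for u
  proof (rule eq_vecI)
    fix i assume "i < dim_vec (Matrix.vec n (\<lambda>i. u i - (\<Sum>j<n. u j * cnj (w j)) / s * w i))"
    then have i: "i < n" by simp
    have "(H *\<^sub>v Matrix.vec n u) $ i = (\<Sum>j<n. ((if i = j then 1 else 0) - w i * cnj (w j) / s) * u j)"
      using i by (auto simp: H_def scalar_prod_def lessThan_atLeast0)
    also have "\<dots> = (\<Sum>j<n. if i = j then u j else 0) - (\<Sum>j<n. w i / s * (u j * cnj (w j)))"
      unfolding sum_subtractf[symmetric] by (intro sum.cong) (auto simp: algebra_simps)
    also have "\<dots> = u i - w i / s * (\<Sum>j<n. u j * cnj (w j))"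
      using i by (simp add: sum_distrib_left)
    finally show "(H *\<^sub>v Matrix.vec n u) $ i = Matrix.vec n (\<lambda>i. u i - (\<Sum>j<n. u j * cnj (w j)) / s * w i) $ i"
      using i by simp
  qed (auto simp: H_def)
  have "unitary_mat n H"
  proof (rule unitary_matI[OF H])
    fix i j assume ij: "i < n" "j < n"
    have "(\<Sum>k<n. H $$ (i, k) * cnj (H $$ (j, k))) =
      (\<Sum>k<n. (if i = k \<and> j = k then 1 else 0) - (if i = k then cnj (w j) * w k / cnj s else 0)
        - (if j = k then w i * cnj (w k) / s else 0)
        + w i * cnj (w j) / (s * cnj s) * (w k * cnj (w k)))"
      using ij by (intro sum.cong) (auto simp: H_def algebra_simps)
    also have "\<dots> = (if i = j then 1 else 0) - cnj (w j) * w i / cnj s - w i * cnj (w j) / s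
        + w i * cnj (w j) / (s * cnj s) * q"
    proof -
      have "(\<Sum>k<n. (if i = k \<and> j = k then 1 else 0) :: complex) = (if i = j then 1 else 0)"
        using ij by (cases "i = j") auto
      then show ?thesis using ij
        by (simp add: sum.distrib sum_subtractf sum_distrib_left[symmetric] sum_divide_distrib[symmetric] q_def)
    qed
    also have "\<dots> = (if i = j then 1 else 0)"
      using s_ne by (simp add: q_eq[symmetric] field_simps)
    finally show "(\<Sum>k<n. H $$ (i, k) * cnj (H $$ (j, k))) = (if i = j then 1 else 0)" .
  qed
  moreover have "H *\<^sub>v Matrix.vec n a = Matrix.vec n b"
    unfolding app s_def[symmetric] using s_ne by (intro eq_vecI) (auto simp: w_def)
  moreover have "H *\<^sub>v Matrix.vec n u = Matrix.vec n u"
    if "(\<Sum>i<n. u i * cnj (a i)) = (\<Sum>i<n. u i * cnj (b i))" for u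
  proof -
    have "(\<Sum>j<n. u j * cnj (w j)) = 0"
      using that by (simp add: w_def algebra_simps sum_subtractf)
    then show ?thesis unfolding app by simp
  qed
  ultimately show ?thesis by blast
qed

lemma unitary_mat_inner:
  assumes "unitary_mat n U" "u \<in> carrier_vec n" "v \<in> carrier_vec n"
  shows "(\<Sum>i<n. (U *\<^sub>v u) $ i * cnj ((U *\<^sub>v v) $ i)) = (\<Sum>i<n. u $ i * cnj (v $ i))"
proof -
  have U: "U \<in> carrier_mat n n" and UU: "mat_adjoint U * U = 1\<^sub>m n"
    using assms by (auto simp: unitary_mat_def)
  have cols: "(\<Sum>i<n. cnj (U $$ (i, j)) * U $$ (i, k)) = (if j = k then 1 else 0)"
    if "j < n" "k < n" for j k
  proof -
    have "(mat_adjoint U * U) $$ (j, k) = (\<Sum>i<n. cnj (U $$ (i, j)) * U $$ (i, k))"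
      using that U mat_adjoint_carrier[OF U]
      by (auto simp: scalar_prod_def lessThan_atLeast0 mat_adjoint_index[OF U] intro!: sum.cong)
    with UU that show ?thesis by simp
  qed
  have app: "(U *\<^sub>v x) $ i = (\<Sum>j<n. U $$ (i, j) * x $ j)" if "x \<in> carrier_vec n" "i < n" for x i
    using that U by (auto simp: scalar_prod_def lessThan_atLeast0)
  have "(\<Sum>i<n. (U *\<^sub>v u) $ i * cnj ((U *\<^sub>v v) $ i))
      = (\<Sum>i<n. \<Sum>k<n. \<Sum>j<n. (cnj (U $$ (i, j)) * U $$ (i, k)) * (u $ k * cnj (v $ j)))"
    using assms(2,3) by (intro sum.cong) (auto simp: app sum_product mult_ac)
  also have "\<dots> = (\<Sum>k<n. \<Sum>i<n. \<Sum>j<n. (cnj (U $$ (i, j)) * U $$ (i, k)) * (u $ k * cnj (v $ j)))"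
    by (rule sum.swap)
  also have "\<dots> = (\<Sum>k<n. \<Sum>j<n. \<Sum>i<n. (cnj (U $$ (i, j)) * U $$ (i, k)) * (u $ k * cnj (v $ j)))"
    by (intro sum.cong refl sum.swap)
  also have "\<dots> = (\<Sum>k<n. \<Sum>j<n. (if j = k then 1 else 0) * (u $ k * cnj (v $ j)))"
    unfolding sum_distrib_right[symmetric] by (intro sum.cong) (simp_all add: cols)
  also have "\<dots> = (\<Sum>k<n. \<Sum>j<n. if j = k then u $ k * cnj (v $ j) else 0)"
    by (intro sum.cong) auto
  also have "\<dots> = (\<Sum>i<n. u $ i * cnj (v $ i))"
    by (intro sum.cong) auto
  finally show ?thesis .
qed

text \<open>Vectors are matched one at a time. Once \<open>U\<close> sends the first m to their
  targets, a reflection carries the image of the next one to its target; equality of the Gram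
  entries says that the earlier targets have equal inner products with both, so the reflection fixes
  them. This works for linearly dependent families without extending bases.\<close>

lemma unitary_of_equal_gram:
  fixes v v' :: "nat \<Rightarrow> nat \<Rightarrow> complex"
  assumes "\<And>x y. x < m \<Longrightarrow> y < m \<Longrightarrow>
    (\<Sum>i<n. v x i * cnj (v y i)) = (\<Sum>i<n. v' x i * cnj (v' y i))"
  shows "\<exists>U. unitary_mat n U \<and> (\<forall>x<m. U *\<^sub>v Matrix.vec n (v x) = Matrix.vec n (v' x))"
  using assms
proof (induction m)
  case 0
  have "unitary_mat n (1\<^sub>m n)"
    by (rule unitary_mat_one)
  then show ?case by blast
next
  case (Suc m)
  then obtain U where U: "unitary_mat n U" "\<forall>x<m. U *\<^sub>v Matrix.vec n (v x) = Matrix.vec n (v' x)"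
    by fastforce
  have Uc: "U \<in> carrier_mat n n" using U by (simp add: unitary_mat_def)
  define a where "a i = (U *\<^sub>v Matrix.vec n (v m)) $ i" for i
  have a: "U *\<^sub>v Matrix.vec n (v m) = Matrix.vec n a"
    using Uc by (intro eq_vecI) (auto simp: a_def)
  have inner_a: "(\<Sum>i<n. (U *\<^sub>v Matrix.vec n (v x)) $ i * cnj (a i)) = (\<Sum>i<n. v x i * cnj (v m i))" for x
    using unitary_mat_inner[OF U(1), of "Matrix.vec n (v x)" "Matrix.vec n (v m)"] by (simp add: a_def)
  have "(\<Sum>i<n. a i * cnj (a i)) = (\<Sum>i<n. v' m i * cnj (v' m i))"
    using inner_a[of m] Suc.prems[of m m] by (simp add: a_def)
  from householder[OF this] obtain H where H: "unitary_mat n H"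
      "H *\<^sub>v Matrix.vec n a = Matrix.vec n (v' m)"
      "\<And>u. (\<Sum>i<n. u i * cnj (a i)) = (\<Sum>i<n. u i * cnj (v' m i)) \<Longrightarrow> H *\<^sub>v Matrix.vec n u = Matrix.vec n u"
    by blast
  have Hc: "H \<in> carrier_mat n n" using H by (simp add: unitary_mat_def)
  have "(H * U) *\<^sub>v Matrix.vec n (v x) = Matrix.vec n (v' x)" if "x < Suc m" for x
  proof (cases "x = m")
    case True
    then show ?thesis using Hc Uc a H(2) by (subst assoc_mult_mat_vec[of _ n n _ n]) auto
  next
    case False
    with that have x: "x < m" by simp
    have "(\<Sum>i<n. v' x i * cnj (a i)) = (\<Sum>i<n. v' x i * cnj (v' m i))"
      using inner_a[of x] U(2) x Suc.prems[of x m] by simp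
    from H(3)[OF this] show ?thesis
      using Hc Uc U(2) x by (subst assoc_mult_mat_vec[of _ n n _ n]) auto
  qed
  then show ?case using unitary_mat_mult[OF H(1) U(1)] by blast
qed

section \<open>The Fejer--Riesz theorem\<close>

lemma infinite_unit_circle: "infinite {z. cmod z = 1}"
proof
  assume fin: "finite {z. cmod z = 1}"
  have "inj_on cis {0..1}"
  proof (rule inj_onI)
    fix x y :: real assume xy: "x \<in> {0..1}" "y \<in> {0..1}" "cis x = cis y"
    then have "Re (cis x) = Re (cis y)" by simp
    then have "cos x = cos y" by simp
    with cos_inj_pi[of x y] xy(1,2) pi_gt3 show "x = y" by simp
  qed
  moreover have "finite (cis ` {0..1})" by (rule finite_subset[OF _ fin]) auto
  ultimately have "finite {0..1::real}" using finite_imageD by blast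
  then show False using infinite_Icc[of 0 "1::real"] by simp
qed

lemma poly_eq_if_eq_on_circle:
  fixes p q :: "complex poly"
  assumes "\<And>z. cmod z = 1 \<Longrightarrow> poly p z = poly q z"
  shows "p = q"
proof (rule ccontr)
  assume "p \<noteq> q"
  then have "finite {z. poly (p - q) z = 0}" by (intro poly_roots_finite) simp
  moreover have "{z. cmod z = 1} \<subseteq> {z. poly (p - q) z = 0}" using assms by auto
  ultimately show False using infinite_unit_circle finite_subset by blast
qed

text \<open>The reciprocal polynomial z^m cnj(p(1/cnj z)). The nominal degree m is a parameter
  because leading coefficients may vanish, and reflection has to turn vanishing at 0 into loss of
  degree.\<close>

definition conj_reflect :: "nat \<Rightarrow> complex poly \<Rightarrow> complex poly" where
  "conj_reflect m p = (\<Sum>i\<le>m. Polynomial.monom (cnj (coeff p i)) (m - i))"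

lemma coeff_conj_reflect:
  "coeff (conj_reflect m p) k = (if k \<le> m then cnj (coeff p (m - k)) else 0)"
proof -
  have "coeff (conj_reflect m p) k = (\<Sum>i\<le>m. if i = m - k \<and> k \<le> m then cnj (coeff p i) else 0)"
    unfolding conj_reflect_def coeff_sum by (intro sum.cong) auto
  then show ?thesis by simp
qed

lemma poly_conj_reflect:
  assumes "degree p \<le> m" "z \<noteq> 0"
  shows "poly (conj_reflect m p) z = z ^ m * cnj (poly p (inverse (cnj z)))"
proof -
  have "poly (conj_reflect m p) z = (\<Sum>i\<le>m. cnj (coeff p i) * z ^ (m - i))"
    by (simp add: conj_reflect_def poly_sum poly_monom)
  also have "\<dots> = (\<Sum>i\<le>m. z ^ m * cnj (coeff p i * inverse (cnj z) ^ i))"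
    using assms(2) by (intro sum.cong) (auto simp: power_diff field_simps)
  also have "\<dots> = z ^ m * cnj (\<Sum>i\<le>m. coeff p i * inverse (cnj z) ^ i)"
    by (simp add: sum_distrib_left)
  also have "(\<Sum>i\<le>m. coeff p i * inverse (cnj z) ^ i) = poly p (inverse (cnj z))"
    using assms(1) by (subst poly_as_sum_of_monoms'[OF assms(1), symmetric]) (simp add: poly_sum poly_monom)
  finally show ?thesis .
qed

lemma cmod1_cnj: "cmod z = 1 \<Longrightarrow> z * cnj z = 1"
  by (metis complex_norm_square mult.commute of_real_1 power_one)

text \<open>Nonnegative values are real, so cnj(z)^m Q(z) equals its conjugate z^m cnj(Q(z)). On the
  circle this is the asserted identity of polynomials, and infinitely many points suffice.\<close>

lemma self_reflective_if_nonneg: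
  assumes deg: "degree Q \<le> 2 * m"
    and nonneg: "\<And>z. cmod z = 1 \<Longrightarrow> cnj z ^ m * poly Q z \<in> \<real>\<^sub>\<ge>\<^sub>0"
  shows "conj_reflect (2 * m) Q = Q"
proof (rule poly_eq_if_eq_on_circle)
  fix z :: complex assume z: "cmod z = 1"
  then have z0: "z \<noteq> 0" by auto
  have zc: "z ^ m * cnj z ^ m = 1" using cmod1_cnj[OF z] by (simp flip: power_mult_distrib)
  have inv: "inverse (cnj z) = z"
    using cmod1_cnj[OF z] z0 by (simp add: field_simps)
  have "cnj w = w" if "w \<in> \<real>\<^sub>\<ge>\<^sub>0" for w :: complex
    using that by (auto simp: complex_nonneg_Reals_iff complex_eq_iff)
  from this[OF nonneg[OF z]] have "cnj (cnj z ^ m * poly Q z) = cnj z ^ m * poly Q z" .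
  then have eq: "z ^ m * cnj (poly Q z) = cnj z ^ m * poly Q z" by simp
  have "poly (conj_reflect (2 * m) Q) z = z ^ m * (z ^ m * cnj (poly Q z))"
    using poly_conj_reflect[OF deg z0] inv by (simp add: mult_2 power_add)
  also have "\<dots> = (z ^ m * cnj z ^ m) * poly Q z" unfolding eq by simp
  finally show "poly (conj_reflect (2 * m) Q) z = poly Q z" using zc by simp
qed

text \<open>A zero on the unit circle is double: writing \<open>u - 1 = 2 i sin s e\<^sup>i\<^sup>s\<close> for \<open>u = e\<^sup>2\<^sup>i\<^sup>s\<close>, the
  real factor \<open>sin s\<close> changes sign at the zero, so the cofactor must vanish there.\<close>

lemma circle_root_is_double:
  assumes r: "cmod r = 1"
    and nonneg: "\<And>z. cmod z = 1 \<Longrightarrow> cnj z ^ m * ((z - r) * poly R z) \<in> \<real>\<^sub>\<ge>\<^sub>0"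
  shows "poly R r = 0"
proof -
  define k where "k s = cnj (r * cis (2 * s)) ^ m * (2 * \<i> * cis s * r * poly R (r * cis (2 * s)))" for s
  have fac: "r * cis (2 * s) - r = of_real (sin s) * (2 * \<i> * cis s * r)" for s
  proof -
    have "cis (2 * s) - 1 = of_real (sin s) * (2 * \<i> * cis s)"
      by (simp add: complex_eq_iff cos_double_sin sin_double power2_eq_square)
    then have "r * (cis (2 * s) - 1) = r * (of_real (sin s) * (2 * \<i> * cis s))" by (rule arg_cong)
    then show ?thesis by (simp add: algebra_simps)
  qed
  have prod: "of_real (sin s) * k s \<in> \<real>\<^sub>\<ge>\<^sub>0" for s
    using nonneg[of "r * cis (2 * s)"] r unfolding fac by (simp add: k_def norm_mult mult_ac)
  have cont: "isCont k 0" unfolding k_def cis_conv_exp by (intro continuous_intros)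
  have scale: "x \<in> \<real>\<^sub>\<ge>\<^sub>0" if "of_real c * x \<in> \<real>\<^sub>\<ge>\<^sub>0" "0 < c" for c :: real and x :: complex
    using that by (auto simp: complex_nonneg_Reals_iff zero_le_mult_iff)
  define e where "e i = 1 / real (Suc i)" for i
  have e_lim: "e \<longlonglongrightarrow> 0" unfolding e_def by (rule lim_inverse_n'[THEN LIMSEQ_Suc])
  have e: "0 < sin (e i)" for i
    
  proof (rule sin_gt_zero)
    have "e i \<le> 1" by (simp add: e_def divide_simps)
    then show "e i < pi" using pi_gt3 by linarith
  qed (simp add: e_def)
  have "k 0 \<in> \<real>\<^sub>\<ge>\<^sub>0"
  proof (rule Lim_in_closed_set[OF closed_nonneg_Reals_complex])
    show "(\<lambda>i. k (e i)) \<longlonglongrightarrow> k 0" using isCont_tendsto_compose[OF cont e_lim] .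
    show "\<forall>\<^sub>F i in sequentially. k (e i) \<in> \<real>\<^sub>\<ge>\<^sub>0"
      using scale[OF prod e] by simp
  qed simp
  moreover have "- k 0 \<in> \<real>\<^sub>\<ge>\<^sub>0"
  proof (rule Lim_in_closed_set[OF closed_nonneg_Reals_complex])
    have "(\<lambda>i. k (- e i)) \<longlonglongrightarrow> k 0"
      using isCont_tendsto_compose[OF cont, of "\<lambda>i. - e i"] tendsto_minus[OF e_lim] by simp
    then show "(\<lambda>i. - k (- e i)) \<longlonglongrightarrow> - k 0" by (rule tendsto_minus)
    have "- k (- e i) \<in> \<real>\<^sub>\<ge>\<^sub>0" for i
      using scale[of "sin (e i)" "- k (- e i)"] prod[of "- e i"] e by simp
    then show "\<forall>\<^sub>F i in sequentially. - k (- e i) \<in> \<real>\<^sub>\<ge>\<^sub>0" by simp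
  qed simp
  ultimately have "k 0 = 0" by (auto simp: complex_nonneg_Reals_iff complex_eq_iff)
  then show ?thesis using r by (auto simp: k_def)
qed

text \<open>Each induction step removes a zero r together with its mirror image 1/cnj(r), which is
  again a zero by self-reflection, or by double vanishing if r lies on the circle. The pair
  contributes |z - r|^2 on the circle, hence the factor z - r to \<open>P\<close>. A zero at the
  origin has its mirror at infinity: there the top coefficient vanishes too, and dividing by z
  lowers m without changing the values.\<close>

lemma fejer_riesz_poly:
  assumes "degree Q \<le> 2 * m"
    and "\<And>z. cmod z = 1 \<Longrightarrow> cnj z ^ m * poly Q z \<in> \<real>\<^sub>\<ge>\<^sub>0"
  shows "\<exists>P. degree P \<le> m \<and> (\<forall>z. cmod z = 1 \<longrightarrow> cnj z ^ m * poly Q z = poly P z * cnj (poly P z))"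
  using assms
proof (induction m arbitrary: Q)
  case 0
  then obtain c where Q: "Q = [:c:]" by (metis degree_0_id le_zero_eq mult_0_right degree_eq_zeroE)
  have "c \<in> \<real>\<^sub>\<ge>\<^sub>0" using 0(2)[of 1] Q by simp
  then obtain x where x: "c = of_real x" "0 \<le> x" by (auto simp: nonneg_Reals_def)
  have "c = of_real (sqrt x) * cnj (of_real (sqrt x))"
    using x by (simp flip: of_real_mult)
  then show ?case by (intro exI[of _ "[:of_real (sqrt x):]"]) (auto simp: Q)
next
  case (Suc m)
  note deg = Suc.prems(1) and nonneg = Suc.prems(2)
  have refl: "coeff Q k = cnj (coeff Q (2 * Suc m - k))" if "k \<le> 2 * Suc m" for k
    using self_reflective_if_nonneg[OF deg nonneg] coeff_conj_reflect[of "2 * Suc m" Q k] that by simp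
  show ?case
  proof (cases "coeff Q 0 = 0")
    case True
    then have "[:0, 1:] dvd Q" using poly_eq_0_iff_dvd[of Q 0] by (simp add: poly_0_coeff_0)
    then obtain Q' where Q': "Q = [:0, 1:] * Q'" by (metis dvdE)
    have "degree Q' \<le> 2 * m"
    proof (cases "Q' = 0")
      case False
      have "coeff Q (2 * Suc m) = 0" using refl[of "2 * Suc m"] True by simp
      moreover have "degree Q = Suc (degree Q')" unfolding Q' using False by (subst degree_mult_eq) auto
      moreover have "Q \<noteq> 0" using False Q' by auto
      ultimately have "degree Q \<noteq> 2 * Suc m" by (metis leading_coeff_0_iff)
      then show ?thesis using deg \<open>degree Q = Suc (degree Q')\<close> by simp
    qed simp
    moreover have same: "cnj z ^ Suc m * poly Q z = cnj z ^ m * poly Q' z" if "cmod z = 1" for z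
    proof -
      have "cnj z ^ Suc m * poly Q z = (z * cnj z) * (cnj z ^ m * poly Q' z)"
        by (simp add: Q')
      then show ?thesis using cmod1_cnj[OF that] by simp
    qed
    ultimately have "\<exists>P. degree P \<le> m \<and> (\<forall>z. cmod z = 1 \<longrightarrow> cnj z ^ m * poly Q' z = poly P z * cnj (poly P z))"
      using nonneg same by (intro Suc.IH) metis+
    then obtain P where "degree P \<le> m" "\<And>z. cmod z = 1 \<Longrightarrow> cnj z ^ m * poly Q' z = poly P z * cnj (poly P z)"
      by blast
    then show ?thesis using same by (intro exI[of _ P]) auto
  next
    case False
    \<comment> \<open>Self-reflection ties the top coefficient to the constant one, so the degree is
      exactly 2(m+1); the quotient by the quadratic \<open>D\<close> then has degree exactly 2m, as
      the induction hypothesis needs.\<close>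
    then have "coeff Q (2 * Suc m) \<noteq> 0" using refl[of 0] by auto
    then have degQ: "degree Q = 2 * Suc m" using deg le_degree by (metis le_antisym)
    then have "\<not> constant (poly Q)" by (simp add: constant_degree)
    then obtain r where r: "poly Q r = 0" using fundamental_theorem_of_algebra by blast
    have r0: "r \<noteq> 0" using r False by (auto simp: poly_0_coeff_0)
    \<comment> \<open>The second factor is a multiple of z - 1/cnj(r), scaled so that cnj(z) D(z) =
      |z - r|^2 on the circle.\<close>
    define D where "D = [:- r, 1:] * [:1, - cnj r:]"
    have D_circle: "cnj z * poly D z = (z - r) * cnj (z - r)" if "cmod z = 1" for z
    proof -
      have "cnj z * poly D z = (z - r) * (cnj z - (z * cnj z) * cnj r)"
        by (simp add: D_def algebra_simps)
      then show ?thesis using cmod1_cnj[OF that] by simp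
    qed
    obtain R where R: "Q = [:- r, 1:] * R" using r poly_eq_0_iff_dvd[of Q r] by (metis dvdE)
    have "poly R (inverse (cnj r)) = 0"
    proof (cases "cmod r = 1")
      case True
      then have "inverse (cnj r) = r" using cmod1_cnj[OF True] r0 by (simp add: field_simps)
      moreover have "poly R r = 0"
        using nonneg by (intro circle_root_is_double[OF True, of "Suc m"]) (simp add: R algebra_simps)
      ultimately show ?thesis by simp
    next
      case False
      have "poly (conj_reflect (2 * Suc m) Q) (inverse (cnj r)) = 0"
        using r0 r by (subst poly_conj_reflect[OF deg]) auto
      then have "poly Q (inverse (cnj r)) = 0" using self_reflective_if_nonneg[OF deg nonneg] by simp
      moreover have "inverse (cnj r) - r \<noteq> 0"
      proof
        assume "inverse (cnj r) - r = 0"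
        then have "r * cnj r = 1" using r0 by (simp add: field_simps)
        then have "(cmod r)\<^sup>2 = 1" by (metis complex_norm_square of_real_eq_1_iff)
        then have "cmod r = 1 \<or> cmod r = - 1" by (simp add: power2_eq_1_iff)
        with False norm_ge_zero[of r] show False by linarith
      qed
      ultimately show ?thesis by (simp add: R)
    qed
    then obtain S where S: "R = [:- inverse (cnj r), 1:] * S" using poly_eq_0_iff_dvd[of R "inverse (cnj r)"] by (metis dvdE)
    have "Q = D * Polynomial.smult (- inverse (cnj r)) S"
    proof -
      have "[:- inverse (cnj r), 1:] = Polynomial.smult (- inverse (cnj r)) [:1, - cnj r:]"
        using r0 by simp
      then show ?thesis
        unfolding R S D_def by (simp only: mult_smult_left mult_smult_right mult.assoc)
    qed
    then obtain Q' where Q': "Q = D * Q'" by blast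
    have "D \<noteq> 0" "degree D = 2" using r0 by (auto simp: D_def degree_mult_eq)
    moreover have "Q' \<noteq> 0" using False Q' by auto
    ultimately have degQ': "degree Q' = 2 * m" using degQ unfolding Q' by (simp add: degree_mult_eq)
    have fac: "cnj z ^ Suc m * poly Q z = ((z - r) * cnj (z - r)) * (cnj z ^ m * poly Q' z)" if "cmod z = 1" for z
      using D_circle[OF that] by (simp add: Q' mult_ac)
    have nn: "cnj z ^ m * poly Q' z \<in> \<real>\<^sub>\<ge>\<^sub>0" if z: "cmod z = 1" "z \<noteq> r" for z
    proof -
      have "of_real ((cmod (z - r))\<^sup>2) * (cnj z ^ m * poly Q' z) \<in> \<real>\<^sub>\<ge>\<^sub>0"
        using nonneg[OF z(1)] fac[OF z(1)] by (simp only: complex_norm_square)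
      moreover have "0 < (cmod (z - r))\<^sup>2" using z by simp
      ultimately show ?thesis by (auto simp: complex_nonneg_Reals_iff zero_le_mult_iff simp del: of_real_power)
    qed
    \<comment> \<open>At z = r nothing can be divided out; nonnegativity there is the limit along
      the points r cis(1/(i+1)) of the circle.\<close>
    have "cnj z ^ m * poly Q' z \<in> \<real>\<^sub>\<ge>\<^sub>0" if z: "cmod z = 1" for z
    proof (cases "z = r")
      case True
      define e where "e i = 1 / real (Suc i)" for i
      have e_lim: "e \<longlonglongrightarrow> 0" unfolding e_def by (rule lim_inverse_n'[THEN LIMSEQ_Suc])
      have ne: "r * cis (e i) \<noteq> r" for i
      proof
        assume "r * cis (e i) = r"
        then have "cis (e i) = 1" using r0 by simp
        then have "Im (cis (e i)) = 0" by simp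
        then have "sin (e i) = 0" by simp
        moreover have "0 < sin (e i)" 
          
  proof (rule sin_gt_zero)
    have "e i \<le> 1" by (simp add: e_def divide_simps)
    then show "e i < pi" using pi_gt3 by linarith
  qed (simp add: e_def)
        ultimately show False by simp
      qed
      have "isCont (\<lambda>s. cnj (r * cis s) ^ m * poly Q' (r * cis s)) 0"
        unfolding cis_conv_exp by (intro continuous_intros)
      from isCont_tendsto_compose[OF this e_lim]
      have lim: "(\<lambda>i. cnj (r * cis (e i)) ^ m * poly Q' (r * cis (e i))) \<longlonglongrightarrow> cnj r ^ m * poly Q' r"
        by simp
      have mem: "cnj (r * cis (e i)) ^ m * poly Q' (r * cis (e i)) \<in> \<real>\<^sub>\<ge>\<^sub>0" for i
        using True z ne[of i] by (intro nn) (auto simp: norm_mult)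
      have "cnj r ^ m * poly Q' r \<in> \<real>\<^sub>\<ge>\<^sub>0"
        by (rule Lim_in_closed_set[OF closed_nonneg_Reals_complex _ _ lim]) (use mem in auto)
      with True show ?thesis by simp
    qed (use nn z in auto)
    then obtain P where P: "degree P \<le> m"
        "\<And>z. cmod z = 1 \<Longrightarrow> cnj z ^ m * poly Q' z = poly P z * cnj (poly P z)"
      using Suc.IH[of Q'] degQ' by auto
    have "degree ([:- r, 1:] * P) \<le> Suc m"
      using degree_mult_le[of "[:- r, 1:]" P] P(1) by simp
    moreover have "cnj z ^ Suc m * poly Q z = poly ([:- r, 1:] * P) z * cnj (poly ([:- r, 1:] * P) z)"
      if "cmod z = 1" for z
      unfolding fac[OF that] P(2)[OF that] by (simp add: algebra_simps)
    ultimately show ?thesis by blast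
  qed
qed

text \<open>The coefficients of the Fejer-Riesz factor are what the later arguments use: their
  autocorrelations are the \<open>a j\<close>, and normalization of q makes them a unit vector.
  States of the algorithm and the input of Hilbert's inequality are both built from this
  vector.\<close>

lemma fejer_riesz_laurent:
  assumes nonneg: "nonneg_on_circle (laurent n a)" and n: "0 < n"
  shows "\<exists>p :: nat \<Rightarrow> complex.
    (\<forall>j\<in>{1..<n}. (\<Sum>s<n - j. p (s + j) * cnj (p s)) = of_real (a j)) \<and> (\<Sum>s<n. p s * cnj (p s)) = 1"
proof -
  define m where "m = n - 1"
  have nm: "n = Suc m" using n by (simp add: m_def)
  define Q where "Q = Polynomial.monom 1 m +
    (\<Sum>j\<in>{1..<n}. Polynomial.monom (complex_of_real (a j)) (m + j) + Polynomial.monom (of_real (a j)) (m - j))"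
  have circle: "poly Q z = z ^ m * laurent n a z" if z: "cmod z = 1" for z
  proof -
    have z0: "z \<noteq> 0" using z by auto
    have "poly Q z = z ^ m + (\<Sum>j\<in>{1..<n}. of_real (a j) * z ^ (m + j) + of_real (a j) * z ^ (m - j))"
      by (simp add: Q_def poly_sum poly_monom)
    also have "(\<Sum>j\<in>{1..<n}. of_real (a j) * z ^ (m + j) + of_real (a j) * z ^ (m - j))
        = (\<Sum>j\<in>{1..<n}. z ^ m * (of_real (a j) * (z ^ j + inverse z ^ j)))"
      using z0 by (intro sum.cong) (auto simp: nm power_add power_diff field_simps)
    finally show ?thesis by (simp add: laurent_def sum_distrib_left distrib_left)
  qed
  have cnj_circle: "cnj z ^ m * z ^ m = 1" if "cmod z = 1" for z
    using cmod1_cnj[OF that] by (simp add: mult.commute flip: power_mult_distrib)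
  have Q_circle: "cnj z ^ m * poly Q z = laurent n a z" if "cmod z = 1" for z
    using cnj_circle[OF that] by (simp add: circle[OF that] flip: mult.assoc)
  have "degree Q \<le> 2 * m"
    unfolding Q_def
    by (intro degree_add_le degree_sum_le order_trans[OF degree_monom_le]) (auto simp: nm)
  moreover have "cnj z ^ m * poly Q z \<in> \<real>\<^sub>\<ge>\<^sub>0" if "cmod z = 1" for z
    using nonneg that unfolding Q_circle[OF that] nonneg_on_circle_def by blast
  ultimately obtain P where P: "degree P \<le> m"
      "\<And>z. cmod z = 1 \<Longrightarrow> cnj z ^ m * poly Q z = poly P z * cnj (poly P z)"
    using fejer_riesz_poly by metis
  \<comment> \<open>Turning |P|^2 on the circle into a product of polynomials allows coefficients to
    be compared.\<close>
  have QP: "Q = P * conj_reflect m P"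
  proof (rule poly_eq_if_eq_on_circle)
    fix z :: complex assume z: "cmod z = 1"
    then have z0: "z \<noteq> 0" by auto
    have inv: "inverse (cnj z) = z" using cmod1_cnj[OF z] z0 by (simp add: field_simps)
    have "poly Q z = z ^ m * (cnj z ^ m * poly Q z)"
      using cnj_circle[OF z] by (simp add: mult_ac flip: mult.assoc)
    also have "\<dots> = poly (P * conj_reflect m P) z"
      unfolding P(2)[OF z] using poly_conj_reflect[OF P(1) z0] inv by (simp add: mult_ac)
    finally show "poly Q z = poly (P * conj_reflect m P) z" .
  qed
  have auto_corr: "(\<Sum>s<n - j. coeff P (s + j) * cnj (coeff P s)) = coeff Q (m + j)" if "j < n" for j
  proof -
    have "coeff Q (m + j) = (\<Sum>i\<le>m + j. coeff P i * (if m + j - i \<le> m then cnj (coeff P (m - (m + j - i))) else 0))"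
      unfolding QP coeff_mult coeff_conj_reflect ..
    also have "\<dots> = (\<Sum>i\<in>{j..m}. coeff P i * cnj (coeff P (i - j)))"
      using that P(1) by (intro sum.mono_neutral_cong_right) (auto simp: nm coeff_eq_0 intro!: arg_cong[of _ _ "\<lambda>k. coeff P k"])
    also have "\<dots> = (\<Sum>s<n - j. coeff P (s + j) * cnj (coeff P s))"
      using that by (intro sum.reindex_bij_witness[of _ "\<lambda>s. s + j" "\<lambda>i. i - j"]) (auto simp: nm)
    finally show ?thesis ..
  qed
  have coeffQ: "coeff Q (m + j) = of_real (a j)" if "j \<in> {1..<n}" for j
  proof -
    have "coeff Q (m + j) = (\<Sum>i\<in>{1..<n}. if i = j then of_real (a i) else 0)"
      unfolding Q_def coeff_add coeff_sum using that by (auto intro!: sum.cong)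
    then show ?thesis using that by simp
  qed
  have "coeff Q m = 1"
    unfolding Q_def coeff_add coeff_sum by (auto intro!: sum.neutral simp: nm)
  with auto_corr[of 0] n have "(\<Sum>s<n. coeff P s * cnj (coeff P s)) = 1" by simp
  then show ?thesis using auto_corr coeffQ by (intro exI[of _ "coeff P"]) auto
qed

section \<open>From polynomial paths to algorithms\<close>

text \<open>The entry at i is p at x - i - 1 modulo n, the wrapped entries carrying the sign e. The
  wrapped positions are those with x \<le> i, exactly where the oracle for x acts by -1; hence a
  query replaces e by -e.\<close>

definition shift_state :: "nat \<Rightarrow> (nat \<Rightarrow> complex) \<Rightarrow> complex \<Rightarrow> nat \<Rightarrow> nat \<Rightarrow> complex" where
  "shift_state n p e x i = (if x \<le> i then e * p (x + n - i - 1) else p (x - i - 1))"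

text \<open>Below y neither vector is wrapped, from x on both are, and the signs cancel; these two
  blocks together form the autocorrelation at x - y. Between y and x only the second vector is
  wrapped, which gives e times the conjugate autocorrelation at n - (x - y), a real number.\<close>

lemma gram_shift_state:
  assumes corr: "\<And>j. j \<in> {1..<n} \<Longrightarrow> (\<Sum>s<n - j. p (s + j) * cnj (p s)) = of_real (a j)"
    and norm: "(\<Sum>s<n. p s * cnj (p s)) = 1"
    and e: "e * e = 1" "cnj e = e"
    and xy: "y \<le> x" "x < n"
  shows "(\<Sum>i<n. shift_state n p e x i * cnj (shift_state n p e y i))
    = (if x = y then 1 else of_real (a (x - y)) + e * of_real (a (n - (x - y))))"
proof -
  define j where "j = x - y"
  have j: "x = y + j" "j < n" using xy by (auto simp: j_def)
  let ?f = "\<lambda>i. shift_state n p e x i * cnj (shift_state n p e y i)"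
  have split: "{..<n} = {..<y} \<union> {x..<n} \<union> {y..<x}" using xy by auto
  have "sum ?f {..<n} = sum ?f {..<y} + sum ?f {x..<n} + sum ?f {y..<x}"
    unfolding split using xy by (subst sum.union_disjoint, auto)+
  also have "sum ?f {..<y} = (\<Sum>s<y. p (s + j) * cnj (p s))"
    using j by (intro sum.reindex_bij_witness[of _ "\<lambda>s. y - s - 1" "\<lambda>i. y - i - 1"])
      (auto simp: shift_state_def)
  also have "sum ?f {x..<n} = (\<Sum>s\<in>{y..<n - j}. p (s + j) * cnj (p s))"
  proof (intro sum.reindex_bij_witness[of _ "\<lambda>s. y + n - s - 1" "\<lambda>i. y + n - i - 1"])
    fix i assume i: "i \<in> {x..<n}"
    then have idx: "y + n - i - 1 + j = x + n - i - 1" using j by auto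
    have "?f i = (e * e) * (p (x + n - i - 1) * cnj (p (y + n - i - 1)))"
      using i j e(2) by (simp add: shift_state_def)
    then show "p (y + n - i - 1 + j) * cnj (p (y + n - i - 1)) = ?f i"
      unfolding idx e(1) by simp
  qed (use j xy in auto)
  also have "(\<Sum>s<y. p (s + j) * cnj (p s)) + (\<Sum>s\<in>{y..<n - j}. p (s + j) * cnj (p s))
      = (\<Sum>s<n - j. p (s + j) * cnj (p s))"
    using j xy by (subst sum.union_disjoint[symmetric]) (auto intro!: sum.cong)
  also have "sum ?f {y..<x} = (\<Sum>s<j. e * cnj (p (s + (n - j)) * cnj (p s)))"
    using j xy e(2)
    by (intro sum.reindex_bij_witness[of _ "\<lambda>s. x - s - 1" "\<lambda>i. x - i - 1"])
      (auto simp: shift_state_def mult_ac intro!: arg_cong[of _ _ p])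
  also have "\<dots> = e * cnj (\<Sum>s<n - (n - j). p (s + (n - j)) * cnj (p s))"
    using j by (simp add: sum_distrib_left)
  finally have total: "sum ?f {..<n} = (\<Sum>s<n - j. p (s + j) * cnj (p s))
      + e * cnj (\<Sum>s<n - (n - j). p (s + (n - j)) * cnj (p s))" .
  show ?thesis
  proof (cases "j = 0")
    case True
    then show ?thesis using total norm j(1) by simp
  next
    case False
    then have "j \<in> {1..<n}" "n - j \<in> {1..<n}" using j(2) by auto
    then have "sum ?f {..<n} = of_real (a j) + e * of_real (a (n - j))"
      unfolding total using corr[of j] corr[of "n - j"] by (simp only: complex_cnj_complex_of_real)
    then show ?thesis using False unfolding j(1) by simp
  qed
qed

lemma gram_shift_state_eq:
  assumes corr: "\<And>j. j \<in> {1..<n} \<Longrightarrow> (\<Sum>s<n - j. p (s + j) * cnj (p s)) = of_real (a j)"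
    and norm: "(\<Sum>s<n. p s * cnj (p s)) = 1"
    and e: "e * e = 1" "cnj e = e"
    and g: "\<And>j. j \<in> {1..<n} \<Longrightarrow> of_real (a j) + e * of_real (a (n - j)) = of_real (g j)"
    and w_norm: "\<And>x. x < n \<Longrightarrow> (\<Sum>i<n. w x i * cnj (w x i)) = 1"
    and w: "\<And>x y. y < x \<Longrightarrow> x < n \<Longrightarrow> (\<Sum>i<n. w x i * cnj (w y i)) = of_real (g (x - y))"
    and xy: "x < n" "y < n"
  shows "(\<Sum>i<n. w x i * cnj (w y i)) = (\<Sum>i<n. shift_state n p e x i * cnj (shift_state n p e y i))"
proof -
  have *: "(\<Sum>i<n. w x i * cnj (w y i)) = (\<Sum>i<n. shift_state n p e x i * cnj (shift_state n p e y i))"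
    if "y \<le> x" "x < n" for x y
  proof (cases "x = y")
    case True
    then show ?thesis using gram_shift_state[OF corr norm e that] w_norm[of x] that by simp
  next
    case False
    then have "x - y \<in> {1..<n}" "y < x" using that by auto
    then show ?thesis
      using gram_shift_state[OF corr norm e that] w[of y x] g[of "x - y"] that False by (simp only: if_False)
  qed
  show ?thesis
  proof (cases "y \<le> x")
    case False
    have "(\<Sum>i<n. w x i * cnj (w y i)) = cnj (\<Sum>i<n. w y i * cnj (w x i))"
      by (simp add: mult.commute)
    also have "\<dots> = cnj (\<Sum>i<n. shift_state n p e y i * cnj (shift_state n p e x i))"
      using *[of x y] False xy by simp
    finally show ?thesis by (simp add: mult.commute)
  qed (use * xy in simp)
qed

lemma phase_oracle_shift_state:
  assumes "e * e = 1"
  shows "phase_oracle n 1 (ordered_input x) *\<^sub>v Matrix.vec n (shift_state n p e x)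
    = Matrix.vec n (shift_state n p (- e) x)"
proof (rule eq_vecI)
  fix i assume "i < dim_vec (Matrix.vec n (shift_state n p (- e) x))"
  then have i: "i < n" by simp
  have "(phase_oracle n 1 (ordered_input x) *\<^sub>v Matrix.vec n (shift_state n p e x)) $ i
      = (\<Sum>c<n. if i = c then (- 1) ^ ordered_input x i * shift_state n p e x i else 0)"
    using i unfolding phase_oracle_def
    by (auto simp: scalar_prod_def lessThan_atLeast0 if_distrib[of "\<lambda>c. c * _"] cong: if_cong)
  then show "(phase_oracle n 1 (ordered_input x) *\<^sub>v Matrix.vec n (shift_state n p e x)) $ i
      = Matrix.vec n (shift_state n p (- e) x) $ i"
    using i by (auto simp: shift_state_def ordered_input_def)
qed (simp add: phase_oracle_def)

text \<open>The states before the queries are the cyclic (even \<open>t\<close>) or negacyclic (odd \<open>t\<close>) shifts of the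
  Fejer--Riesz factor of \<open>q\<^sub>t\<close>; a query exchanges the two kinds, whose Gram matrices are
  \<open>a\<^sub>j \<plusminus> a\<^bsub>n-j\<^esub>\<close>.\<close>

lemma exact_ordered_search_if_path:
  fixes q :: "nat \<Rightarrow> nat \<Rightarrow> real"
  assumes n: "0 < n"
    and nonneg: "\<And>t. t \<le> k \<Longrightarrow> nonneg_on_circle (laurent n (q t))"
    and start: "\<And>j. j \<in> {1..<n} \<Longrightarrow> q 0 j + q 0 (n - j) = 1"
    and final: "\<And>j. j \<in> {1..<n} \<Longrightarrow> q k j = 0"
    and step: "\<And>t j. t < k \<Longrightarrow> j \<in> {1..<n} \<Longrightarrow>
      q (Suc t) (n - j) - q t (n - j) = (- 1) ^ t * (q (Suc t) j - q t j)"
  shows "exact_ordered_search n k"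
proof -
  have "\<forall>t. \<exists>p. t \<le> k \<longrightarrow> (\<forall>j\<in>{1..<n}. (\<Sum>s<n - j. p (s + j) * cnj (p s)) = of_real (q t j))
      \<and> (\<Sum>s<n. p s * cnj (p s)) = 1"
    using fejer_riesz_laurent[OF nonneg n] by blast
  then obtain p where corr: "\<And>t j. t \<le> k \<Longrightarrow> j \<in> {1..<n} \<Longrightarrow>
        (\<Sum>s<n - j. p t (s + j) * cnj (p t s)) = of_real (q t j)"
      and norm: "\<And>t. t \<le> k \<Longrightarrow> (\<Sum>s<n. p t s * cnj (p t s)) = 1"
    by metis
  define e :: "nat \<Rightarrow> complex" where "e t = (- 1) ^ t" for t
  have e: "e t * e t = 1" "cnj (e t) = e t" "- e t * - e t = 1" "cnj (- e t) = - e t" for t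
    by (auto simp: e_def simp flip: power_add mult_2 power_mult_distrib)
  define v where "v t x = shift_state n (p t) (e t) x" for t x
  define v' where "v' t x = shift_state n (p t) (- e t) x" for t x
  define g where "g t j = q t j + (- 1) ^ t * q t (n - j)" for t j
  have g: "of_real (q t j) + e t * of_real (q t (n - j)) = of_real (g t j)" for t j
    by (simp add: g_def e_def)
  \<comment> \<open>The Fejer coefficients satisfy a_j + a_{n-j} = 1, so all cyclic shifts have
    inner product 1: they are one and the same unit vector, and an input-independent unitary can
    prepare it.\<close>
  have "\<exists>U. unitary_mat n U \<and> (\<forall>x<n. U *\<^sub>v Matrix.vec n (\<lambda>i. if i = 0 then 1 else 0) = Matrix.vec n (v 0 x))"
  proof (rule unitary_of_equal_gram)
    fix x y assume xy: "x < n" "y < n"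
    have one: "(\<Sum>i<n. (if i = 0 then 1 else 0) * cnj (if i = 0 then 1 else (0::complex))) = 1"
    proof -
      have "(\<Sum>i<n. (if i = 0 then 1 else 0) * cnj (if i = 0 then 1 else (0::complex)))
          = (\<Sum>i<n. if i = 0 then 1 else 0)" by (intro sum.cong) auto
      then show ?thesis using n by simp
    qed
    have g0: "g 0 (x - y) = 1" if "y < x" "x < n" for x y
      using start[of "x - y"] that unfolding g_def by fastforce
    show "(\<Sum>i<n. (if i = 0 then 1 else 0) * cnj (if i = 0 then 1 else (0::complex)))
        = (\<Sum>i<n. v 0 x i * cnj (v 0 y i))"
      unfolding v_def
      by (rule gram_shift_state_eq[OF corr norm e(1,2) g _ _ xy]) (use one g0 in auto)
  qed
  then obtain U0 where U0: "unitary_mat n U0"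
      "\<And>x. x < n \<Longrightarrow> U0 *\<^sub>v Matrix.vec n (\<lambda>i. if i = 0 then 1 else 0) = Matrix.vec n (v 0 x)" by blast
  \<comment> \<open>After the query the Gram entries of step t are a_j - (-1)^t a_{n-j}. The path
    condition says precisely that this combination is the same for q_t and q_{t+1}, and for q_{t+1}
    it is the Gram matrix before the next query.\<close>
  have "\<exists>U. unitary_mat n U \<and> (\<forall>x<n. U *\<^sub>v Matrix.vec n (v' t x) = Matrix.vec n (v (Suc t) x))"
    if t: "t < k" for t
  proof (rule unitary_of_equal_gram)
    fix x y assume xy: "x < n" "y < n"
    show "(\<Sum>i<n. v' t x i * cnj (v' t y i)) = (\<Sum>i<n. v (Suc t) x i * cnj (v (Suc t) y i))"
      unfolding v_def
    proof (rule gram_shift_state_eq[OF corr norm e(1,2) g _ _ xy])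
      show "(\<Sum>i<n. v' t x i * cnj (v' t x i)) = 1" if "x < n" for x
        using gram_shift_state[where x = x and y = x, OF corr norm e(3,4)[of t], of t] t that by (simp add: v'_def)
      show "(\<Sum>i<n. v' t x i * cnj (v' t y i)) = of_real (g (Suc t) (x - y))" if "y < x" "x < n" for x y
      proof -
        have j: "x - y \<in> {1..<n}" using that by auto
        have "(\<Sum>i<n. v' t x i * cnj (v' t y i)) = of_real (q t (x - y) - (- 1) ^ t * q t (n - (x - y)))"
          using gram_shift_state[where x = x and y = y, OF corr norm e(3,4)[of t], of t] t that by (simp add: v'_def e_def)
        also have "q t (x - y) - (- 1) ^ t * q t (n - (x - y)) = g (Suc t) (x - y)"
          using step[OF t j] unfolding g_def by (cases "even t") auto
        finally show ?thesis .
      qed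
    qed (use t in auto)
  qed
  then obtain U1 where U1: "\<And>t. t < k \<Longrightarrow> unitary_mat n (U1 t)"
      "\<And>t x. t < k \<Longrightarrow> x < n \<Longrightarrow> U1 t *\<^sub>v Matrix.vec n (v' t x) = Matrix.vec n (v (Suc t) x)"
    by metis
  \<comment> \<open>All coefficients of q_k vanish, so the final states are orthonormal and can be
    rotated onto the computational basis.\<close>
  have "\<exists>U. unitary_mat n U \<and> (\<forall>x<n. U *\<^sub>v Matrix.vec n (v k x) = Matrix.vec n (\<lambda>i. if i = x then 1 else 0))"
  proof (rule unitary_of_equal_gram)
    fix x y assume xy: "x < n" "y < n"
    have delta: "(\<Sum>i<n. (if i = x then 1 else 0) * cnj (if i = y then 1 else (0::complex))) = (if x = y then 1 else 0)"
      if "x < n" for x y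
    proof -
      have "(\<Sum>i<n. (if i = x then 1 else 0) * cnj (if i = y then 1 else (0::complex)))
          = (\<Sum>i<n. if i = x then (if x = y then 1 else 0) else 0)" by (intro sum.cong) auto
      then show ?thesis using that by simp
    qed
    have "(\<Sum>i<n. (if i = x then 1 else 0) * cnj (if i = y then 1 else (0::complex)))
        = (\<Sum>i<n. v k x i * cnj (v k y i))"
      unfolding v_def
    proof (rule gram_shift_state_eq[OF corr norm e(1,2) g _ _ xy])
      fix x y assume "y < x" "x < n"
      moreover from this have "x - y \<in> {1..<n}" "n - (x - y) \<in> {1..<n}" by auto
      then have "g k (x - y) = 0" unfolding g_def by (simp only: final mult_zero_right add_0_right)
      ultimately show "(\<Sum>i<n. (if i = x then 1 else 0) * cnj (if i = y then 1 else (0::complex))) = of_real (g k (x - y))"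
        using delta[of x y] by simp
    qed (use delta in auto)
    then show "(\<Sum>i<n. v k x i * cnj (v k y i)) = (\<Sum>i<n. (if i = x then 1 else 0) * cnj (if i = y then 1 else 0))" ..
  qed
  then obtain V where V: "unitary_mat n V"
      "\<And>x. x < n \<Longrightarrow> V *\<^sub>v Matrix.vec n (v k x) = Matrix.vec n (\<lambda>i. if i = x then 1 else 0)" by blast
  define U' where "U' t = (case t of 0 \<Rightarrow> U0 | Suc s \<Rightarrow> U1 s)" for t
  \<comment> \<open>The measurement basis change has no slot of its own and is merged into the last
    unitary; for k = 0 this is also the preparing one.\<close>
  define U where "U t = (if t = k then V * U' t else U' t)" for t
  have U': "unitary_mat n (U' t)" if "t \<le> k" for t
    using U0(1) U1(1) that by (auto simp: U'_def split: nat.split)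
  have U: "unitary_mat n (U t)" if "t \<le> k" for t
    using U'[OF that] V(1) unitary_mat_mult by (auto simp: U_def)
  have car: "V \<in> carrier_mat n n" "\<And>t. t \<le> k \<Longrightarrow> U' t \<in> carrier_mat n n"
    using V(1) U' by (auto simp: unitary_mat_def)
  have unit: "unit_vec n 0 = Matrix.vec n (\<lambda>i. if i = 0 then 1 else (0::complex))"
    by (auto simp: unit_vec_def)
  have state': "U' t *\<^sub>v (if t = 0 then unit_vec n 0 else Matrix.vec n (v' (t - 1) x)) = Matrix.vec n (v t x)"
    if "t \<le> k" "x < n" for t x
    using U0(2) U1(2) that by (cases t) (auto simp: U'_def unit)
  have state: "query_state n 1 U (ordered_input x) t = Matrix.vec n (v t x)" if "t < k" "x < n" for t x
    using that
  proof (induction t)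
    case 0
    then show ?case using state'[of 0 x] by (simp add: U_def)
  next
    case (Suc t)
    have "phase_oracle n 1 (ordered_input x) *\<^sub>v Matrix.vec n (v t x) = Matrix.vec n (v' t x)"
      unfolding v_def v'_def by (rule phase_oracle_shift_state[OF e(1)])
    then show ?case using Suc state'[of "Suc t" x] by (simp add: U_def)
  qed
  have final_state: "query_state n 1 U (ordered_input x) k = Matrix.vec n (\<lambda>i. if i = x then 1 else 0)"
    if "x < n" for x
  proof -
    have "query_state n 1 U (ordered_input x) k
        = (V * U' k) *\<^sub>v (if k = 0 then unit_vec n 0 else Matrix.vec n (v' (k - 1) x))"
    proof (cases k)
      case (Suc m)
      have "phase_oracle n 1 (ordered_input x) *\<^sub>v Matrix.vec n (v m x) = Matrix.vec n (v' m x)"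
        unfolding v_def v'_def by (rule phase_oracle_shift_state[OF e(1)])
      then show ?thesis using Suc state[of m x] that by (simp add: U_def)
    qed (simp add: U_def)
    also have "\<dots> = V *\<^sub>v (U' k *\<^sub>v (if k = 0 then unit_vec n 0 else Matrix.vec n (v' (k - 1) x)))"
      using car by (intro assoc_mult_mat_vec[of _ n n _ n]) auto
    also have "\<dots> = Matrix.vec n (\<lambda>i. if i = x then 1 else 0)"
      using state'[of k x] V(2) that by simp
    finally show ?thesis .
  qed
  have "answer_prob n 1 U id k (ordered_input x) x = 1" if "x < n" for x
  proof -
    have "{r. r < n * 1 \<and> id r = x} = {x}" using that by auto
    then show ?thesis using final_state[OF that] that by (simp add: answer_prob_def)
  qed
  then show ?thesis
    unfolding exact_ordered_search_def using U by (intro exI[of _ 1] exI[of _ U] exI[of _ id]) auto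
qed

section \<open>Hilbert's inequality and the lower bound\<close>

text \<open>Schur test with the weights \<open>sqrt x\<close>: the row sums are compared with the antiderivative
  \<open>2 arctan (sqrt (u / x))\<close> of \<open>sqrt (x / u) / (x + u)\<close>.\<close>

lemma hilbert_row_sum:
  fixes x :: real
  assumes x: "0 < x"
  shows "(\<Sum>y=1..m. sqrt (x / real y) / (x + real y)) \<le> pi"
proof -
  define G where "G u = 2 * arctan (sqrt (u / x))" for u
  have step: "sqrt (x / real y) / (x + real y) \<le> G (real y) - G (real y - 1)" if "1 \<le> y" for y :: nat
  proof -
    have der: "(G has_real_derivative sqrt (x / z) / (x + z)) (at z)" if "0 < z" for z
    proof -
      have "(G has_real_derivative 2 * (inverse (1 + (sqrt (z / x))\<^sup>2) * (inverse (sqrt (z / x)) / 2 * (1 / x)))) (at z)"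
        unfolding G_def using that x by (auto intro!: derivative_eq_intros simp: divide_simps)
      also have "2 * (inverse (1 + (sqrt (z / x))\<^sup>2) * (inverse (sqrt (z / x)) / 2 * (1 / x))) = inverse (sqrt (z / x)) / (x + z)"
      proof -
        define r where "r = sqrt (z / x)"
        have r: "0 < r" "r\<^sup>2 = z / x" using that x by (auto simp: r_def)
        have "x * (1 + z / x) = x + z" "0 < 1 + z / x" using that x by (auto simp: field_simps add_pos_pos)
        then have "inverse (1 + z / x) = x / (x + z)" using that x by (simp add: divide_simps mult.commute)
        then show ?thesis
          unfolding r_def[symmetric] r(2) using r(1) that x by (simp add: divide_simps)
      qed
      also have "inverse (sqrt (z / x)) = sqrt (x / z)"
        by (simp add: real_sqrt_inverse[symmetric])
      finally show ?thesis .
    qed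
    have cont: "continuous_on {real y - 1..real y} G"
      unfolding G_def using x by (intro continuous_intros) auto
    have "\<exists>l z. real y - 1 < z \<and> z < real y \<and> DERIV G z :> l \<and> G (real y) - G (real y - 1) = (real y - (real y - 1)) * l"
    proof (rule MVT[OF _ cont])
      fix z assume "real y - 1 < z" "z < real y"
      then have "0 < z" using \<open>1 \<le> y\<close> by linarith
      then show "G differentiable (at z)" using der real_differentiable_def by blast
    qed simp
    then obtain l z where z: "real y - 1 < z" "z < real y" "DERIV G z :> l" "G (real y) - G (real y - 1) = l"
      by auto
    have z0: "0 < z" using z(1) \<open>1 \<le> y\<close> by linarith
    then have l: "l = sqrt (x / z) / (x + z)" using DERIV_unique[OF z(3) der] by simp
    have "sqrt (x / real y) / (x + real y) \<le> sqrt (x / z) / (x + z)"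
      using x z z0 by (intro frac_le real_sqrt_le_mono divide_left_mono) auto
    with z(4) l show ?thesis by simp
  qed
  have "(\<Sum>y=1..m. sqrt (x / real y) / (x + real y)) \<le> (\<Sum>y=1..m. G (real y) - G (real y - 1))"
    by (intro sum_mono step) auto
  also have "\<dots> = (\<Sum>y=1..m. G (real y) - G (real (y - 1)))"
    by (intro sum.cong) (auto simp: of_nat_diff)
  also have "\<dots> = G (real m) - G 0"
    using sum_telescope''[of 0 m "\<lambda>y. G (real y)"] by (simp add: atLeastSucAtMost_greaterThanAtMost)
  also have "\<dots> \<le> pi"
    unfolding G_def using arctan_ubound[of "sqrt (real m / x)"] by simp
  finally show ?thesis .
qed

text \<open>Weighted AM-GM with weight sqrt(x/y) on each product reduces everything to the row sums.
  The right-hand side is kept additive rather than a product of norms because it is applied to two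
  disjoint pieces of one unit vector, whose squares add up to at most 1.\<close>

lemma hilbert_inequality:
  fixes f g :: "nat \<Rightarrow> real"
  assumes f: "\<And>x. 0 \<le> f x" and g: "\<And>x. 0 \<le> g x"
  shows "(\<Sum>x=1..m. \<Sum>y=1..m. f x * g y / (real x + real y))
    \<le> pi / 2 * ((\<Sum>x=1..m. (f x)\<^sup>2) + (\<Sum>y=1..m. (g y)\<^sup>2))"
proof -
  have pt: "f x * g y / (real x + real y)
      \<le> (f x)\<^sup>2 / 2 * (sqrt (real x / real y) / (real x + real y))
        + (g y)\<^sup>2 / 2 * (sqrt (real y / real x) / (real y + real x))"
    if "x \<in> {1..m}" "y \<in> {1..m}" for x y
  proof -
    define c where "c = sqrt (real x / real y)"
    have c: "0 < c" using that by (auto simp: c_def)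
    have ci: "sqrt (real y / real x) = 1 / c" by (simp add: c_def real_sqrt_divide)
    have "0 \<le> (f x * c - g y)\<^sup>2 / c" using c by simp
    also have "\<dots> = (f x)\<^sup>2 * c + (g y)\<^sup>2 * (1 / c) - 2 * (f x * g y)"
      using c by (simp add: power2_eq_square field_simps)
    finally have "f x * g y \<le> (f x)\<^sup>2 / 2 * c + (g y)\<^sup>2 / 2 * (1 / c)" by simp
    then have "f x * g y / (real x + real y) \<le> ((f x)\<^sup>2 / 2 * c + (g y)\<^sup>2 / 2 * (1 / c)) / (real x + real y)"
      by (rule divide_right_mono) simp
    then show ?thesis
      unfolding ci c_def[symmetric] by (simp add: add_divide_distrib add.commute)
  qed
  have "(\<Sum>x=1..m. \<Sum>y=1..m. f x * g y / (real x + real y))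
      \<le> (\<Sum>x=1..m. \<Sum>y=1..m. (f x)\<^sup>2 / 2 * (sqrt (real x / real y) / (real x + real y))
        + (g y)\<^sup>2 / 2 * (sqrt (real y / real x) / (real y + real x)))"
    by (intro sum_mono pt)
  also have "\<dots> = (\<Sum>x=1..m. (f x)\<^sup>2 / 2 * (\<Sum>y=1..m. sqrt (real x / real y) / (real x + real y)))
      + (\<Sum>x=1..m. \<Sum>y=1..m. (g y)\<^sup>2 / 2 * (sqrt (real y / real x) / (real y + real x)))"
    by (simp add: sum.distrib sum_distrib_left)
  also have "(\<Sum>x=1..m. \<Sum>y=1..m. (g y)\<^sup>2 / 2 * (sqrt (real y / real x) / (real y + real x)))
      = (\<Sum>y=1..m. (g y)\<^sup>2 / 2 * (\<Sum>x=1..m. sqrt (real y / real x) / (real y + real x)))"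
    by (subst sum.swap) (simp add: sum_distrib_left)
  also have "(\<Sum>x=1..m. (f x)\<^sup>2 / 2 * (\<Sum>y=1..m. sqrt (real x / real y) / (real x + real y)))
      + (\<Sum>y=1..m. (g y)\<^sup>2 / 2 * (\<Sum>x=1..m. sqrt (real y / real x) / (real y + real x)))
      \<le> (\<Sum>x=1..m. (f x)\<^sup>2 / 2 * pi) + (\<Sum>y=1..m. (g y)\<^sup>2 / 2 * pi)"
    by (intro add_mono sum_mono mult_left_mono hilbert_row_sum) auto
  also have "\<dots> = pi / 2 * ((\<Sum>x=1..m. (f x)\<^sup>2) + (\<Sum>y=1..m. (g y)\<^sup>2))"
    by (simp add: sum_distrib_left sum_distrib_right algebra_simps)
  finally show ?thesis .
qed

text \<open>The coefficient at n - j correlates only the first j with the last j entries of the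
  Fejer-Riesz vector. Counting x = s + 1 from the front and y = j - s from the back gives x + y = j
  + 1, so the weight 1/(j+1) is the Hilbert kernel. As 2m \<le> n, front and back do not
  overlap.\<close>

lemma reversed_coeff_sum_bound:
  assumes nonneg: "nonneg_on_circle (laurent n a)" and m: "2 * m \<le> n" and n: "0 < n"
  shows "\<bar>\<Sum>j=1..m. a (n - j) / (real j + 1)\<bar> \<le> pi / 2"
proof -
  obtain p :: "nat \<Rightarrow> complex" where
      corr: "\<And>j. j \<in> {1..<n} \<Longrightarrow> (\<Sum>s<n - j. p (s + j) * cnj (p s)) = of_real (a j)"
      and norm: "(\<Sum>s<n. p s * cnj (p s)) = 1"
    using fejer_riesz_laurent[OF nonneg n] by blast
  define f where "f x = cmod (p (x - 1))" for x
  define g where "g y = cmod (p (n - y))" for y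
  have sq: "(\<Sum>s<n. (cmod (p s))\<^sup>2) = 1"
  proof -
    have "complex_of_real (\<Sum>s<n. (cmod (p s))\<^sup>2) = 1"
      unfolding of_real_sum using norm by (simp only: complex_norm_square)
    then show ?thesis by (simp only: of_real_eq_1_iff)
  qed
  have pt: "\<bar>a (n - j)\<bar> / (real j + 1) \<le> (\<Sum>s<j. f (s + 1) * g (j - s) / (real (s + 1) + real (j - s)))"
    if j: "j \<in> {1..m}" for j
  proof -
    have "n - j \<in> {1..<n}" using j m by auto
    then have "\<bar>a (n - j)\<bar> = cmod (\<Sum>s<n - (n - j). p (s + (n - j)) * cnj (p s))"
      by (simp only: corr norm_of_real)
    also have "\<dots> \<le> (\<Sum>s<n - (n - j). cmod (p (s + (n - j)) * cnj (p s)))" by (rule norm_sum)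
    also have "\<dots> = (\<Sum>s<j. f (s + 1) * g (j - s))"
    proof (rule sum.cong)
      fix s assume s: "s \<in> {..<j}"
      then have "s + (n - j) = n - (j - s)" using j m by auto
      then show "cmod (p (s + (n - j)) * cnj (p s)) = f (s + 1) * g (j - s)"
        by (simp add: f_def g_def norm_mult)
    qed (use j m in auto)
    finally have "\<bar>a (n - j)\<bar> / (real j + 1) \<le> (\<Sum>s<j. f (s + 1) * g (j - s)) / (real j + 1)"
      by (rule divide_right_mono) simp
    also have "\<dots> = (\<Sum>s<j. f (s + 1) * g (j - s) / (real (s + 1) + real (j - s)))"
      unfolding sum_divide_distrib by (intro sum.cong) (auto simp: of_nat_diff)
    finally show ?thesis .
  qed
  \<comment> \<open>The pairs (s+1, j-s) are distinct points of the square with sides {1..m};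
    filling up the square only adds nonnegative terms.\<close>
  define G where "G = (\<lambda>(x, y). f x * g y / (real x + real y))"
  have "\<bar>\<Sum>j=1..m. a (n - j) / (real j + 1)\<bar> \<le> (\<Sum>j=1..m. \<bar>a (n - j)\<bar> / (real j + 1))"
    by (rule order_trans[OF sum_abs]) simp
  also have "\<dots> \<le> (\<Sum>j=1..m. \<Sum>s<j. G (s + 1, j - s))"
    using pt by (intro sum_mono) (simp add: G_def)
  also have "\<dots> = (\<Sum>(j, s)\<in>Sigma {1..m} (\<lambda>j. {..<j}). G (s + 1, j - s))"
    by (subst sum.Sigma) auto
  also have "\<dots> = sum G ((\<lambda>(j, s). (s + 1, j - s)) ` Sigma {1..m} (\<lambda>j. {..<j}))"
    by (subst sum.reindex) (auto simp: inj_on_def case_prod_unfold)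
  also have "\<dots> \<le> sum G ({1..m} \<times> {1..m})"
    by (rule sum_mono2) (auto simp: G_def f_def g_def)
  also have "\<dots> = (\<Sum>x=1..m. \<Sum>y=1..m. f x * g y / (real x + real y))"
    by (simp add: G_def sum.cartesian_product)
  also have "\<dots> \<le> pi / 2 * ((\<Sum>x=1..m. (f x)\<^sup>2) + (\<Sum>y=1..m. (g y)\<^sup>2))"
    by (rule hilbert_inequality) (auto simp: f_def g_def)
  also have "(\<Sum>x=1..m. (f x)\<^sup>2) = (\<Sum>s<m. (cmod (p s))\<^sup>2)"
    by (rule sum.reindex_bij_witness[of _ "\<lambda>s. s + 1" "\<lambda>x. x - 1"]) (auto simp: f_def)
  also have "(\<Sum>y=1..m. (g y)\<^sup>2) = (\<Sum>s\<in>{n - m..<n}. (cmod (p s))\<^sup>2)"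
    using m by (intro sum.reindex_bij_witness[of _ "\<lambda>s. n - s" "\<lambda>y. n - y"]) (auto simp: g_def)
  also have "(\<Sum>s<m. (cmod (p s))\<^sup>2) + (\<Sum>s\<in>{n - m..<n}. (cmod (p s))\<^sup>2)
      = (\<Sum>s\<in>{..<m} \<union> {n - m..<n}. (cmod (p s))\<^sup>2)"
    using m by (subst sum.union_disjoint) auto
  also have "\<dots> \<le> (\<Sum>s<n. (cmod (p s))\<^sup>2)"
    using m by (intro sum_mono2) auto
  finally show ?thesis using sq by simp
qed

text \<open>The weights 1/(j+1) make the functional logarithmically large at the Fejer kernel while
  each of q_t and q_{t+1} contributes at most pi/2 to a step. The losses 1 + 1/2 + ln 2 are rounded
  up to 3.\<close>

lemma path_length_lower_bound:
  fixes q :: "nat \<Rightarrow> nat \<Rightarrow> real"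
  assumes n: "0 < n"
    and nonneg: "\<And>t. t \<le> k \<Longrightarrow> nonneg_on_circle (laurent n (q t))"
    and start: "\<And>j. j \<in> {1..<n} \<Longrightarrow> q 0 j = 1 - real j / real n"
    and final: "\<And>j. j \<in> {1..<n} \<Longrightarrow> q k j = 0"
    and step: "\<And>t j. t < k \<Longrightarrow> j \<in> {1..<n} \<Longrightarrow>
      q (Suc t) (n - j) - q t (n - j) = (- 1) ^ t * (q (Suc t) j - q t j)"
  shows "ln (real n) \<le> pi * real k + 3"
proof -
  define m where "m = n div 2"
  have m: "2 * m \<le> n" "m < n" using n by (auto simp: m_def)
  define \<phi> where "\<phi> a = (\<Sum>j=1..m. a j / (real j + 1))" for a :: "nat \<Rightarrow> real"
  have change: "\<phi> (q t) - \<phi> (q (Suc t)) \<le> pi" if t: "t < k" for t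
  proof -
    define S where "S u = (\<Sum>j=1..m. q u (n - j) / (real j + 1))" for u
    have S: "\<bar>S u\<bar> \<le> pi / 2" if "u \<le> k" for u
      unfolding S_def by (rule reversed_coeff_sum_bound[OF nonneg[OF that] m(1) n])
    have "\<phi> (q t) - \<phi> (q (Suc t)) = (- 1) ^ t * (S t - S (Suc t))"
      unfolding \<phi>_def S_def sum_subtractf[symmetric] sum_distrib_left
    proof (rule sum.cong)
      fix j assume "j \<in> {1..m}"
      then have "j \<in> {1..<n}" using m by auto
      from step[OF t this] show "q t j / (real j + 1) - q (Suc t) j / (real j + 1)
          = (- 1) ^ t * (q t (n - j) / (real j + 1) - q (Suc t) (n - j) / (real j + 1))"
        by (cases "even t") (auto simp: diff_divide_distrib[symmetric])
    qed simp
    also have "\<dots> \<le> \<bar>S t\<bar> + \<bar>S (Suc t)\<bar>"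
      by (cases "even t") auto
    also have "\<dots> \<le> pi" using S[of t] S[of "Suc t"] t by simp
    finally show ?thesis .
  qed
  have "\<phi> (q 0) - \<phi> (q u) \<le> pi * real u" if "u \<le> k" for u
    using that
  proof (induction u)
    case (Suc u)
    then show ?case using change[of u] by (simp add: algebra_simps)
  qed simp
  from this[of k] have up: "\<phi> (q 0) \<le> pi * real k"
    using final m by (simp add: \<phi>_def)
  \<comment> \<open>The 1 is the term of the harmonic number missing from the functional; the 1/2
    pays for the part j/n of the Fejer coefficients, at most 1/n for each of the m \<le> n/2
    terms.\<close>
  have "harm (Suc m) - 1 - 1 / 2 \<le> \<phi> (q 0)"
  proof -
    have "harm (Suc m) = 1 + (\<Sum>j=1..m. 1 / (real j + 1))"
      unfolding harm_def by (subst sum.atLeast_Suc_atMost) (auto simp: sum.shift_bounds_cl_Suc_ivl field_simps simp del: sum.cl_ivl_Suc)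
    moreover have "(\<Sum>j=1..m. 1 / real n) \<le> 1 / 2"
      using m n by (simp add: field_simps)
    moreover have "(\<Sum>j=1..m. 1 / (real j + 1)) - (\<Sum>j=1..m. 1 / real n) \<le> \<phi> (q 0)"
      unfolding \<phi>_def sum_subtractf[symmetric]
    proof (rule sum_mono)
      fix j assume "j \<in> {1..m}"
      then have "j \<in> {1..<n}" using m by auto
      then show "1 / (real j + 1) - 1 / real n \<le> q 0 j / (real j + 1)"
      proof -
        have "real j / real n / (real j + 1) = real j / (real j + 1) / real n" by (simp add: mult.commute)
        also have "\<dots> \<le> 1 / real n" by (intro divide_right_mono) auto
        finally have "real j / real n / (real j + 1) \<le> 1 / real n" .
        then show ?thesis using start[OF \<open>j \<in> {1..<n}\<close>] by (simp add: diff_divide_distrib)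
      qed
    qed
    ultimately show ?thesis by linarith
  qed
  moreover have "ln (real (Suc m) + 1) \<le> harm (Suc m)" by (rule ln_le_harm)
  moreover have "ln (real n / 2) \<le> ln (real (Suc m) + 1)"
    using n by (subst ln_le_cancel_iff) (auto simp: m_def)
  moreover have "ln (real n / 2) = ln (real n) - ln 2" using n by (simp add: ln_div)
  moreover have "ln (2::real) \<le> 1" using ln_le_minus_one[of 2] by simp
  ultimately show ?thesis using up by linarith
qed

section \<open>Closed forms and positivity of packet pairs\<close>

definition cos_sum :: "nat \<Rightarrow> (nat \<Rightarrow> real) \<Rightarrow> real \<Rightarrow> real" where
  "cos_sum n a \<theta> = 1 + (\<Sum>j\<in>{1..<n}. a j * (2 * cos (real j * \<theta>)))"

lemma laurent_cis: "laurent n a (cis \<theta>) = of_real (cos_sum n a \<theta>)"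
proof -
  have "of_real (a j) * (cis \<theta> ^ j + inverse (cis \<theta>) ^ j) = complex_of_real (a j * (2 * cos (real j * \<theta>)))" for j
    by (simp add: Complex.DeMoivre complex_eq_iff)
  then show ?thesis unfolding laurent_def cos_sum_def of_real_add of_real_sum of_real_1 by (simp only:)
qed

lemma nonneg_on_circle_iff: "nonneg_on_circle (laurent n a) \<longleftrightarrow> (\<forall>\<theta>. 0 \<le> cos_sum n a \<theta>)"
proof
  assume L: "nonneg_on_circle (laurent n a)"
  show "\<forall>\<theta>. 0 \<le> cos_sum n a \<theta>"
  proof
    fix \<theta>
    have "laurent n a (cis \<theta>) \<in> \<real>\<^sub>\<ge>\<^sub>0" using L by (simp add: nonneg_on_circle_def)
    then show "0 \<le> cos_sum n a \<theta>" by (simp add: laurent_cis)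
  qed
next
  assume R: "\<forall>\<theta>. 0 \<le> cos_sum n a \<theta>"
  show "nonneg_on_circle (laurent n a)"
    unfolding nonneg_on_circle_def
  proof (intro allI impI)
    fix z :: complex assume "cmod z = 1"
    then have "z = cis (Arg z)" using rcis_cmod_Arg[of z] by (simp add: rcis_def)
    then have "laurent n a z = of_real (cos_sum n a (Arg z))" using laurent_cis by metis
    then show "laurent n a z \<in> \<real>\<^sub>\<ge>\<^sub>0" using R by simp
  qed
qed

text \<open>Both G(j) and cos(j \<theta>) satisfy three-term recurrences, with constants 2C and 2
  cos \<theta>. Their discrete Wronskian \<open>V\<close> therefore changes by 2(C - cos \<theta>)
  times their product, as in the Christoffel-Darboux formula.\<close>

lemma cos_sum_telescope:
  fixes G :: "nat \<Rightarrow> real"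
  assumes rec: "\<And>j. j \<in> {1..<n} \<Longrightarrow> G (Suc j) + G (j - 1) = 2 * C * G j" and n: "1 \<le> n"
  shows "2 * (C - cos \<theta>) * (\<Sum>j\<in>{1..<n}. G j * cos (real j * \<theta>))
    = G n * cos (real (n - 1) * \<theta>) - G (n - 1) * cos (real n * \<theta>) - (G 1 - G 0 * cos \<theta>)"
proof -
  define V where "V j = G j * cos (real (j - 1) * \<theta>) - G (j - 1) * cos (real j * \<theta>)" for j
  have "2 * (C - cos \<theta>) * (G j * cos (real j * \<theta>)) = V (Suc j) - V j" if j: "j \<in> {1..<n}" for j
  proof -
    have "cos (real (Suc j) * \<theta>) + cos (real (j - 1) * \<theta>) = 2 * cos \<theta> * cos (real j * \<theta>)"
    proof -
      have "real (Suc j) * \<theta> = real j * \<theta> + \<theta>" "real (j - 1) * \<theta> = real j * \<theta> - \<theta>"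
        using j by (auto simp: of_nat_diff algebra_simps)
      then show ?thesis by (simp add: cos_add cos_diff)
    qed
    then have "V (Suc j) - V j = (G (Suc j) + G (j - 1)) * cos (real j * \<theta>) - G j * (2 * cos \<theta> * cos (real j * \<theta>))"
      by (simp add: V_def algebra_simps flip: distrib_left)
    then show ?thesis unfolding rec[OF j] by (simp add: algebra_simps)
  qed
  then have "2 * (C - cos \<theta>) * (\<Sum>j\<in>{1..<n}. G j * cos (real j * \<theta>)) = (\<Sum>j\<in>{1..<n}. V (Suc j) - V j)"
    unfolding sum_distrib_left by (rule sum.cong[OF refl])
  also have "\<dots> = V n - V 1" using n by (rule sum_Suc_diff')
  finally show ?thesis by (simp add: V_def)
qed

text \<open>The full sum over 0 \<le> j \<le> n with half weight at both ends, where the symmetric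
  packet formula takes the value 1/2. In \<open>kernel_a\<close> the values are 1/2 and -1/2, so in
  the sum of the two kernels the ends at n cancel and those at 0 give the constant coefficient
  1.\<close>

definition kernel_s :: "nat \<Rightarrow> real \<Rightarrow> real \<Rightarrow> real" where
  "kernel_s n l \<theta> = 1 / 2 + (\<Sum>j\<in>{1..<n}. packet_s n (ennreal l) j * (2 * cos (real j * \<theta>))) + cos (real n * \<theta>) / 2"

definition kernel_a :: "nat \<Rightarrow> real \<Rightarrow> real \<Rightarrow> real" where
  "kernel_a n l \<theta> = 1 / 2 + (\<Sum>j\<in>{1..<n}. packet_a n (ennreal l) j * (2 * cos (real j * \<theta>))) - cos (real n * \<theta>) / 2"

lemma cosh_minus_cos_pos: "x \<noteq> 0 \<Longrightarrow> 0 < cosh x - cos (t :: real)" for x :: real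
  using cosh_real_ge_1[of x] cosh_real_one_iff[of x] cos_le_one[of t] by linarith

lemma cos_pred: "1 \<le> n \<Longrightarrow> cos (real (n - 1) * \<theta>) = cos (real n * \<theta>) * cos \<theta> + sin (real n * \<theta>) * sin \<theta>"
proof -
  assume "1 \<le> n"
  then have "real (n - 1) * \<theta> = real n * \<theta> - \<theta>" by (simp add: of_nat_diff algebra_simps)
  then show ?thesis by (simp add: cos_diff)
qed

text \<open>The packet numerator G satisfies the recurrence with C = cosh(l/n), and G(n) = G(0); the
  half-weighted ends then combine the boundary terms of the telescoped sum into a multiple of 1 +
  cos(n \<theta>). For the antisymmetric kernel G(n) = -G(0) turns this into 1 - cos(n
  \<theta>).\<close>

lemma kernel_s_closed_form:
  assumes l: "0 < l" and n: "1 \<le> n"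
  shows "2 * kernel_s n l \<theta>
    = (tanh (l / 2) * sinh (l / n) * (1 + cos (real n * \<theta>)) + sin (real n * \<theta>) * sin \<theta>) / (cosh (l / n) - cos \<theta>)"
proof -
  define \<mu> where "\<mu> = l / n"
  define C where "C = cos (real n * \<theta>)"
  define S where "S = sin (real n * \<theta>)"
  define D where "D = cosh \<mu> - cos \<theta>"
  have D: "0 < D" unfolding D_def using l n by (intro cosh_minus_cos_pos) (simp add: \<mu>_def)
  have l\<mu>: "l = \<mu> * real n" using n by (simp add: \<mu>_def)
  define G where "G j = cosh (l / 2 - \<mu> * real j)" for j :: nat
  have rec: "G (Suc j) + G (j - 1) = 2 * cosh \<mu> * G j" if "j \<in> {1..<n}" for j
  proof -
    have "l / 2 - \<mu> * real (Suc j) = (l / 2 - \<mu> * real j) - \<mu>" "l / 2 - \<mu> * real (j - 1) = (l / 2 - \<mu> * real j) + \<mu>"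
      using that by (auto simp: of_nat_diff algebra_simps)
    moreover have "cosh (B - \<mu>) + cosh (B + \<mu>) = 2 * cosh \<mu> * cosh B" for B
      by (simp add: cosh_add cosh_diff)
    ultimately show ?thesis unfolding G_def by metis
  qed
  have G0: "G 0 = cosh (l / 2)" and G1: "G 1 = cosh (l / 2) * cosh \<mu> - sinh (l / 2) * sinh \<mu>"
    by (simp_all add: G_def cosh_diff)
  have Gn: "G n = cosh (l / 2)"
    using cosh_minus[of "l / 2"] by (simp add: G_def l\<mu> algebra_simps)
  have Gn1: "G (n - 1) = cosh (l / 2) * cosh \<mu> - sinh (l / 2) * sinh \<mu>"
  proof -
    have "l / 2 - \<mu> * real (n - 1) = - (l / 2 - \<mu>)" using n by (simp add: l\<mu> of_nat_diff algebra_simps)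
    then show ?thesis by (simp add: G_def cosh_diff del: minus_diff_eq)
  qed
  have c0: "cosh (l / 2) \<noteq> 0" by simp
  have tel: "2 * D * (\<Sum>j\<in>{1..<n}. G j * cos (real j * \<theta>))
      = cosh (l / 2) * (C * cos \<theta> + S * sin \<theta>) - (cosh (l / 2) * cosh \<mu> - sinh (l / 2) * sinh \<mu>) * C
        - (cosh (l / 2) * cosh \<mu> - sinh (l / 2) * sinh \<mu> - cosh (l / 2) * cos \<theta>)"
    using cos_sum_telescope[of n G "cosh \<mu>" \<theta>, OF rec n] unfolding G0 G1 Gn Gn1 cos_pred[OF n] C_def S_def D_def
    by simp
  have sum: "(\<Sum>j\<in>{1..<n}. packet_s n (ennreal l) j * (2 * cos (real j * \<theta>)))
      = (\<Sum>j\<in>{1..<n}. G j * cos (real j * \<theta>)) / cosh (l / 2)"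
    unfolding sum_divide_distrib using l n
    by (intro sum.cong) (auto simp: packet_finite G_def \<mu>_def algebra_simps)
  have "2 * kernel_s n l \<theta> * D = D * (1 + C) + 2 * D * (\<Sum>j\<in>{1..<n}. G j * cos (real j * \<theta>)) / cosh (l / 2)"
    unfolding kernel_s_def sum C_def by (simp add: algebra_simps)
  also have "\<dots> = tanh (l / 2) * sinh \<mu> * (1 + C) + S * sin \<theta>"
    unfolding tel unfolding D_def tanh_def using c0 by (simp add: field_simps)
  finally show ?thesis using D by (simp add: C_def S_def D_def \<mu>_def field_simps)
qed

lemma kernel_a_closed_form:
  assumes l: "0 < l" and n: "1 \<le> n"
  shows "2 * kernel_a n l \<theta>
    = (sinh (l / n) / tanh (l / 2) * (1 - cos (real n * \<theta>)) - sin (real n * \<theta>) * sin \<theta>) / (cosh (l / n) - cos \<theta>)"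
proof -
  define \<mu> where "\<mu> = l / n"
  define C where "C = cos (real n * \<theta>)"
  define S where "S = sin (real n * \<theta>)"
  define D where "D = cosh \<mu> - cos \<theta>"
  have D: "0 < D" unfolding D_def using l n by (intro cosh_minus_cos_pos) (simp add: \<mu>_def)
  have l\<mu>: "l = \<mu> * real n" using n by (simp add: \<mu>_def)
  define G where "G j = sinh (l / 2 - \<mu> * real j)" for j :: nat
  have rec: "G (Suc j) + G (j - 1) = 2 * cosh \<mu> * G j" if "j \<in> {1..<n}" for j
  proof -
    have "l / 2 - \<mu> * real (Suc j) = (l / 2 - \<mu> * real j) - \<mu>" "l / 2 - \<mu> * real (j - 1) = (l / 2 - \<mu> * real j) + \<mu>"
      using that by (auto simp: of_nat_diff algebra_simps)
    moreover have "sinh (B - \<mu>) + sinh (B + \<mu>) = 2 * cosh \<mu> * sinh B" for B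
      by (simp add: sinh_add sinh_diff)
    ultimately show ?thesis unfolding G_def by metis
  qed
  have G0: "G 0 = sinh (l / 2)" and G1: "G 1 = sinh (l / 2) * cosh \<mu> - cosh (l / 2) * sinh \<mu>"
    by (simp_all add: G_def sinh_diff)
  have Gn: "G n = - sinh (l / 2)"
    using sinh_minus[of "l / 2"] by (simp add: G_def l\<mu> algebra_simps)
  have Gn1: "G (n - 1) = - (sinh (l / 2) * cosh \<mu> - cosh (l / 2) * sinh \<mu>)"
  proof -
    have "l / 2 - \<mu> * real (n - 1) = - (l / 2 - \<mu>)" using n by (simp add: l\<mu> of_nat_diff algebra_simps)
    then show ?thesis by (simp add: G_def sinh_diff del: minus_diff_eq)
  qed
  have c0: "sinh (l / 2) \<noteq> 0" "cosh (l / 2) \<noteq> 0" using l by auto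
  have tel: "2 * D * (\<Sum>j\<in>{1..<n}. G j * cos (real j * \<theta>))
      = - sinh (l / 2) * (C * cos \<theta> + S * sin \<theta>) + (sinh (l / 2) * cosh \<mu> - cosh (l / 2) * sinh \<mu>) * C
        - (sinh (l / 2) * cosh \<mu> - cosh (l / 2) * sinh \<mu> - sinh (l / 2) * cos \<theta>)"
    using cos_sum_telescope[of n G "cosh \<mu>" \<theta>, OF rec n] unfolding G0 G1 Gn Gn1 cos_pred[OF n] C_def S_def D_def
    by (simp add: algebra_simps)
  have sum: "(\<Sum>j\<in>{1..<n}. packet_a n (ennreal l) j * (2 * cos (real j * \<theta>)))
      = (\<Sum>j\<in>{1..<n}. G j * cos (real j * \<theta>)) / sinh (l / 2)"
    unfolding sum_divide_distrib using l n
    by (intro sum.cong) (auto simp: packet_finite G_def \<mu>_def algebra_simps)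
  have "2 * kernel_a n l \<theta> * D = D * (1 - C) + 2 * D * (\<Sum>j\<in>{1..<n}. G j * cos (real j * \<theta>)) / sinh (l / 2)"
    unfolding kernel_a_def sum C_def by (simp add: algebra_simps)
  also have "\<dots> = sinh \<mu> / tanh (l / 2) * (1 - C) - S * sin \<theta>"
    unfolding tel unfolding D_def tanh_def using c0 by (simp add: field_simps)
  finally show ?thesis using D by (simp add: C_def S_def D_def \<mu>_def field_simps)
qed

text \<open>In half angles 1 + c, 1 - c and s are twice a square, a square and a product, so this is
  a binary quadratic form and the bound on d^2 is its discriminant condition.\<close>

lemma quadratic_form_nonneg:
  fixes a b c d s :: real
  assumes "0 \<le> a" "0 \<le> b" "d\<^sup>2 \<le> 4 * a * b" "c\<^sup>2 + s\<^sup>2 = 1"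
  shows "0 \<le> a * (1 + c) + b * (1 - c) + d * s"
proof -
  have c: "\<bar>c\<bar> \<le> 1" using assms(4) by (metis abs_square_le_1 le_add_same_cancel1 zero_le_power2)
  have s2: "s\<^sup>2 = (1 + c) * (1 - c)" using assms(4) by (simp add: power2_eq_square algebra_simps)
  have nn: "0 \<le> (1 + c) * (1 - c)" using c by (intro mult_nonneg_nonneg) auto
  have "(d * s)\<^sup>2 = d\<^sup>2 * ((1 + c) * (1 - c))" by (simp add: power_mult_distrib s2)
  also have "\<dots> \<le> (4 * a * b) * ((1 + c) * (1 - c))" using assms(3) nn by (rule mult_right_mono)
  also have "\<dots> \<le> (4 * a * b) * ((1 + c) * (1 - c)) + (a * (1 + c) - b * (1 - c))\<^sup>2" by simp
  also have "\<dots> = (a * (1 + c) + b * (1 - c))\<^sup>2" by (simp add: power2_eq_square algebra_simps)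
  finally have "\<bar>d * s\<bar> \<le> \<bar>a * (1 + c) + b * (1 - c)\<bar>" by (simp add: abs_le_square_iff)
  moreover have "0 \<le> a * (1 + c) + b * (1 - c)" using assms(1,2) c
    by (intro add_nonneg_nonneg[OF mult_nonneg_nonneg mult_nonneg_nonneg]) auto
  ultimately show ?thesis by linarith
qed

section \<open>Nonnegativity for single pairs of packets\<close>

text \<open>The point is a criterion free of \<theta>. With v = sinh(\<mu>/2) and S =
  sin^2(\<theta>/2) the denominators are 2(v^2 + S) and 2(v'^2 + S), their difference contains (v' -
  v)(v' + v), and S (v + v')^2 \<le> (v^2 + S)(v'^2 + S) together with sin^2 \<theta> \<le> 4S
  absorbs the dependence on \<theta> in the discriminant condition.\<close>

lemma kernel_sum_nonneg:
  assumes l: "0 < l" and l': "0 < l'" and n: "1 \<le> n"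
    and close: "(sinh (l' / n / 2) - sinh (l / n / 2))\<^sup>2 \<le> tanh (l / 2) / tanh (l' / 2) * sinh (l / n) * sinh (l' / n)"
  shows "0 \<le> kernel_s n l \<theta> + kernel_a n l' \<theta>"
proof -
  define \<mu> \<mu>' where "\<mu> = l / n" and "\<mu>' = l' / n"
  define v v' S where "v = sinh (\<mu> / 2)" and "v' = sinh (\<mu>' / 2)" and "S = (sin (\<theta> / 2))\<^sup>2"
  have \<mu>: "0 < \<mu>" "0 < \<mu>'" using l l' n by (auto simp: \<mu>_def \<mu>'_def)
  have v: "0 < v" "0 < v'" using \<mu> by (auto simp: v_def v'_def)
  have cosh_v: "cosh \<mu> = 1 + 2 * v\<^sup>2" "cosh \<mu>' = 1 + 2 * v'\<^sup>2"
    using cosh_double[of "\<mu> / 2"] cosh_double[of "\<mu>' / 2"] hyperbolic_pythagoras[of "\<mu> / 2"] hyperbolic_pythagoras[of "\<mu>' / 2"]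
    by (simp_all add: v_def v'_def)
  have cos_S: "cos \<theta> = 1 - 2 * S" using cos_double_sin[of "\<theta> / 2"] by (simp add: S_def)
  define D D' where "D = cosh \<mu> - cos \<theta>" and "D' = cosh \<mu>' - cos \<theta>"
  have D: "0 < D" "0 < D'" unfolding D_def D'_def using \<mu> by (intro cosh_minus_cos_pos; simp)+
  have D_eq: "D = 2 * (v\<^sup>2 + S)" "D' = 2 * (v'\<^sup>2 + S)" by (simp_all add: D_def D'_def cosh_v cos_S)
  have S0: "0 \<le> S" by (simp add: S_def)
  define \<tau> where "\<tau> = tanh (l / 2) / tanh (l' / 2)"
  have th: "0 < tanh (l / 2)" "0 < tanh (l' / 2)" using l l' by auto
  have close': "(v' - v)\<^sup>2 \<le> \<tau> * sinh \<mu> * sinh \<mu>'"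
    using close by (simp add: v_def v'_def \<tau>_def \<mu>_def \<mu>'_def)
  have "(sin \<theta>)\<^sup>2 = 4 * S * (1 - S)"
    using sin_cos_squared_add[of \<theta>] unfolding cos_S by (simp add: power2_eq_square algebra_simps)
  then have "(sin \<theta>)\<^sup>2 = 4 * S - 4 * (S * S)" by (simp add: algebra_simps)
  then have sin2: "(sin \<theta>)\<^sup>2 \<le> 4 * S" using mult_nonneg_nonneg[OF S0 S0] by linarith
  have amgm: "4 * (S * (v + v')\<^sup>2) \<le> D * D'"
  proof -
    have "D * D' = 4 * (S * (v + v')\<^sup>2) + 4 * (v * v' - S)\<^sup>2"
      unfolding D_eq by (simp add: power2_eq_square algebra_simps)
    then show ?thesis by simp
  qed
  have "(sin \<theta> * (D' - D))\<^sup>2 = (sin \<theta>)\<^sup>2 * (2 * (v'\<^sup>2 - v\<^sup>2))\<^sup>2"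
    unfolding D_eq by (simp add: power_mult_distrib)
  also have "\<dots> \<le> 4 * S * (2 * (v'\<^sup>2 - v\<^sup>2))\<^sup>2" using sin2 by (intro mult_right_mono) auto
  also have "\<dots> = 4 * (v' - v)\<^sup>2 * (4 * (S * (v + v')\<^sup>2))" by (simp add: power2_eq_square algebra_simps)
  also have "\<dots> \<le> 4 * (\<tau> * sinh \<mu> * sinh \<mu>') * (D * D')"
  proof (rule mult_mono)
    show "4 * (v' - v)\<^sup>2 \<le> 4 * (\<tau> * sinh \<mu> * sinh \<mu>')" using close' by simp
    have "0 < \<tau>" using th by (simp add: \<tau>_def)
    then show "0 \<le> 4 * (\<tau> * sinh \<mu> * sinh \<mu>')" using \<mu> by simp
  qed (use amgm S0 in auto)
  finally have key: "(sin \<theta> * (D' - D))\<^sup>2 \<le> 4 * (\<tau> * sinh \<mu> * sinh \<mu>') * (D * D')" .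
  define a b d where "a = tanh (l / 2) * sinh \<mu> / D" and "b = sinh \<mu>' / tanh (l' / 2) / D'"
    and "d = sin \<theta> / D - sin \<theta> / D'"
  have "d = sin \<theta> * (D' - D) / (D * D')" using D by (simp add: d_def field_simps)
  then have "d\<^sup>2 = (sin \<theta> * (D' - D))\<^sup>2 / (D * D')\<^sup>2" by (simp add: power_divide)
  also have "\<dots> \<le> 4 * (\<tau> * sinh \<mu> * sinh \<mu>') * (D * D') / (D * D')\<^sup>2"
    using key by (rule divide_right_mono) simp
  also have "\<dots> = 4 * a * b" using D th by (simp add: a_def b_def \<tau>_def power2_eq_square mult_ac)
  finally have "d\<^sup>2 \<le> 4 * a * b" .
  moreover have "0 \<le> a" "0 \<le> b" using D th \<mu> by (auto simp: a_def b_def)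
  ultimately have "0 \<le> a * (1 + cos (real n * \<theta>)) + b * (1 - cos (real n * \<theta>)) + d * sin (real n * \<theta>)"
    by (intro quadratic_form_nonneg) auto
  also have "\<dots> = 2 * kernel_s n l \<theta> + 2 * kernel_a n l' \<theta>"
    unfolding kernel_s_closed_form[OF l n] kernel_a_closed_form[OF l' n] a_def b_def d_def D_def D'_def \<mu>_def \<mu>'_def
    by (simp add: add_divide_distrib diff_divide_distrib algebra_simps)
  finally show ?thesis by simp
qed

lemma kernel_sum_nonneg_same:
  assumes "0 < l" "1 \<le> n"
  shows "0 \<le> kernel_s n l \<theta> + kernel_a n l \<theta>"
  using assms by (intro kernel_sum_nonneg) auto

text \<open>The ratio of the tanh factors is at least 1/2 in either order. In terms of v and c =
  cosh(\<mu>/2) the criterion then reduces to (2vc - v)^2 \<le> 4 v^2 c^2. It holds at every scale,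
  hence survives averaging without any property of the density.\<close>

lemma kernel_sum_nonneg_double:
  assumes l: "0 < l" and n: "1 \<le> n"
  shows "0 \<le> kernel_s n (2 * l) \<theta> + kernel_a n l \<theta>" "0 \<le> kernel_s n l \<theta> + kernel_a n (2 * l) \<theta>"
proof -
  define \<mu> where "\<mu> = l / n"
  have \<mu>: "0 < \<mu>" using l n by (simp add: \<mu>_def)
  define v c where "v = sinh (\<mu> / 2)" and "c = cosh (\<mu> / 2)"
  have vc: "0 < v" "1 \<le> c" using \<mu> cosh_real_ge_1 by (auto simp: v_def c_def)
  have s1: "sinh \<mu> = 2 * v * c" using sinh_double[of "\<mu> / 2"] by (simp add: v_def c_def)
  have s2: "sinh (2 * \<mu>) = 2 * (2 * v * c) * cosh \<mu>" using sinh_double[of \<mu>] s1 by simp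
  have "(2 * c - 1)\<^sup>2 \<le> (2 * c)\<^sup>2" using vc by (intro power_mono) auto
  then have "v\<^sup>2 * (2 * c - 1)\<^sup>2 \<le> v\<^sup>2 * (2 * c)\<^sup>2" by (intro mult_left_mono) auto
  then have base: "(2 * v * c - v)\<^sup>2 \<le> 4 * v\<^sup>2 * c\<^sup>2" by (simp add: power2_eq_square algebra_simps)
  have main: "(sinh \<mu> - sinh (\<mu> / 2))\<^sup>2 \<le> r * sinh \<mu> * sinh (2 * \<mu>)" if "1 / 2 \<le> r" for r
  proof -
    have "4 * v\<^sup>2 * c\<^sup>2 * 1 \<le> 4 * v\<^sup>2 * c\<^sup>2 * cosh \<mu>" using cosh_real_ge_1[of \<mu>] by (intro mult_left_mono) auto
    also have "\<dots> = (1 / 2) * (sinh \<mu> * sinh (2 * \<mu>))"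
      unfolding s1 s2 by (simp add: power2_eq_square)
    also have "\<dots> \<le> r * (sinh \<mu> * sinh (2 * \<mu>))" using that \<mu> by (intro mult_right_mono) auto
    finally have "4 * v\<^sup>2 * c\<^sup>2 \<le> r * sinh \<mu> * sinh (2 * \<mu>)" by (simp add: mult.assoc)
    moreover have "(sinh \<mu> - sinh (\<mu> / 2))\<^sup>2 \<le> 4 * v\<^sup>2 * c\<^sup>2" using base unfolding s1 v_def[symmetric] .
    ultimately show ?thesis by linarith
  qed
  have th: "0 < tanh (l / 2)" "tanh (l / 2) < 1" using l tanh_real_lt_1 by auto
  have "tanh l = 2 * tanh (l / 2) / (1 + (tanh (l / 2))\<^sup>2)"
    using tanh_add[of "l / 2" "l / 2"] by (simp add: power2_eq_square)
  moreover have "2 * tanh (l / 2) / (1 + (tanh (l / 2))\<^sup>2) \<le> 2 * tanh (l / 2) / 1"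
    using th by (intro divide_left_mono) (auto simp: add_pos_nonneg)
  ultimately have "tanh l \<le> 2 * tanh (l / 2)" by simp
  moreover have "0 < tanh l" using l by simp
  ultimately have r1: "1 / 2 \<le> tanh (l / 2) / tanh l" by (simp add: field_simps)
  have "tanh (l / 2) \<le> tanh l" using l by simp
  then have "1 \<le> tanh l / tanh (l / 2)" using th by simp
  then have r2: "1 / 2 \<le> tanh l / tanh (l / 2)" by linarith
  show "0 \<le> kernel_s n (2 * l) \<theta> + kernel_a n l \<theta>"
    using main[OF r2] l n by (intro kernel_sum_nonneg) (auto simp: \<mu>_def power2_commute mult_ac)
  show "0 \<le> kernel_s n l \<theta> + kernel_a n (2 * l) \<theta>"
    using main[OF r1] l n by (intro kernel_sum_nonneg) (auto simp: \<mu>_def mult_ac)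
qed

section \<open>Elementary bounds for hyperbolic functions\<close>

lemma sinh_mean_value: "0 < x \<Longrightarrow> \<exists>z. 0 < z \<and> z < x \<and> sinh x = x * cosh (z :: real)"
proof -
  assume x: "0 < x"
  have "(sinh has_real_derivative cosh y) (at y)" for y :: real
    by (auto intro!: derivative_eq_intros)
  then have "\<exists>z. 0 < z \<and> z < x \<and> sinh x - sinh 0 = (x - 0) * cosh z"
    using x by (intro MVT2) auto
  then show ?thesis by simp
qed

lemma le_sinh: "0 \<le> x \<Longrightarrow> x \<le> sinh (x :: real)"
proof (cases "x = 0")
  case False
  assume "0 \<le> x"
  with False obtain z where "sinh x = x * cosh z" using sinh_mean_value[of x] by auto
  then show ?thesis using \<open>0 \<le> x\<close> cosh_real_ge_1[of z] mult_left_mono[of 1 "cosh z" x] by simp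
qed simp

lemma tanh_le: "0 \<le> x \<Longrightarrow> tanh x \<le> (x :: real)"
proof (cases "x = 0")
  case False
  assume "0 \<le> x"
  with False obtain z where z: "0 < z" "z < x" "sinh x = x * cosh z" using sinh_mean_value[of x] by auto
  then have "sinh x \<le> x * cosh x" using \<open>0 \<le> x\<close> by (auto intro!: mult_left_mono simp: cosh_real_nonneg_le_iff)
  then show ?thesis by (simp add: tanh_def field_simps)
qed simp

lemma sinh_le_double: "0 \<le> x \<Longrightarrow> x \<le> 1 / 2 \<Longrightarrow> sinh x \<le> 2 * (x :: real)"
proof (cases "x = 0")
  case False
  assume x: "0 \<le> x" "x \<le> 1 / 2"
  then have "0 < x" using False by simp
  then obtain z where z: "0 < z" "z < x" "sinh x = x * cosh z" using sinh_mean_value by blast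
  have "cosh z \<le> exp z" using z by (simp add: cosh_def)
  also have "\<dots> \<le> exp (1 / 2)" using z x by simp
  also have "\<dots> \<le> 2" using exp_half_le2 by simp
  finally show ?thesis using z x by (simp add: mult_left_mono mult.commute)
qed simp

lemma half_le_tanh: "0 \<le> x \<Longrightarrow> x \<le> 1 / 2 \<Longrightarrow> x / 2 \<le> tanh (x :: real)"
proof -
  assume x: "0 \<le> x" "x \<le> 1 / 2"
  have "cosh x \<le> exp x" using x by (simp add: cosh_def)
  also have "\<dots> \<le> exp (1 / 2)" using x by simp
  also have "\<dots> \<le> 2" using exp_half_le2 by simp
  finally have "x / 2 \<le> x / cosh x" using x cosh_real_pos[of x] by (intro divide_left_mono) auto
  also have "\<dots> \<le> sinh x / cosh x" using x by (intro divide_right_mono) (auto simp: le_sinh)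
  finally show ?thesis by (simp add: tanh_def)
qed

text \<open>For leaving scale 0, where no multiplicative gain helps. The quotient
  sinh(l'/n)/tanh(l'/2) stays above 2/n as l' tends to 0, so the criterion holds for all l' \<le> l
  at once provided l \<le> 1.\<close>

lemma kernel_sum_nonneg_start:
  assumes l': "0 < l'" "l' \<le> l" and l: "l \<le> 1" and n: "1 \<le> n"
  shows "0 \<le> kernel_s n l \<theta> + kernel_a n l' \<theta>"
proof (rule kernel_sum_nonneg)
  define \<mu> \<mu>' where "\<mu> = l / n" and "\<mu>' = l' / n"
  have \<mu>: "0 < \<mu>'" "\<mu>' \<le> \<mu>" "0 < \<mu>" using l' l n by (auto simp: \<mu>_def \<mu>'_def divide_right_mono)
  define v where "v = sinh (\<mu> / 2)"
  have v0: "0 < v" using \<mu> by (simp add: v_def)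
  have \<mu>_half: "\<mu> / 2 \<le> 1 / 2" using l l' n unfolding \<mu>_def by (simp add: field_simps)
  have "(sinh (\<mu>' / 2) - v)\<^sup>2 = (v - sinh (\<mu>' / 2))\<^sup>2" by (rule power2_commute)
  also have "\<dots> \<le> v\<^sup>2" using \<mu> by (intro power_mono) (auto simp: v_def)
  also have "\<dots> \<le> tanh (l / 2) * (2 * v) * (2 / n)"
  proof -
    have "v \<le> \<mu>" using sinh_le_double[of "\<mu> / 2"] \<mu>_half \<mu> by (simp add: v_def)
    also have "\<dots> \<le> tanh (l / 2) * 2 * (2 / n)"
      using half_le_tanh[of "l / 2"] l l' n by (simp add: \<mu>_def field_simps)
    finally have "v * v \<le> (tanh (l / 2) * 2 * (2 / n)) * v" using v0 by (intro mult_right_mono) auto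
    then show ?thesis by (simp add: power2_eq_square mult_ac)
  qed
  also have "\<dots> \<le> tanh (l / 2) * sinh \<mu> * (sinh \<mu>' / tanh (l' / 2))"
  proof (intro mult_mono)
    have "2 * v * 1 \<le> 2 * v * cosh (\<mu> / 2)" using v0 cosh_real_ge_1 by (intro mult_left_mono) auto
    then show "2 * v \<le> sinh \<mu>" using sinh_double[of "\<mu> / 2"] by (simp add: v_def)
    have "2 / n * tanh (l' / 2) \<le> 2 / n * (l' / 2)" using l' by (intro mult_left_mono tanh_le) auto
    also have "\<dots> \<le> sinh \<mu>'" using \<mu> by (simp add: \<mu>'_def le_sinh)
    finally show "2 / n \<le> sinh \<mu>' / tanh (l' / 2)" using l' by (simp add: field_simps)
  qed (use l' l v0 \<mu> in auto)
  finally show "(sinh (l' / n / 2) - sinh (l / n / 2))\<^sup>2 \<le> tanh (l / 2) / tanh (l' / 2) * sinh (l / n) * sinh (l' / n)"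
    by (simp add: v_def \<mu>_def \<mu>'_def mult_ac)
qed (use assms in auto)

section \<open>Random scales\<close>

lemma cos_power4: "cos (u::real) ^ 4 = 3 / 8 + cos (2 * u) / 2 + cos (4 * u) / 8"
proof -
  have "cos (4 * u) = 2 * (cos (2 * u))\<^sup>2 - 1" using cos_double_cos[of "2 * u"] by simp
  then show ?thesis
    unfolding cos_double_cos[of u] by (simp add: power2_eq_square power4_eq_xxxx field_simps)
qed

lemma nn_integral_cos4_density:
  assumes W: "0 < W"
  shows "(\<integral>\<^sup>+ y. ennreal (cos4_density W y) \<partial>lborel) = 1"
proof -
  define F where "F y = 4 / (3 * W) * (3 * y / 8 + W / (2 * pi) * sin (pi * y / W) + W / (16 * pi) * sin (2 * pi * y / W))"
    for y
  define f where "f y = 4 / (3 * W) * cos (pi * y / (2 * W)) ^ 4" for y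
  have f_eq: "f y = 4 / (3 * W) * (3 / 8 + cos (pi * y / W) / 2 + cos (2 * pi * y / W) / 8)" for y
    unfolding f_def cos_power4 using W by (simp add: field_simps)
  have DERIV: "(F has_real_derivative f y) (at y within A)" for y A
    unfolding F_def f_eq using W by (auto intro!: derivative_eq_intros simp: field_simps)
  have "(\<integral>\<^sup>+ y. ennreal (cos4_density W y) \<partial>lborel) = (\<integral>\<^sup>+ y. ennreal (f y) * indicator {- W..W} y \<partial>lborel)"
  proof (rule nn_integral_cong)
    fix y :: real
    \<comment> \<open>The density is cut off to the open interval; the formula vanishes at the end
      points, so the closed interval of the fundamental theorem may be used.\<close>
    have "f y = 0" if "\<bar>y\<bar> = W"
    proof -
      have "y = W \<or> y = - W" using that by linarith
      then have "pi * y / (2 * W) = pi / 2 \<or> pi * y / (2 * W) = - (pi / 2)" using W by auto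
      then show ?thesis unfolding f_def by (elim disjE) (simp_all only: cos_minus cos_pi_half, simp_all)
    qed
    then show "ennreal (cos4_density W y) = ennreal (f y) * indicator {- W..W} y"
      by (auto simp: cos4_density_def f_def indicator_def abs_less_iff abs_le_iff)
  qed
  also have "\<dots> = ennreal (F W - F (- W))"
    using W DERIV by (intro nn_integral_FTC_Icc) (auto simp: f_def)
  also have "F W - F (- W) = 1"
    using W by (simp add: F_def)
  finally show ?thesis by simp
qed

lemma measurable_cos4_density [measurable]: "cos4_density W \<in> borel_measurable borel"
  unfolding cos4_density_def by measurable

lemma cos4_density_nonneg: "0 < W \<Longrightarrow> 0 \<le> cos4_density W y"
  by (simp add: cos4_density_def)

section \<open>Boundedness and continuity of packets in the scale\<close>

lemma half_minus_ratio_le: "j < n \<Longrightarrow> \<bar>1 / 2 - real j / real n\<bar> \<le> 1 / 2"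
  by (simp add: abs_le_iff divide_simps)

lemma abs_packet_le_half:
  assumes "j < n"
  shows "\<bar>packet_s n l j\<bar> \<le> 1 / 2" "\<bar>packet_a n l j\<bar> \<le> 1 / 2"
proof -
  define c where "c = 1 / 2 - real j / real n"
  have c: "\<bar>c\<bar> \<le> 1 / 2" using half_minus_ratio_le[OF assms] by (simp add: c_def)
  define r where "r = enn2real l"
  have r: "0 \<le> r" by (simp add: r_def)
  have arg: "\<bar>r * c\<bar> \<le> r / 2" using c r mult_left_mono[of "\<bar>c\<bar>" "1 / 2" r] by (simp add: abs_mult)
  have "cosh \<bar>r * c\<bar> \<le> cosh (r / 2)" using arg r by (subst cosh_real_nonneg_le_iff) auto
  then have "cosh (r * c) \<le> cosh (r / 2)" by simp
  moreover have "0 < cosh (r / 2)" "0 \<le> cosh (r * c)" by (simp_all add: order_less_imp_le)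
  ultimately show "\<bar>packet_s n l j\<bar> \<le> 1 / 2"
    by (simp add: packet_s_def r_def[symmetric] c_def[symmetric] field_simps)
  have "sinh \<bar>r * c\<bar> \<le> sinh (r / 2)" using arg by (simp del: sinh_real_abs)
  then have "\<bar>sinh (r * c)\<bar> \<le> sinh (r / 2)" by simp
  moreover have "0 \<le> sinh (r / 2)" using r by simp
  moreover have "sinh (r / 2) \<noteq> 0" if "l \<noteq> 0" "l \<noteq> \<infinity>"
    using that by (cases l) (auto simp: r_def)
  ultimately show "\<bar>packet_a n l j\<bar> \<le> 1 / 2"
    using c by (auto simp: packet_a_def r_def[symmetric] c_def[symmetric] abs_mult field_simps)
qed

lemma tendsto_at_ennreal_infinity:
  fixes f :: "ennreal \<Rightarrow> real"
  assumes "((\<lambda>r. f (ennreal r)) \<longlongrightarrow> f \<infinity>) at_top"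
  shows "(f \<longlongrightarrow> f \<infinity>) (at \<infinity>)"
proof (rule tendstoI)
  fix e :: real assume "0 < e"
  with assms have "eventually (\<lambda>r. dist (f (ennreal r)) (f \<infinity>) < e) at_top" by (rule tendstoD)
  then obtain R where R: "\<And>r. R \<le> r \<Longrightarrow> dist (f (ennreal r)) (f \<infinity>) < e"
    by (auto simp: eventually_at_top_linorder)
  have "eventually (\<lambda>l. ennreal (max R 0) < l) (at (\<infinity>::ennreal))"
    by (rule order_tendstoD(1)[OF tendsto_ident_at]) simp
  then show "eventually (\<lambda>l. dist (f l) (f \<infinity>) < e) (at \<infinity>)"
  proof (rule eventually_mono)
    fix l assume l: "ennreal (max R 0) < l"
    show "dist (f l) (f \<infinity>) < e"
    proof (cases l)
      case (real r)
      then have "R \<le> r" using l by (auto simp: ennreal_less_iff)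
      then show ?thesis using R real by simp
    qed (use \<open>0 < e\<close> in simp)
  qed
qed

lemma isCont_ennreal_finite:
  fixes f :: "ennreal \<Rightarrow> real"
  assumes F: "\<And>l. l < \<infinity> \<Longrightarrow> f l = F (enn2real l)" and cont: "isCont F r" and r: "0 \<le> r"
  shows "(f \<longlongrightarrow> f (ennreal r)) (at (ennreal r))"
proof -
  have "((\<lambda>l. F (enn2real l)) \<longlongrightarrow> F r) (at (ennreal r))"
    using r by (intro isCont_tendsto_compose[OF cont] tendsto_enn2real) auto
  moreover have "F r = f (ennreal r)" using F[of "ennreal r"] r by simp
  moreover have "eventually (\<lambda>l. F (enn2real l) = f l) (at (ennreal r))"
  proof (rule eventually_mono)
    show "eventually (\<lambda>l. l < \<infinity>) (at (ennreal r))"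
      by (rule order_tendstoD(2)[OF tendsto_ident_at]) simp
  qed (simp add: F)
  ultimately show ?thesis using Lim_transform_eventually by metis
qed

text \<open>Continuity on all of \<open>ennreal\<close>, end points included, serves twice: it gives
  measurability under the random scale, and it lets coefficients converge when a scale tends to 0,
  to a supremum, or to \<infinity>.\<close>

lemma continuous_packet_s:
  assumes "j \<in> {1..<n}"
  shows "continuous_on UNIV (\<lambda>l. packet_s n l j)"
  unfolding continuous_on_def
proof
  fix l :: ennreal
  define c where "c = 1 / 2 - real j / real n"
  show "((\<lambda>l. packet_s n l j) \<longlongrightarrow> packet_s n l j) (at l)"
  proof (cases l)
    case (real r)
    have "isCont (\<lambda>x. cosh (x * c) / (2 * cosh (x / 2))) r"
      by (intro continuous_intros) auto
    moreover have "packet_s n l j = cosh (enn2real l * c) / (2 * cosh (enn2real l / 2))" if "l < \<infinity>" for l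
      using that by (auto simp: packet_s_def c_def)
    ultimately show ?thesis
      unfolding real(2) using real(1) by (intro isCont_ennreal_finite[where F = "\<lambda>x. cosh (x * c) / (2 * cosh (x / 2))"])
  next
    case top
    show ?thesis
      unfolding top infinity_ennreal_def[symmetric]
      by (rule tendsto_at_ennreal_infinity) (use packet_tendsto_top(1)[of j n] assms in auto)
  qed
qed

lemma continuous_packet_a:
  assumes "j \<in> {1..<n}"
  shows "continuous_on UNIV (\<lambda>l. packet_a n l j)"
  unfolding continuous_on_def
proof
  fix l :: ennreal
  define c where "c = 1 / 2 - real j / real n"
  \<comment> \<open>The quotient of sinh terms is 0/0 at scale 0; \<open>F\<close> fills in its
    limit c.\<close>
  define F where "F x = (if x = 0 then c else sinh (x * c) / (2 * sinh (x / 2)))" for x :: real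
  show "((\<lambda>l. packet_a n l j) \<longlongrightarrow> packet_a n l j) (at l)"
  proof (cases l)
    case (real r)
    have "isCont F r"
    proof (cases "r = 0")
      case True
      have "((\<lambda>x::real. sinh (x * c) / (2 * sinh (x / 2))) \<longlongrightarrow> c) (at 0)"
        by real_asymp
      then have "(F \<longlongrightarrow> c) (at 0)"
        by (rule Lim_transform_eventually) (auto simp: F_def eventually_at_filter)
      then show ?thesis using True by (simp add: isCont_def F_def)
    next
      case False
      then have "isCont (\<lambda>x. sinh (x * c) / (2 * sinh (x / 2))) r"
        by (intro continuous_intros) auto
      moreover have "eventually (\<lambda>x. F x = sinh (x * c) / (2 * sinh (x / 2))) (nhds r)"
        using t1_space_nhds[OF False] by (rule eventually_mono) (simp add: F_def)
      ultimately show ?thesis by (simp add: isCont_cong)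
    qed
    moreover have "packet_a n l j = F (enn2real l)" if "l < \<infinity>" for l
      using that by (auto simp: packet_a_def c_def F_def enn2real_eq_0_iff)
    ultimately show ?thesis
      unfolding real(2) using real(1) by (intro isCont_ennreal_finite[where F = F])
  next
    case top
    show ?thesis
      unfolding top infinity_ennreal_def[symmetric]
      by (rule tendsto_at_ennreal_infinity) (use packet_tendsto_top(2)[of j n] assms in auto)
  qed
qed

text \<open>The arguments about the greedy path rest on mass one and on support in the interval of
  radius W. The shape of the density enters through the overlap inequality alone, which is therefore
  an assumption of individual lemmas.\<close>

locale scale_density =
  fixes h :: "real \<Rightarrow> real" and W :: real
  assumes W_pos: "0 < W"
    and h_measurable [measurable]: "h \<in> borel_measurable borel"
    and h_nonneg: "\<And>y. 0 \<le> h y"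
    and h_total: "(\<integral>\<^sup>+ y. ennreal (h y) \<partial>lborel) = 1"
    and h_support: "\<And>y. W \<le> \<bar>y\<bar> \<Longrightarrow> h y = 0"
begin

definition P :: "real measure" where "P = density lborel (\<lambda>y. ennreal (h y))"

lemma sets_P [simp, measurable_cong]: "sets P = sets borel" by (simp add: P_def)
lemma space_P [simp]: "space P = UNIV" by (simp add: P_def)

lemma emeasure_P: "emeasure P UNIV = 1"
  using h_total by (simp add: P_def emeasure_density)

lemma measure_P: "measure P UNIV = 1"
  using emeasure_P by (simp add: measure_def)

sublocale P: finite_measure P
  by (rule finite_measureI) (simp add: emeasure_P)

lemma AE_P: "AE y in P. \<bar>y\<bar> < W"
proof -
  have "AE y in lborel. 0 < ennreal (h y) \<longrightarrow> \<bar>y\<bar> < W"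
  proof (rule AE_I2, rule impI)
    fix y assume "0 < ennreal (h y)"
    then have "h y \<noteq> 0" by auto
    then show "\<bar>y\<bar> < W" using h_support[of y] by linarith
  qed
  then show ?thesis unfolding P_def by (subst AE_density) auto
qed

lemma integral_P:
  assumes [measurable]: "f \<in> borel_measurable borel"
  shows "(\<integral>y. f y \<partial>P) = (\<integral>y. h y * f y \<partial>lborel)"
  unfolding P_def using h_nonneg by (subst integral_density) auto

lemma measurable_packet:
  assumes "j \<in> {1..<n}"
  shows "(\<lambda>y. packet_s n (\<alpha> * ennreal (exp y)) j) \<in> borel_measurable borel"
    "(\<lambda>y. packet_a n (\<alpha> * ennreal (exp y)) j) \<in> borel_measurable borel"
proof -
  note [measurable] = borel_measurable_continuous_onI[OF continuous_packet_s[OF assms]]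
    borel_measurable_continuous_onI[OF continuous_packet_a[OF assms]]
  show "(\<lambda>y. packet_s n (\<alpha> * ennreal (exp y)) j) \<in> borel_measurable borel"
    "(\<lambda>y. packet_a n (\<alpha> * ennreal (exp y)) j) \<in> borel_measurable borel"
    by measurable
qed

lemma integrable_packet:
  assumes "j \<in> {1..<n}"
  shows "integrable P (\<lambda>y. packet_s n (\<alpha> * ennreal (exp y)) j)"
    "integrable P (\<lambda>y. packet_a n (\<alpha> * ennreal (exp y)) j)"
  using assms abs_packet_le_half[of j n] measurable_packet[OF assms]
  by (auto intro!: P.integrable_const_bound[where B = "1 / 2"])

lemma mixed_eq:
  "mixed_S n h \<alpha> j = (\<integral>y. packet_s n (\<alpha> * ennreal (exp y)) j \<partial>P)"
  "mixed_A n h \<alpha> j = (\<integral>y. packet_a n (\<alpha> * ennreal (exp y)) j \<partial>P)"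
  by (simp_all add: mixed_S_def mixed_A_def scale_law_def P_def)

lemma cos_sum_SA:
  "cos_sum n (SA_coeff n h \<alpha> \<beta>) \<theta> = (\<integral>y. cos_sum n
     (\<lambda>j. packet_s n (\<alpha> * ennreal (exp y)) j + packet_a n (\<beta> * ennreal (exp y)) j) \<theta> \<partial>P)"
proof -
  have int: "integrable P (\<lambda>y. (packet_s n (\<alpha> * ennreal (exp y)) j + packet_a n (\<beta> * ennreal (exp y)) j) * (2 * cos (real j * \<theta>)))"
    if "j \<in> {1..<n}" for j
    using integrable_packet[OF that] by auto
  have "(\<integral>y. cos_sum n (\<lambda>j. packet_s n (\<alpha> * ennreal (exp y)) j + packet_a n (\<beta> * ennreal (exp y)) j) \<theta> \<partial>P)
      = 1 + (\<Sum>j\<in>{1..<n}. \<integral>y. (packet_s n (\<alpha> * ennreal (exp y)) j + packet_a n (\<beta> * ennreal (exp y)) j) * (2 * cos (real j * \<theta>)) \<partial>P)"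
    unfolding cos_sum_def
    by (subst Bochner_Integration.integral_add) (use int in \<open>auto simp: measure_P intro!: Bochner_Integration.integrable_sum Bochner_Integration.integral_sum\<close>)
  also have "\<dots> = 1 + (\<Sum>j\<in>{1..<n}. SA_coeff n h \<alpha> \<beta> j * (2 * cos (real j * \<theta>)))"
    using integrable_packet by (intro arg_cong2[of _ _ _ _ "(+)"] sum.cong refl) (auto simp: SA_coeff_def mixed_eq)
  finally show ?thesis by (simp add: cos_sum_def)
qed

lemma SA_nonneg_if_pointwise:
  assumes "\<And>y \<theta>. \<bar>y\<bar> < W \<Longrightarrow>
    0 \<le> cos_sum n (\<lambda>j. packet_s n (\<alpha> * ennreal (exp y)) j + packet_a n (\<beta> * ennreal (exp y)) j) \<theta>"
  shows "nonneg_on_circle (laurent n (SA_coeff n h \<alpha> \<beta>))"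
  unfolding nonneg_on_circle_iff cos_sum_SA
  using AE_P by (intro allI integral_nonneg_AE) (auto intro: assms)

lemma mixed_tendsto:
  assumes j: "j \<in> {1..<n}" and X: "X \<longlonglongrightarrow> \<alpha>"
  shows "(\<lambda>i. mixed_S n h (X i) j) \<longlonglongrightarrow> mixed_S n h \<alpha> j" "(\<lambda>i. mixed_A n h (X i) j) \<longlonglongrightarrow> mixed_A n h \<alpha> j"
proof -
  have lim: "(\<lambda>i. X i * ennreal (exp y)) \<longlonglongrightarrow> \<alpha> * ennreal (exp y)" for y
    by (rule tendsto_mult_ennreal[OF X tendsto_const]) auto
  have s: "(\<lambda>i. packet_s n (X i * ennreal (exp y)) j) \<longlonglongrightarrow> packet_s n (\<alpha> * ennreal (exp y)) j" for y
    using continuous_on_tendsto_compose[OF continuous_packet_s[OF j] lim] by simp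
  have a: "(\<lambda>i. packet_a n (X i * ennreal (exp y)) j) \<longlonglongrightarrow> packet_a n (\<alpha> * ennreal (exp y)) j" for y
    using continuous_on_tendsto_compose[OF continuous_packet_a[OF j] lim] by simp
  have jn: "j < n" using j by simp
  show "(\<lambda>i. mixed_S n h (X i) j) \<longlonglongrightarrow> mixed_S n h \<alpha> j"
    unfolding mixed_eq
    by (rule integral_dominated_convergence[where w = "\<lambda>_. 1 / 2"])
      (use s abs_packet_le_half[OF jn] measurable_packet[OF j] in auto)
  show "(\<lambda>i. mixed_A n h (X i) j) \<longlonglongrightarrow> mixed_A n h \<alpha> j"
    unfolding mixed_eq
    by (rule integral_dominated_convergence[where w = "\<lambda>_. 1 / 2"])
      (use a abs_packet_le_half[OF jn] measurable_packet[OF j] in auto)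
qed

text \<open>At each angle nonnegativity is a closed condition on finitely many coefficients, and
  these converge by dominated convergence with bound 1/2. This handles the scale 0 and suprema,
  where the packetwise closed forms do not apply directly.\<close>

lemma SA_nonneg_limit:
  assumes X: "X \<longlonglongrightarrow> \<alpha>" and Y: "Y \<longlonglongrightarrow> \<beta>"
    and nonneg: "\<And>i. nonneg_on_circle (laurent n (SA_coeff n h (X i) (Y i)))"
  shows "nonneg_on_circle (laurent n (SA_coeff n h \<alpha> \<beta>))"
  unfolding nonneg_on_circle_iff
proof
  fix \<theta>
  have "(\<lambda>i. cos_sum n (SA_coeff n h (X i) (Y i)) \<theta>) \<longlonglongrightarrow> cos_sum n (SA_coeff n h \<alpha> \<beta>) \<theta>"
    unfolding cos_sum_def SA_coeff_def
    by (intro tendsto_intros mixed_tendsto[OF _ X] mixed_tendsto[OF _ Y])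
  then show "0 \<le> cos_sum n (SA_coeff n h \<alpha> \<beta>) \<theta>"
    by (rule LIMSEQ_le_const) (use nonneg in \<open>auto simp: nonneg_on_circle_iff\<close>)
qed

lemma cos_sum_packets:
  assumes "0 < a" "0 < b"
  shows "cos_sum n (\<lambda>j. packet_s n (ennreal a * ennreal (exp y)) j + packet_a n (ennreal b * ennreal (exp y)) j) \<theta>
    = kernel_s n (a * exp y) \<theta> + kernel_a n (b * exp y) \<theta>"
  using assms
  by (simp add: cos_sum_def kernel_s_def kernel_a_def distrib_right sum.distrib flip: ennreal_mult')

lemma SA_nonneg_same:
  assumes n: "1 \<le> n"
  shows "nonneg_on_circle (laurent n (SA_coeff n h \<alpha> \<alpha>))"
proof -
  have pos: "nonneg_on_circle (laurent n (SA_coeff n h (ennreal a) (ennreal a)))" if "0 < a" for a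
    using that n by (intro SA_nonneg_if_pointwise) (auto simp: cos_sum_packets intro!: kernel_sum_nonneg_same)
  consider "\<alpha> = 0" | a where "\<alpha> = ennreal a" "0 < a" | "\<alpha> = \<infinity>"
    by (cases \<alpha>) (fastforce simp: less_le)+
  then show ?thesis
  proof cases
    case 1
    have "(\<lambda>i. ennreal (inverse (real (Suc i)))) \<longlonglongrightarrow> ennreal 0"
      by (intro tendsto_ennrealI LIMSEQ_inverse_real_of_nat)
    then have lim: "(\<lambda>i. ennreal (inverse (real (Suc i)))) \<longlonglongrightarrow> \<alpha>" using 1 by simp
    show ?thesis by (rule SA_nonneg_limit[OF lim lim]) (auto intro: pos)
  next
    case 3
    have "\<infinity> * ennreal (exp y) = \<infinity>" for y by (simp add: ennreal_top_mult)
    with 3 show ?thesis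
      by (intro SA_nonneg_if_pointwise) (auto simp: cos_sum_def packet_s_def packet_a_def)
  qed (use pos in auto)
qed

text \<open>The greedy supremum is itself admissible, even if infinite: the defining set contains
  \<alpha>, so its supremum is the limit of an increasing sequence of admissible scales.\<close>

lemma Gamma_nonneg:
  assumes n: "1 \<le> n"
  shows "nonneg_on_circle (laurent n (SA_coeff n h (Gamma_S n h \<alpha>) \<alpha>))"
    "nonneg_on_circle (laurent n (SA_coeff n h \<alpha> (Gamma_A n h \<alpha>)))"
proof -
  have "nonneg_on_circle (laurent n (SA_coeff n h (Gamma_S n h \<alpha>) \<alpha>))
    \<and> nonneg_on_circle (laurent n (SA_coeff n h \<alpha> (Gamma_A n h \<alpha>)))"
  proof (cases "\<alpha> = \<infinity>")
    case False
    let ?S = "{\<beta>. \<alpha> \<le> \<beta> \<and> \<beta> < \<infinity> \<and> nonneg_on_circle (laurent n (SA_coeff n h \<beta> \<alpha>))}"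
    let ?A = "{\<beta>. \<alpha> \<le> \<beta> \<and> \<beta> < \<infinity> \<and> nonneg_on_circle (laurent n (SA_coeff n h \<alpha> \<beta>))}"
    have ne: "?S \<noteq> {}" "?A \<noteq> {}"
      using SA_nonneg_same[OF n, of \<alpha>] False by (auto intro!: exI[of _ \<alpha>] simp: less_top)
    obtain X where X: "incseq X" "range X \<subseteq> ?S" "Sup ?S = (SUP i. X i)"
      using ennreal_Sup_countable_SUP[OF ne(1)] by blast
    obtain Y where Y: "incseq Y" "range Y \<subseteq> ?A" "Sup ?A = (SUP i. Y i)"
      using ennreal_Sup_countable_SUP[OF ne(2)] by blast
    have "nonneg_on_circle (laurent n (SA_coeff n h (SUP i. X i) \<alpha>))"
      by (rule SA_nonneg_limit[OF LIMSEQ_SUP[OF X(1)] tendsto_const]) (use X(2) in auto)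
    moreover have "nonneg_on_circle (laurent n (SA_coeff n h \<alpha> (SUP i. Y i)))"
      by (rule SA_nonneg_limit[OF tendsto_const LIMSEQ_SUP[OF Y(1)]]) (use Y(2) in auto)
    ultimately show ?thesis using False X(3) Y(3) by (simp add: Gamma_S_def Gamma_A_def)
  qed (use SA_nonneg_same[OF n, of \<infinity>] in \<open>simp add: Gamma_S_def Gamma_A_def\<close>)
  then show "nonneg_on_circle (laurent n (SA_coeff n h (Gamma_S n h \<alpha>) \<alpha>))"
    "nonneg_on_circle (laurent n (SA_coeff n h \<alpha> (Gamma_A n h \<alpha>)))" by auto
qed

lemma Gamma_S_ge:
  assumes "\<alpha> \<le> \<beta>" "\<beta> < \<infinity>" "nonneg_on_circle (laurent n (SA_coeff n h \<beta> \<alpha>))"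
  shows "\<beta> \<le> Gamma_S n h \<alpha>"
  using assms by (auto simp: Gamma_S_def intro!: Sup_upper)

lemma Gamma_A_ge:
  assumes "\<alpha> \<le> \<beta>" "\<beta> < \<infinity>" "nonneg_on_circle (laurent n (SA_coeff n h \<alpha> \<beta>))"
  shows "\<beta> \<le> Gamma_A n h \<alpha>"
  using assms by (auto simp: Gamma_A_def intro!: Sup_upper)

text \<open>The scale exp(-W) is chosen so that exp(-W) e^Y \<le> 1 on the support, the range of the
  starting criterion; the other scale is 0 and is reached as the limit of \<open>X\<close>.\<close>

lemma Gamma_S_zero_ge:
  assumes n: "1 \<le> n"
  shows "ennreal (exp (- W)) \<le> Gamma_S n h 0"
proof (rule Gamma_S_ge)
  define X where "X i = exp (- W) / real (Suc i)" for i
  have "(\<lambda>i. ennreal (X i)) \<longlonglongrightarrow> ennreal (exp (- W) * 0)"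
    unfolding X_def divide_inverse
    by (intro tendsto_ennrealI tendsto_mult tendsto_const LIMSEQ_inverse_real_of_nat)
  then have X: "(\<lambda>i. ennreal (X i)) \<longlonglongrightarrow> 0" by simp
  show "nonneg_on_circle (laurent n (SA_coeff n h (ennreal (exp (- W))) 0))"
  proof (rule SA_nonneg_limit[OF tendsto_const X])
    fix i
    have Xi: "0 < X i" "X i \<le> exp (- W)" by (auto simp: X_def divide_simps)
    show "nonneg_on_circle (laurent n (SA_coeff n h (ennreal (exp (- W))) (ennreal (X i))))"
    proof (rule SA_nonneg_if_pointwise)
      fix y \<theta> assume y: "\<bar>y\<bar> < W"
      have "exp (- W) * exp y \<le> 1" using y by (simp flip: exp_add)
      then show "0 \<le> cos_sum n (\<lambda>j. packet_s n (ennreal (exp (- W)) * ennreal (exp y)) j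
          + packet_a n (ennreal (X i) * ennreal (exp y)) j) \<theta>"
        using Xi n by (subst cos_sum_packets) (auto intro!: kernel_sum_nonneg_start)
    qed
  qed
qed auto

lemma Gamma_ge_double:
  assumes n: "1 \<le> n" and a: "0 < a"
  shows "ennreal (2 * a) \<le> Gamma_S n h (ennreal a)" "ennreal (2 * a) \<le> Gamma_A n h (ennreal a)"
proof -
  have le: "ennreal a \<le> ennreal (2 * a)" using a by (intro ennreal_leI) simp
  show "ennreal (2 * a) \<le> Gamma_S n h (ennreal a)"
  proof (rule Gamma_S_ge[OF le])
    show "nonneg_on_circle (laurent n (SA_coeff n h (ennreal (2 * a)) (ennreal a)))"
      using a n kernel_sum_nonneg_double(1)[of "a * exp _" n]
      by (intro SA_nonneg_if_pointwise, subst cos_sum_packets) (auto simp: mult.assoc)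
  qed simp
  show "ennreal (2 * a) \<le> Gamma_A n h (ennreal a)"
  proof (rule Gamma_A_ge[OF le])
    show "nonneg_on_circle (laurent n (SA_coeff n h (ennreal a) (ennreal (2 * a))))"
      using a n kernel_sum_nonneg_double(2)[of "a * exp _" n]
      by (intro SA_nonneg_if_pointwise, subst cos_sum_packets) (auto simp: mult.assoc)
  qed simp
qed

end

lemma scale_density_cos4: "0 < W \<Longrightarrow> scale_density (cos4_density W) W"
  by unfold_locales (auto simp: cos4_density_nonneg nn_integral_cos4_density, auto simp: cos4_density_def)

section \<open>Partial fractions and the overlap estimate\<close>

text \<open>Logarithmic derivative of the reflection formula for the reciprocal Gamma function,
  whose two factors are nonzero off the integers.\<close>

lemma Digamma_reflection:
  fixes z :: complex
  assumes z: "z \<notin> \<int>"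
  shows "Digamma (1 - z) - Digamma z = of_real pi * cos (of_real pi * z) / sin (of_real pi * z)"
proof -
  have nz: "z \<notin> \<int>\<^sub>\<le>\<^sub>0" using z nonpos_Ints_Int by blast
  have "1 - z \<notin> \<int>"
  proof
    assume "1 - z \<in> \<int>"
    from Ints_diff[OF Ints_1 this] z show False by simp
  qed
  then have nz': "1 - z \<notin> \<int>\<^sub>\<le>\<^sub>0" using nonpos_Ints_Int by blast
  have inner: "((\<lambda>z. 1 - z) has_field_derivative 0 - 1) (at z)"
    by (intro DERIV_diff DERIV_const DERIV_ident)
  have refl_der: "((\<lambda>z. rGamma (1 - z)) has_field_derivative - rGamma (1 - z) * Digamma (1 - z) * (0 - 1)) (at z)"
    by (rule DERIV_chain2[where f = rGamma, OF has_field_derivative_rGamma_no_nonpos_int[OF nz'] inner])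
  have "((\<lambda>z. rGamma z * rGamma (1 - z)) has_field_derivative
      (- rGamma z * Digamma z) * rGamma (1 - z) + (- rGamma (1 - z) * Digamma (1 - z) * (0 - 1)) * rGamma z) (at z)"
    by (rule DERIV_mult[OF has_field_derivative_rGamma_no_nonpos_int[OF nz] refl_der])
  moreover have "((\<lambda>z. rGamma z * rGamma (1 - z)) has_field_derivative cos (of_real pi * z)) (at z)"
    unfolding rGamma_reflection_complex by (auto intro!: derivative_eq_intros)
  ultimately have "(- rGamma z * Digamma z) * rGamma (1 - z) + (- rGamma (1 - z) * Digamma (1 - z) * (0 - 1)) * rGamma z
      = cos (of_real pi * z)" by (rule DERIV_unique)
  then have "(rGamma z * rGamma (1 - z)) * (Digamma (1 - z) - Digamma z) = cos (of_real pi * z)"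
    by (simp add: algebra_simps)
  moreover have "rGamma z * rGamma (1 - z) \<noteq> 0"
    using nz nz' by (auto simp: rGamma_eq_zero_iff)
  ultimately show ?thesis
    unfolding rGamma_reflection_complex by (simp add: field_simps)
qed

lemma sum_symmetric_int_window:
  fixes f :: "int \<Rightarrow> 'a::comm_monoid_add"
  shows "(\<Sum>k\<in>{- int m..<int m}. f k) = (\<Sum>i<m. f (int i) + f (- 1 - int i))"
proof (induction m)
  case (Suc m)
  have "{- int (Suc m)..<int (Suc m)} = insert (int m) (insert (- 1 - int m) {- int m..<int m})"
    by auto
  then show ?case using Suc by (simp add: ac_simps)
qed simp

text \<open>The logarithms in the two limits defining Digamma cancel. The sums for z and 1 - z cover
  the nonnegative and the negative integers, m of each, which explains the half-open window.\<close>

lemma cot_partial_fractions: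
  fixes w :: complex
  assumes w: "Im w \<noteq> 0"
  shows "(\<lambda>m. \<Sum>k\<in>{- int m..<int m}. 2 / (w + 2 * of_real pi * of_int k)) \<longlonglongrightarrow> cos (w / 2) / sin (w / 2)"
proof -
  define z where "z = w / of_real (2 * pi)"
  have Im_z: "Im z \<noteq> 0"
    using w unfolding z_def Im_divide_of_real by simp
  have z: "z \<notin> \<int>"
  proof
    assume "z \<in> \<int>"
    then obtain k where "z = of_int k" by (rule Ints_cases)
    with Im_z show False by simp
  qed
  have z0: "z \<noteq> 0" "1 - z \<noteq> 0" using Im_z by (auto simp: complex_eq_iff)
  have zk: "z + of_int k \<noteq> 0" for k using Im_z by (auto simp: complex_eq_iff)
  have "(\<lambda>m. (of_real (ln (real m)) - (\<Sum>i<m. inverse (1 - z + of_nat i))) - (of_real (ln (real m)) - (\<Sum>i<m. inverse (z + of_nat i))))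
      \<longlonglongrightarrow> Digamma (1 - z) - Digamma z"
    by (intro tendsto_diff Digamma_LIMSEQ z0)
  also have "(\<lambda>m. (of_real (ln (real m)) - (\<Sum>i<m. inverse (1 - z + of_nat i))) - (of_real (ln (real m)) - (\<Sum>i<m. inverse (z + of_nat i))))
      = (\<lambda>m. \<Sum>k\<in>{- int m..<int m}. inverse (z + of_int k))"
  proof
    fix m
    have "inverse (1 - z + of_nat i) = - inverse (z + of_int (- 1 - int i))" for i
    proof -
      have "z + of_int (- 1 - int i) = - (1 - z + of_nat i)" by simp
      then show ?thesis by (simp only: inverse_minus_eq minus_minus)
    qed
    then show "(of_real (ln (real m)) - (\<Sum>i<m. inverse (1 - z + of_nat i))) - (of_real (ln (real m)) - (\<Sum>i<m. inverse (z + of_nat i)))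
      = (\<Sum>k\<in>{- int m..<int m}. inverse (z + of_int k))"
      unfolding sum_symmetric_int_window by (simp add: sum.distrib sum_negf)
  qed
  finally have L: "(\<lambda>m. inverse (of_real pi) * (\<Sum>k\<in>{- int m..<int m}. inverse (z + of_int k)))
      \<longlonglongrightarrow> inverse (of_real pi) * (of_real pi * cos (of_real pi * z) / sin (of_real pi * z))"
    unfolding Digamma_reflection[OF z] by (intro tendsto_mult tendsto_const)
  have summand: "inverse (of_real pi) * inverse (z + of_int k) = 2 / (w + 2 * of_real pi * of_int k)" for k
  proof -
    have "w + 2 * of_real pi * of_int k = 2 * of_real pi * (z + of_int k)" by (simp add: z_def field_simps)
    then show ?thesis using zk[of k] by (simp only:) (simp add: divide_simps)
  qed
  have "of_real pi * z = w / 2" by (simp add: z_def)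
  then have limit: "inverse (of_real pi) * (of_real pi * cos (of_real pi * z) / sin (of_real pi * z)) = cos (w / 2) / sin (w / 2)"
    by (simp only:) simp
  show ?thesis using L unfolding limit sum_distrib_left summand .
qed

lemma cot_half_complex:
  assumes \<mu>: "0 < \<mu>"
  shows "cos (Complex \<theta> \<mu> / 2) / sin (Complex \<theta> \<mu> / 2)
    = Complex (sin \<theta> / (cosh \<mu> - cos \<theta>)) (- sinh \<mu> / (cosh \<mu> - cos \<theta>))"
proof -
  define w where "w = Complex \<theta> \<mu>"
  have D: "0 < cosh \<mu> - cos \<theta>" using \<mu> by (intro cosh_minus_cos_pos) simp
  have sin_w: "sin w = Complex (sin \<theta> * cosh \<mu>) (cos \<theta> * sinh \<mu>)"
    by (simp add: complex_eq_iff Re_sin Im_sin w_def cosh_field_def sinh_field_def)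
  have cos_w: "cos w = Complex (cos \<theta> * cosh \<mu>) (- (sin \<theta> * sinh \<mu>))"
    by (simp add: complex_eq_iff Re_cos Im_cos w_def cosh_field_def sinh_field_def field_simps)
  have s: "sin w = 2 * sin (w / 2) * cos (w / 2)" using sin_double[of "w / 2"] by simp
  have c: "1 - cos w = 2 * (sin (w / 2))\<^sup>2" using cos_double_sin[of "w / 2"] by simp
  have "sin (w / 2) \<noteq> 0"
  proof
    assume "sin (w / 2) = 0"
    then have "sin w = 0" "cos w = 1" using s c by auto
    then have "sin \<theta> * cosh \<mu> = 0" "cos \<theta> * sinh \<mu> = 0" unfolding sin_w by (auto simp: complex_eq_iff)
    then have "sin \<theta> = 0" "cos \<theta> = 0" using \<mu> by auto
    then show False using sin_cos_squared_add[of \<theta>] by simp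
  qed
  then have "cos (w / 2) / sin (w / 2) = sin w / (1 - cos w)"
    unfolding s c by (simp add: power2_eq_square)
  also have "\<dots> = Complex (sin \<theta> / (cosh \<mu> - cos \<theta>)) (- sinh \<mu> / (cosh \<mu> - cos \<theta>))"
  proof -
    have ne: "1 - cos w \<noteq> 0" using \<open>sin (w / 2) \<noteq> 0\<close> by (simp add: c)
    have "sin w * of_real (cosh \<mu> - cos \<theta>) = Complex (sin \<theta>) (- sinh \<mu>) * (1 - cos w)"
    proof -
      have cs: "cosh \<mu> * cosh \<mu> = 1 + sinh \<mu> * sinh \<mu>" "cos \<theta> * cos \<theta> = 1 - sin \<theta> * sin \<theta>"
        using cosh_square_eq[of \<mu>] cos_squared_eq[of \<theta>] by (simp_all add: power2_eq_square)
      have "sin \<theta> * cosh \<mu> * (cosh \<mu> - cos \<theta>) = sin \<theta> * (cosh \<mu> * cosh \<mu>) - sin \<theta> * cosh \<mu> * cos \<theta>"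
        "cos \<theta> * sinh \<mu> * (cosh \<mu> - cos \<theta>) = cos \<theta> * sinh \<mu> * cosh \<mu> - (cos \<theta> * cos \<theta>) * sinh \<mu>"
        by (simp_all add: algebra_simps)
      then show ?thesis
        unfolding sin_w cos_w cs by (simp add: complex_eq_iff algebra_simps)
    qed
    then have "sin w / (1 - cos w) = Complex (sin \<theta>) (- sinh \<mu>) / of_real (cosh \<mu> - cos \<theta>)"
      using ne D by (subst frac_eq_eq) (auto simp: complex_eq_iff)
    then show ?thesis by (simp add: complex_eq_iff Re_divide_of_real Im_divide_of_real)
  qed
  finally show ?thesis by (simp add: w_def)
qed

text \<open>Real and imaginary part of one complex expansion: the summand 2/(t + i \<mu>) splits
  into the two kernels on the line at t = \<theta> + 2 pi k.\<close>

lemma real_partial_fractions: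
  assumes \<mu>: "0 < \<mu>"
  shows "(\<lambda>m. \<Sum>k\<in>{- int m..<int m}. 2 * \<mu> / ((\<theta> + 2 * pi * of_int k)\<^sup>2 + \<mu>\<^sup>2)) \<longlonglongrightarrow> sinh \<mu> / (cosh \<mu> - cos \<theta>)"
    and "(\<lambda>m. \<Sum>k\<in>{- int m..<int m}. 2 * (\<theta> + 2 * pi * of_int k) / ((\<theta> + 2 * pi * of_int k)\<^sup>2 + \<mu>\<^sup>2))
      \<longlonglongrightarrow> sin \<theta> / (cosh \<mu> - cos \<theta>)"
proof -
  have lim: "(\<lambda>m. \<Sum>k\<in>{- int m..<int m}. 2 / (Complex \<theta> \<mu> + 2 * of_real pi * of_int k))
      \<longlonglongrightarrow> Complex (sin \<theta> / (cosh \<mu> - cos \<theta>)) (- sinh \<mu> / (cosh \<mu> - cos \<theta>))"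
    using cot_partial_fractions[of "Complex \<theta> \<mu>"] \<mu> by (simp add: cot_half_complex)
  have w: "Complex \<theta> \<mu> + 2 * of_real pi * of_int k = Complex (\<theta> + 2 * pi * of_int k) \<mu>" for k :: int
    by (simp add: complex_eq_iff)
  have "Re (2 / Complex t \<mu>) = 2 * t / (t\<^sup>2 + \<mu>\<^sup>2)" "Im (2 / Complex t \<mu>) = - (2 * \<mu> / (t\<^sup>2 + \<mu>\<^sup>2))" for t
    by (simp_all add: Re_divide Im_divide)
  then show "(\<lambda>m. \<Sum>k\<in>{- int m..<int m}. 2 * \<mu> / ((\<theta> + 2 * pi * of_int k)\<^sup>2 + \<mu>\<^sup>2)) \<longlonglongrightarrow> sinh \<mu> / (cosh \<mu> - cos \<theta>)"
    and "(\<lambda>m. \<Sum>k\<in>{- int m..<int m}. 2 * (\<theta> + 2 * pi * of_int k) / ((\<theta> + 2 * pi * of_int k)\<^sup>2 + \<mu>\<^sup>2))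
      \<longlonglongrightarrow> sin \<theta> / (cosh \<mu> - cos \<theta>)"
    using tendsto_Re[OF lim] tendsto_minus[OF tendsto_Im[OF lim]] unfolding w Re_sum Im_sum
    by (simp_all add: sum_negf)
qed

section \<open>Poisson kernels on the circle and their majorants\<close>

definition poisson :: "real \<Rightarrow> real \<Rightarrow> real" where
  "poisson \<mu> \<theta> = sinh \<mu> / (cosh \<mu> - cos \<theta>)"

definition conj_poisson :: "real \<Rightarrow> real \<Rightarrow> real" where
  "conj_poisson \<mu> \<theta> = sin \<theta> / (cosh \<mu> - cos \<theta>)"

lemma measurable_poisson [measurable]: "(\<lambda>\<mu>. poisson \<mu> \<theta>) \<in> borel_measurable borel"
  "(\<lambda>\<mu>. conj_poisson \<mu> \<theta>) \<in> borel_measurable borel"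
proof -
  have [measurable]: "(sinh :: real \<Rightarrow> real) \<in> borel_measurable borel" "(cosh :: real \<Rightarrow> real) \<in> borel_measurable borel"
    by (intro borel_measurable_continuous_onI continuous_intros)+
  show "(\<lambda>\<mu>. poisson \<mu> \<theta>) \<in> borel_measurable borel" "(\<lambda>\<mu>. conj_poisson \<mu> \<theta>) \<in> borel_measurable borel"
    unfolding poisson_def conj_poisson_def by measurable
qed

lemma poisson_nonneg: "0 < \<mu> \<Longrightarrow> 0 \<le> poisson \<mu> \<theta>"
  using cosh_minus_cos_pos[of \<mu> \<theta>] by (simp add: poisson_def)

text \<open>The kernel is largest at \<theta> = 0, where it equals coth(\<mu>/2), decreasing in
  \<mu>. On the compact support of Y the scale stays away from 0, so this is a constant
  majorant.\<close>

lemma poisson_le: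
  assumes "0 < m" "m \<le> \<mu>"
  shows "poisson \<mu> \<theta> \<le> 1 / tanh (m / 2)"
proof -
  define v c where "v = sinh (\<mu> / 2)" and "c = cosh (\<mu> / 2)"
  have \<mu>: "0 < \<mu>" using assms by simp
  have v: "0 < v" using \<mu> by (simp add: v_def)
  have sinh: "sinh \<mu> = 2 * v * c" using sinh_double[of "\<mu> / 2"] by (simp add: v_def c_def)
  have cosh: "cosh \<mu> = 1 + 2 * v\<^sup>2"
    using cosh_double[of "\<mu> / 2"] hyperbolic_pythagoras[of "\<mu> / 2"] by (simp add: v_def)
  have "poisson \<mu> \<theta> \<le> sinh \<mu> / (2 * v\<^sup>2)"
  proof -
    have "0 < v\<^sup>2" "cos \<theta> \<le> 1" using v by auto
    then have "2 * v\<^sup>2 \<le> 1 + 2 * v\<^sup>2 - cos \<theta>" "0 < 1 + 2 * v\<^sup>2 - cos \<theta>" "0 < 2 * v\<^sup>2" by linarith+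
    then show ?thesis
      unfolding poisson_def cosh using \<mu> by (intro divide_left_mono mult_pos_pos) auto
  qed
  also have "\<dots> = c / v" using v unfolding sinh by (simp add: power2_eq_square)
  also have "\<dots> = 1 / tanh (\<mu> / 2)" by (simp add: tanh_def v_def c_def)
  also have "\<dots> \<le> 1 / tanh (m / 2)" using assms by (intro divide_left_mono) auto
  finally show ?thesis .
qed

text \<open>The series of the conjugate kernel converges only conditionally, but a difference of two
  such summands is dominated by a Poisson summand, whose partial sums are bounded by the kernel. The
  prefactor depends only on the ratio of \<mu> and \<mu>', hence not on the random scale.\<close>

lemma summand_difference_bound:
  fixes t \<mu> \<mu>' :: real
  assumes "0 < \<mu>" "0 < \<mu>'"
  shows "\<bar>2 * t / (t\<^sup>2 + \<mu>\<^sup>2) - 2 * t / (t\<^sup>2 + \<mu>'\<^sup>2)\<bar> \<le> \<bar>\<mu>'\<^sup>2 - \<mu>\<^sup>2\<bar> / (2 * \<mu> * \<mu>') * (2 * \<mu>' / (t\<^sup>2 + \<mu>'\<^sup>2))"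
proof -
  define A B where "A = t\<^sup>2 + \<mu>\<^sup>2" and "B = t\<^sup>2 + \<mu>'\<^sup>2"
  have AB: "0 < A" "0 < B" using assms by (auto simp: A_def B_def add_nonneg_pos)
  have amgm: "2 * \<bar>t\<bar> * \<mu> \<le> A"
    using sum_squares_bound[of "\<bar>t\<bar>" \<mu>] by (simp add: A_def)
  have "2 * t / A - 2 * t / B = (2 * t) * (B - A) / (A * B)" using AB by (simp add: field_simps)
  also have "B - A = \<mu>'\<^sup>2 - \<mu>\<^sup>2" by (simp add: A_def B_def)
  finally have "\<bar>2 * t / A - 2 * t / B\<bar> = 2 * \<bar>t\<bar> * \<bar>\<mu>'\<^sup>2 - \<mu>\<^sup>2\<bar> / (A * B)"
    using AB by (simp add: abs_mult)
  also have "\<dots> = (2 * \<bar>t\<bar> * \<mu>) * (\<bar>\<mu>'\<^sup>2 - \<mu>\<^sup>2\<bar> / (\<mu> * (A * B)))" using assms by simp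
  also have "\<dots> \<le> A * (\<bar>\<mu>'\<^sup>2 - \<mu>\<^sup>2\<bar> / (\<mu> * (A * B)))"
    using AB assms by (intro mult_right_mono[OF amgm]) simp
  also have "\<dots> = \<bar>\<mu>'\<^sup>2 - \<mu>\<^sup>2\<bar> / (2 * \<mu> * \<mu>') * (2 * \<mu>' / B)" using AB assms by simp
  finally show ?thesis by (simp add: A_def B_def)
qed

context scale_density
begin

text \<open>With x = ln(|t|/s) one has s e^y = |t| e^(y-x), and both summands become functions of y
  - x. This is the origin of \<open>frak_a\<close> and \<open>frak_b\<close>.\<close>

lemma integral_summands:
  assumes t: "t \<noteq> 0" and s: "0 < s"
  shows "(\<integral>y. 2 * (s * exp y) / (t\<^sup>2 + (s * exp y)\<^sup>2) \<partial>P) = 2 / \<bar>t\<bar> * frak_a h (ln (\<bar>t\<bar> / s))"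
    and "(\<integral>y. 2 * t / (t\<^sup>2 + (s * exp y)\<^sup>2) \<partial>P) = 2 / t * frak_b h (ln (\<bar>t\<bar> / s))"
proof -
  define x where "x = ln (\<bar>t\<bar> / s)"
  have ex: "exp x = \<bar>t\<bar> / s" using t s by (simp add: x_def)
  have sy: "s * exp y = \<bar>t\<bar> * exp (y - x)" for y
    using t s unfolding exp_diff ex by simp
  have pa: "2 * (s * exp y) / (t\<^sup>2 + (s * exp y)\<^sup>2) = 2 / \<bar>t\<bar> * (1 / (2 * cosh (x - y)))" for y
  proof -
    define u where "u = exp (y - x)"
    have u: "0 < u" by (simp add: u_def)
    have "exp (x - y) = 1 / u" "exp (- (x - y)) = u"
      using exp_minus[of "y - x"] by (simp_all add: u_def inverse_eq_divide)
    then have "2 * cosh (x - y) = u + 1 / u"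
      unfolding cosh_field_def by simp
    also have "\<dots> = (1 + u\<^sup>2) / u" using u by (simp add: field_simps power2_eq_square)
    finally have "1 / (2 * cosh (x - y)) = u / (1 + u\<^sup>2)" by (simp only: divide_divide_eq_right mult_1)
    moreover have "2 * (s * exp y) / (t\<^sup>2 + (s * exp y)\<^sup>2) = 2 * (\<bar>t\<bar> * u) / (\<bar>t\<bar>\<^sup>2 * (1 + u\<^sup>2))"
      unfolding sy u_def[symmetric] by (simp add: power_mult_distrib algebra_simps)
    moreover have "2 * (a * u) / (a\<^sup>2 * c) = 2 / a * (u / c)" if "a \<noteq> 0" for a c :: real
      using that by (simp add: power2_eq_square)
    then have "2 * (\<bar>t\<bar> * u) / (\<bar>t\<bar>\<^sup>2 * (1 + u\<^sup>2)) = 2 / \<bar>t\<bar> * (u / (1 + u\<^sup>2))"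
      using t by (metis abs_eq_0)
    ultimately show ?thesis by (simp only:)
  qed
  have pb: "2 * t / (t\<^sup>2 + (s * exp y)\<^sup>2) = 2 / t * (1 / (1 + exp (2 * (y - x))))" for y
  proof -
    have "exp (2 * (y - x)) = (exp (y - x))\<^sup>2" by (simp add: power2_eq_square flip: exp_add)
    moreover have "t\<^sup>2 + (s * exp y)\<^sup>2 = t\<^sup>2 * (1 + (exp (y - x))\<^sup>2)"
      unfolding sy by (simp add: power_mult_distrib algebra_simps)
    ultimately show ?thesis using t by (simp add: power2_eq_square)
  qed
  have [measurable]: "(\<lambda>y. 1 / (2 * cosh (x - y))) \<in> borel_measurable borel"
    by (intro borel_measurable_continuous_onI continuous_intros) auto
  show "(\<integral>y. 2 * (s * exp y) / (t\<^sup>2 + (s * exp y)\<^sup>2) \<partial>P) = 2 / \<bar>t\<bar> * frak_a h (ln (\<bar>t\<bar> / s))"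
    unfolding pa integral_mult_right_zero x_def[symmetric] frak_a_def
    by (subst integral_P) auto
  show "(\<integral>y. 2 * t / (t\<^sup>2 + (s * exp y)\<^sup>2) \<partial>P) = 2 / t * frak_b h (ln (\<bar>t\<bar> / s))"
    unfolding pb integral_mult_right_zero x_def[symmetric] frak_b_def
    by (subst integral_P) auto
qed

lemma integrable_summands:
  assumes t: "t \<noteq> 0" and s: "0 < s"
  shows "integrable P (\<lambda>y. 2 * (s * exp y) / (t\<^sup>2 + (s * exp y)\<^sup>2))"
    and "integrable P (\<lambda>y. 2 * t / (t\<^sup>2 + (s * exp y)\<^sup>2))"
proof -
  have pos: "0 < t\<^sup>2 + (s * exp y)\<^sup>2" for y using t by (simp add: add_pos_nonneg)
  have "2 * (s * exp y) / (t\<^sup>2 + (s * exp y)\<^sup>2) \<le> 1 / \<bar>t\<bar>" for y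
  proof -
    have "2 * \<bar>t\<bar> * (s * exp y) \<le> t\<^sup>2 + (s * exp y)\<^sup>2"
      using sum_squares_bound[of "\<bar>t\<bar>" "s * exp y"] by simp
    then show ?thesis using t pos[of y] by (simp add: field_simps)
  qed
  then show "integrable P (\<lambda>y. 2 * (s * exp y) / (t\<^sup>2 + (s * exp y)\<^sup>2))"
    using s pos by (intro P.integrable_const_bound[where B = "1 / \<bar>t\<bar>"]) (auto simp: less_imp_le)
  have "\<bar>2 * t / (t\<^sup>2 + (s * exp y)\<^sup>2)\<bar> \<le> 2 / \<bar>t\<bar>" for y
  proof -
    have "\<bar>2 * t\<bar> / (t\<^sup>2 + (s * exp y)\<^sup>2) \<le> \<bar>2 * t\<bar> / t\<^sup>2"
      using t pos[of y] by (intro divide_left_mono) auto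
    also have "\<dots> = 2 / \<bar>t\<bar>" using t by (cases "0 < t") (auto simp: power2_eq_square)
    finally show ?thesis using pos[of y] by (simp add: abs_mult)
  qed
  then show "integrable P (\<lambda>y. 2 * t / (t\<^sup>2 + (s * exp y)\<^sup>2))"
    by (intro P.integrable_const_bound[where B = "2 / \<bar>t\<bar>"]) auto
qed

lemma AE_scale_ge: "0 < s \<Longrightarrow> AE y in P. s * exp (- W) \<le> s * exp y"
  using AE_P by eventually_elim auto

lemma integrable_poisson:
  assumes s: "0 < s"
  shows "integrable P (\<lambda>y. poisson (s * exp y) \<theta>)"
proof (rule P.integrable_const_bound)
  show "AE y in P. norm (poisson (s * exp y) \<theta>) \<le> 1 / tanh (s * exp (- W) / 2)"
    using AE_scale_ge[OF s]
    by eventually_elim (use s in \<open>auto simp: poisson_nonneg intro!: poisson_le\<close>)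
qed measurable

text \<open>The overlap hypothesis at ln(|T k|/s) bounds the k-th term for each k. Cauchy-Schwarz
  over a finite window gives the product of two partial sums, each at most the full Poisson
  integral; this bound is independent of the window and passes to the limit.\<close>

lemma overlap_poisson:
  assumes s: "0 < s" and \<rho>: "0 \<le> \<rho>"
    and overlap: "\<And>x. \<bar>frak_b h x - frak_b h (x - d)\<bar> \<le> 2 * \<rho> * sqrt (frak_a h x * frak_a h (x - d))"
  shows "integrable P (\<lambda>y. conj_poisson (s * exp y) \<theta> - conj_poisson (s * exp d * exp y) \<theta>)"
    and "(\<integral>y. conj_poisson (s * exp y) \<theta> - conj_poisson (s * exp d * exp y) \<theta> \<partial>P)\<^sup>2
      \<le> 4 * \<rho>\<^sup>2 * (\<integral>y. poisson (s * exp y) \<theta> \<partial>P) * (\<integral>y. poisson (s * exp d * exp y) \<theta> \<partial>P)"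
proof -
  define s' where "s' = s * exp d"
  have s': "0 < s'" using s by (simp add: s'_def)
  have both: "integrable P (\<lambda>y. conj_poisson (s * exp y) \<theta> - conj_poisson (s' * exp y) \<theta>) \<and>
    (\<integral>y. conj_poisson (s * exp y) \<theta> - conj_poisson (s' * exp y) \<theta> \<partial>P)\<^sup>2
      \<le> 4 * \<rho>\<^sup>2 * (\<integral>y. poisson (s * exp y) \<theta> \<partial>P) * (\<integral>y. poisson (s' * exp y) \<theta> \<partial>P)"
  \<comment> \<open>If sin \<theta> = 0 some \<open>T k\<close> may be 0 and the logarithm is
    meaningless, but then the conjugate kernels vanish.\<close>
  proof (cases "sin \<theta> = 0")
    case True
    have "0 \<le> (\<integral>y. poisson (s * exp y) \<theta> \<partial>P)" "0 \<le> (\<integral>y. poisson (s' * exp y) \<theta> \<partial>P)"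
      using s s' by (auto intro!: integral_nonneg_AE poisson_nonneg)
    then show ?thesis using True by (simp add: conj_poisson_def)
  next
    case False
    define T where "T k = \<theta> + 2 * pi * of_int k" for k :: int
    have T0: "T k \<noteq> 0" for k
    proof
      assume "T k = 0"
      then have "\<theta> = - (2 * pi * of_int k)" by (simp add: T_def)
      then have "sin \<theta> = - sin (2 * of_int k * pi)" by (simp add: mult_ac)
      then have "sin \<theta> = 0" using sin_integer_2pi[of "of_int k"] by (simp add: mult_ac)
      with False show False ..
    qed
    define K where "K m = {- int m..<int m}" for m
    define fa fa' where "fa k = frak_a h (ln (\<bar>T k\<bar> / s))" and "fa' k = frak_a h (ln (\<bar>T k\<bar> / s'))" for k
    define fb fb' where "fb k = frak_b h (ln (\<bar>T k\<bar> / s))" and "fb' k = frak_b h (ln (\<bar>T k\<bar> / s'))" for k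
    have shift: "ln (\<bar>T k\<bar> / s') = ln (\<bar>T k\<bar> / s) - d" for k
      using T0[of k] s by (simp add: s'_def ln_div ln_mult)
    have fa0: "0 \<le> fa k" "0 \<le> fa' k" for k
      using h_nonneg by (auto simp: fa_def fa'_def frak_a_def intro!: Bochner_Integration.integral_nonneg)
    have ov: "\<bar>fb k - fb' k\<bar> \<le> 2 * \<rho> * (sqrt (fa k) * sqrt (fa' k))" for k
      using overlap[of "ln (\<bar>T k\<bar> / s)"] by (simp add: fa_def fa'_def fb_def fb'_def shift real_sqrt_mult)
    define A A' where "A = (\<integral>y. poisson (s * exp y) \<theta> \<partial>P)" and "A' = (\<integral>y. poisson (s' * exp y) \<theta> \<partial>P)"
    define D where "D m y = (\<Sum>k\<in>K m. 2 * T k / ((T k)\<^sup>2 + (s * exp y)\<^sup>2) - 2 * T k / ((T k)\<^sup>2 + (s' * exp y)\<^sup>2))" for m y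
    \<comment> \<open>The Poisson summands are nonnegative, so partial sums increase to the kernel
      and never exceed it.\<close>
    have partial_le: "(\<Sum>k\<in>K m. 2 * \<mu> / ((T k)\<^sup>2 + \<mu>\<^sup>2)) \<le> poisson \<mu> \<theta>" if "0 < \<mu>" for \<mu> m
    proof (rule incseq_le)
      show "(\<lambda>m. \<Sum>k\<in>K m. 2 * \<mu> / ((T k)\<^sup>2 + \<mu>\<^sup>2)) \<longlonglongrightarrow> poisson \<mu> \<theta>"
        unfolding K_def T_def poisson_def by (rule real_partial_fractions(1)[OF that])
      show "incseq (\<lambda>m. \<Sum>k\<in>K m. 2 * \<mu> / ((T k)\<^sup>2 + \<mu>\<^sup>2))"
        using that by (intro monoI sum_mono2) (auto simp: K_def)
    qed
    have partial: "(\<Sum>k\<in>K m. 2 / \<bar>T k\<bar> * frak_a h (ln (\<bar>T k\<bar> / u))) \<le> (\<integral>y. poisson (u * exp y) \<theta> \<partial>P)"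
      if u: "0 < u" for m u
    proof -
      have "(\<Sum>k\<in>K m. 2 / \<bar>T k\<bar> * frak_a h (ln (\<bar>T k\<bar> / u)))
          = (\<integral>y. (\<Sum>k\<in>K m. 2 * (u * exp y) / ((T k)\<^sup>2 + (u * exp y)\<^sup>2)) \<partial>P)"
        using integrable_summands(1)[OF T0 u] by (subst Bochner_Integration.integral_sum) (auto simp: integral_summands(1)[OF T0 u])
      also have "\<dots> \<le> (\<integral>y. poisson (u * exp y) \<theta> \<partial>P)"
        using u partial_le integrable_summands(1)[OF T0 u]
        by (intro integral_mono Bochner_Integration.integrable_sum integrable_poisson) auto
      finally show ?thesis .
    qed
    have int_D: "integrable P (D m)" for m
      unfolding D_def
      by (intro Bochner_Integration.integrable_sum Bochner_Integration.integrable_diff integrable_summands(2) T0 s s')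
    have "(\<integral>y. D m y \<partial>P) = (\<Sum>k\<in>K m. 2 / T k * fb k - 2 / T k * fb' k)" for m
      unfolding D_def fb_def fb'_def
      using integrable_summands(2)[OF T0 s] integrable_summands(2)[OF T0 s']
      by (subst Bochner_Integration.integral_sum) (auto simp: integral_summands(2)[OF T0 s] integral_summands(2)[OF T0 s'])
    then have "\<bar>\<integral>y. D m y \<partial>P\<bar> \<le> (\<Sum>k\<in>K m. \<bar>2 / T k * fb k - 2 / T k * fb' k\<bar>)" for m
      by (simp only: sum_abs)
    also have "(\<Sum>k\<in>K m. \<bar>2 / T k * fb k - 2 / T k * fb' k\<bar>)
        \<le> (\<Sum>k\<in>K m. 2 * \<rho> * (sqrt (2 / \<bar>T k\<bar> * fa k) * sqrt (2 / \<bar>T k\<bar> * fa' k)))" for m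
    proof (rule sum_mono)
      fix k
      define r where "r = 2 / \<bar>T k\<bar>"
      have r: "0 \<le> r" by (simp add: r_def)
      have "\<bar>2 / T k * fb k - 2 / T k * fb' k\<bar> = r * \<bar>fb k - fb' k\<bar>"
        unfolding right_diff_distrib[symmetric] abs_mult r_def by simp
      also have "\<dots> \<le> r * (2 * \<rho> * (sqrt (fa k) * sqrt (fa' k)))" using ov r by (rule mult_left_mono)
      also have "\<dots> = 2 * \<rho> * (sqrt (r * fa k) * sqrt (r * fa' k))"
      proof -
        have "2 * \<rho> * (sqrt (r * fa k) * sqrt (r * fa' k)) = (sqrt r * sqrt r) * (2 * \<rho> * (sqrt (fa k) * sqrt (fa' k)))"
          by (simp only: real_sqrt_mult mult_ac)
        then show ?thesis unfolding real_sqrt_mult_self using r by (simp only: abs_of_nonneg)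
      qed
      finally show "\<bar>2 / T k * fb k - 2 / T k * fb' k\<bar> \<le> 2 * \<rho> * (sqrt (2 / \<bar>T k\<bar> * fa k) * sqrt (2 / \<bar>T k\<bar> * fa' k))"
        by (simp add: r_def)
    qed
    finally have bound1: "\<bar>\<integral>y. D m y \<partial>P\<bar> \<le> 2 * \<rho> * (\<Sum>k\<in>K m. sqrt (2 / \<bar>T k\<bar> * fa k) * sqrt (2 / \<bar>T k\<bar> * fa' k))" for m
      by (simp add: sum_distrib_left)
    have A0: "0 \<le> A" "0 \<le> A'"
      using s s' by (auto simp: A_def A'_def intro!: integral_nonneg_AE poisson_nonneg)
    have bound: "(\<integral>y. D m y \<partial>P)\<^sup>2 \<le> 4 * \<rho>\<^sup>2 * A * A'" for m
    proof -
      let ?S = "\<Sum>k\<in>K m. sqrt (2 / \<bar>T k\<bar> * fa k) * sqrt (2 / \<bar>T k\<bar> * fa' k)"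
      have sq: "(sqrt (2 / \<bar>T k\<bar> * fa k))\<^sup>2 = 2 / \<bar>T k\<bar> * fa k" "(sqrt (2 / \<bar>T k\<bar> * fa' k))\<^sup>2 = 2 / \<bar>T k\<bar> * fa' k" for k
        using fa0 by (auto intro!: real_sqrt_pow2 mult_nonneg_nonneg)
      have "?S\<^sup>2 \<le> (\<Sum>k\<in>K m. 2 / \<bar>T k\<bar> * fa k) * (\<Sum>k\<in>K m. 2 / \<bar>T k\<bar> * fa' k)"
        using Cauchy_Schwarz_ineq_sum[of "\<lambda>k. sqrt (2 / \<bar>T k\<bar> * fa k)" "\<lambda>k. sqrt (2 / \<bar>T k\<bar> * fa' k)" "K m"]
        unfolding sq .
      also have "\<dots> \<le> A * A'"
        using partial[OF s, of m] partial[OF s', of m] fa0 A0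
        by (intro mult_mono) (auto simp: fa_def fa'_def A_def A'_def intro!: sum_nonneg mult_nonneg_nonneg)
      finally have S: "?S\<^sup>2 \<le> A * A'" .
      have "(\<integral>y. D m y \<partial>P)\<^sup>2 \<le> (2 * \<rho> * ?S)\<^sup>2"
        unfolding abs_le_square_iff[symmetric] using bound1[of m] abs_ge_self by (rule order_trans)
      also have "\<dots> = 4 * \<rho>\<^sup>2 * ?S\<^sup>2" by (simp add: power_mult_distrib)
      also have "\<dots> \<le> 4 * \<rho>\<^sup>2 * (A * A')" using S by (intro mult_left_mono) auto
      finally show ?thesis by (simp add: mult.assoc)
    qed
    \<comment> \<open>Majorant for the partial sums \<open>D\<close>, uniform in the window and in y
      on the support: the scale ratio is free of y, and the Poisson kernel is largest at the
      smallest scale s' exp(-W).\<close>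
    define B where "B = \<bar>s'\<^sup>2 - s\<^sup>2\<bar> / (2 * s * s') * (1 / tanh (s' * exp (- W) / 2))"
    have D_lim: "(\<lambda>m. D m y) \<longlonglongrightarrow> conj_poisson (s * exp y) \<theta> - conj_poisson (s' * exp y) \<theta>" for y
      unfolding D_def sum_subtractf K_def T_def conj_poisson_def
      using s s' by (intro tendsto_diff real_partial_fractions(2)) auto
    have D_bound: "\<bar>D m y\<bar> \<le> B" if y: "s' * exp (- W) \<le> s' * exp y" for m y
    proof -
      define \<mu> \<mu>' where "\<mu> = s * exp y" and "\<mu>' = s' * exp y"
      have \<mu>: "0 < \<mu>" "0 < \<mu>'" using s s' by (auto simp: \<mu>_def \<mu>'_def)
      have ratio: "\<bar>\<mu>'\<^sup>2 - \<mu>\<^sup>2\<bar> / (2 * \<mu> * \<mu>') = \<bar>s'\<^sup>2 - s\<^sup>2\<bar> / (2 * s * s')"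
      proof -
        have "\<mu>'\<^sup>2 - \<mu>\<^sup>2 = (s'\<^sup>2 - s\<^sup>2) * (exp y)\<^sup>2" by (simp add: \<mu>_def \<mu>'_def power_mult_distrib algebra_simps)
        then have "\<bar>\<mu>'\<^sup>2 - \<mu>\<^sup>2\<bar> / (2 * \<mu> * \<mu>') = \<bar>s'\<^sup>2 - s\<^sup>2\<bar> * (exp y)\<^sup>2 / (2 * s * s' * (exp y)\<^sup>2)"
          by (simp add: abs_mult \<mu>_def \<mu>'_def power2_eq_square mult_ac)
        then show ?thesis by simp
      qed
      have "\<bar>D m y\<bar> \<le> (\<Sum>k\<in>K m. \<bar>\<mu>'\<^sup>2 - \<mu>\<^sup>2\<bar> / (2 * \<mu> * \<mu>') * (2 * \<mu>' / ((T k)\<^sup>2 + \<mu>'\<^sup>2)))"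
        unfolding D_def \<mu>_def[symmetric] \<mu>'_def[symmetric]
        by (rule order_trans[OF sum_abs]) (intro sum_mono summand_difference_bound \<mu>)
      also have "\<dots> = \<bar>s'\<^sup>2 - s\<^sup>2\<bar> / (2 * s * s') * (\<Sum>k\<in>K m. 2 * \<mu>' / ((T k)\<^sup>2 + \<mu>'\<^sup>2))"
        unfolding ratio by (simp add: sum_distrib_left)
      also have "\<dots> \<le> \<bar>s'\<^sup>2 - s\<^sup>2\<bar> / (2 * s * s') * (1 / tanh (s' * exp (- W) / 2))"
      proof (rule mult_left_mono)
        have "(\<Sum>k\<in>K m. 2 * \<mu>' / ((T k)\<^sup>2 + \<mu>'\<^sup>2)) \<le> poisson \<mu>' \<theta>"
          by (rule partial_le[OF \<mu>(2)])
        also have "poisson \<mu>' \<theta> \<le> 1 / tanh (s' * exp (- W) / 2)"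
          using y s' unfolding \<mu>'_def by (intro poisson_le) auto
        finally show "(\<Sum>k\<in>K m. 2 * \<mu>' / ((T k)\<^sup>2 + \<mu>'\<^sup>2)) \<le> 1 / tanh (s' * exp (- W) / 2)" .
      qed (use s s' in auto)
      finally show ?thesis by (simp only: B_def)
    qed
    have AE_bound: "AE y in P. norm (D m y) \<le> B" for m
      using AE_scale_ge[OF s'] by eventually_elim (simp add: D_bound)
    have meas: "(\<lambda>y. conj_poisson (s * exp y) \<theta> - conj_poisson (s' * exp y) \<theta>) \<in> borel_measurable P"
      by measurable
    have meas_D: "D m \<in> borel_measurable P" for m using int_D by auto
    have lim: "(\<lambda>m. \<integral>y. D m y \<partial>P) \<longlonglongrightarrow> (\<integral>y. conj_poisson (s * exp y) \<theta> - conj_poisson (s' * exp y) \<theta> \<partial>P)"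
      by (rule integral_dominated_convergence[where s = D and w = "\<lambda>_. B"]) (use meas meas_D D_lim AE_bound in auto)
    have int: "integrable P (\<lambda>y. conj_poisson (s * exp y) \<theta> - conj_poisson (s' * exp y) \<theta>)"
      by (rule integrable_dominated_convergence[where s = D and w = "\<lambda>_. B"]) (use meas meas_D D_lim AE_bound in auto)
    have "(\<integral>y. conj_poisson (s * exp y) \<theta> - conj_poisson (s' * exp y) \<theta> \<partial>P)\<^sup>2 \<le> 4 * \<rho>\<^sup>2 * A * A'"
      by (rule LIMSEQ_le_const2[OF tendsto_power[OF lim]]) (use bound in auto)
    with int show ?thesis by (simp add: A_def A'_def)
  qed
  then show "integrable P (\<lambda>y. conj_poisson (s * exp y) \<theta> - conj_poisson (s * exp d * exp y) \<theta>)"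
    and "(\<integral>y. conj_poisson (s * exp y) \<theta> - conj_poisson (s * exp d * exp y) \<theta> \<partial>P)\<^sup>2
      \<le> 4 * \<rho>\<^sup>2 * (\<integral>y. poisson (s * exp y) \<theta> \<partial>P) * (\<integral>y. poisson (s * exp d * exp y) \<theta> \<partial>P)"
    by (auto simp: s'_def)
qed

end

section \<open>Growth of the greedy scale\<close>

lemma geometric_exp_sum_le:
  assumes "0 < \<mu>"
  shows "(\<Sum>j\<in>{1..<n}. exp (- (\<mu> * real j))) \<le> 1 / \<mu>"
proof -
  define r where "r = exp (- \<mu>)"
  have r: "0 < r" "r < 1" using assms by (auto simp: r_def)
  have "(\<Sum>j\<in>{1..<n}. exp (- (\<mu> * real j))) = (\<Sum>j\<in>{1..<n}. r ^ j)"
    by (simp add: r_def mult.commute flip: exp_of_nat_mult)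
  also have "\<dots> \<le> r / (1 - r)"
  proof (cases "1 \<le> n")
    case True
    have "(1 - r) * (\<Sum>j\<in>{1..<n}. r ^ j) = (\<Sum>j\<in>{1..<n}. r ^ j - r ^ Suc j)"
      by (simp add: sum_distrib_left algebra_simps)
    also have "\<dots> = r - r ^ n"
      using sum_Suc_diff'[of 1 n "\<lambda>j. - (r ^ j)"] True by simp
    also have "\<dots> \<le> r" using r by simp
    finally show ?thesis using r by (simp add: field_simps)
  qed (use r in auto)
  also have "\<dots> \<le> 1 / \<mu>"
  proof -
    have "1 + \<mu> \<le> exp \<mu>" by (rule exp_ge_add_one_self)
    then have "(1 + \<mu>) * r \<le> exp \<mu> * r" using r by (intro mult_right_mono) auto
    also have "exp \<mu> * r = 1" by (simp add: r_def flip: exp_add)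
    finally show ?thesis using r assms by (simp add: field_simps)
  qed
  finally show ?thesis .
qed

text \<open>A packet of scale l is concentrated within distance about n/l of the two ends j = 0 and
  j = n. The antisymmetric one is no larger than the symmetric one, by monotonicity of tanh.\<close>

lemma abs_packet_decay:
  assumes l: "0 < L" "L \<le> l" and j: "j \<le> n" and n: "0 < n"
  shows "\<bar>packet_s n (ennreal l) j\<bar> \<le> (exp (- (L / n * real j)) + exp (- (L / n * real (n - j)))) / 2"
    and "\<bar>packet_a n (ennreal l) j\<bar> \<le> (exp (- (L / n * real j)) + exp (- (L / n * real (n - j)))) / 2"
proof -
  define c where "c = 1 / 2 - real j / real n"
  have l0: "0 < l" using l by simp
  have c: "\<bar>c\<bar> \<le> 1 / 2" using j n by (simp add: c_def abs_le_iff divide_simps)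
  have ps: "packet_s n (ennreal l) j = cosh (l * c) / (2 * cosh (l / 2))"
    and pa: "packet_a n (ennreal l) j = sinh (l * c) / (2 * sinh (l / 2))"
    using packet_finite[OF l0] by (simp_all add: c_def)
  have "packet_s n (ennreal l) j \<le> cosh (l * c) / exp (l / 2)"
    unfolding ps by (intro divide_left_mono) (auto simp: cosh_field_def intro!: mult_pos_pos add_pos_pos)
  also have "\<dots> = (exp (l * c - l / 2) + exp (- (l * c) - l / 2)) / 2"
    by (simp add: cosh_field_def exp_diff add_divide_distrib)
  also have "l * c - l / 2 = - (l / n * real j)" by (simp add: c_def algebra_simps)
  also have "- (l * c) - l / 2 = - (l / n * real (n - j))"
    using j n by (simp add: c_def of_nat_diff field_simps)
  also have "(exp (- (l / n * real j)) + exp (- (l / n * real (n - j)))) / 2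
      \<le> (exp (- (L / n * real j)) + exp (- (L / n * real (n - j)))) / 2"
    using l n by (intro divide_right_mono add_mono) (auto intro!: mult_right_mono divide_right_mono)
  finally have s: "packet_s n (ennreal l) j \<le> (exp (- (L / n * real j)) + exp (- (L / n * real (n - j)))) / 2" .
  have s0: "0 \<le> packet_s n (ennreal l) j" unfolding ps by (simp add: less_imp_le)
  show "\<bar>packet_s n (ennreal l) j\<bar> \<le> (exp (- (L / n * real j)) + exp (- (L / n * real (n - j)))) / 2"
    using s s0 by simp
  have "tanh \<bar>l * c\<bar> \<le> tanh (l / 2)" using c l0 by (simp add: abs_mult field_simps)
  then have "\<bar>sinh (l * c)\<bar> * cosh (l / 2) \<le> cosh (l * c) * sinh (l / 2)"
    by (simp add: tanh_def field_simps)
  then have "\<bar>packet_a n (ennreal l) j\<bar> \<le> packet_s n (ennreal l) j"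
    unfolding ps pa using l0 by (simp add: abs_mult field_simps)
  with s show "\<bar>packet_a n (ennreal l) j\<bar> \<le> (exp (- (L / n * real j)) + exp (- (L / n * real (n - j)))) / 2"
    by simp
qed

lemma kernel_poisson:
  assumes "0 < l" "1 \<le> n"
  shows "2 * kernel_s n l \<theta> = tanh (l / 2) * poisson (l / n) \<theta> * (1 + cos (real n * \<theta>))
      + conj_poisson (l / n) \<theta> * sin (real n * \<theta>)"
    and "2 * kernel_a n l \<theta> = poisson (l / n) \<theta> / tanh (l / 2) * (1 - cos (real n * \<theta>))
      - conj_poisson (l / n) \<theta> * sin (real n * \<theta>)"
  unfolding kernel_s_closed_form[OF assms] kernel_a_closed_form[OF assms] poisson_def conj_poisson_def
  by (simp_all add: add_divide_distrib diff_divide_distrib mult_ac)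

context scale_density
begin

text \<open>The quadratic form is averaged first and its discriminant tested afterwards. The factor
  tanh(s e^Y/2) is at least tanh(M/2) \<ge> \<rho>^2 on the support, and 1/tanh(t e^Y/2) is at least
  1, so the averaged diagonal entries absorb the \<rho>^2 of the overlap bound. Nothing is assumed
  on the order of s and t, so both kinds of greedy step are covered.\<close>

lemma SA_nonneg_if_overlap:
  assumes n: "1 \<le> n" and s: "0 < s" and t: "0 < t" and M: "0 < M" "M \<le> s * exp (- W)"
    and \<rho>: "\<rho>\<^sup>2 \<le> tanh (M / 2)"
    and int: "\<And>\<theta>. integrable P (\<lambda>y. conj_poisson (s / n * exp y) \<theta> - conj_poisson (t / n * exp y) \<theta>)"
    and bound: "\<And>\<theta>. (\<integral>y. conj_poisson (s / n * exp y) \<theta> - conj_poisson (t / n * exp y) \<theta> \<partial>P)\<^sup>2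
      \<le> 4 * \<rho>\<^sup>2 * (\<integral>y. poisson (s / n * exp y) \<theta> \<partial>P) * (\<integral>y. poisson (t / n * exp y) \<theta> \<partial>P)"
  shows "nonneg_on_circle (laurent n (SA_coeff n h (ennreal s) (ennreal t)))"
  unfolding nonneg_on_circle_iff cos_sum_SA
proof
  fix \<theta>
  define C S where "C = cos (real n * \<theta>)" and "S = sin (real n * \<theta>)"
  define a where "a y = tanh (s * exp y / 2) * poisson (s / n * exp y) \<theta>" for y
  define b where "b y = poisson (t / n * exp y) \<theta> / tanh (t * exp y / 2)" for y
  define e where "e y = conj_poisson (s / n * exp y) \<theta> - conj_poisson (t / n * exp y) \<theta>" for y
  have sn: "0 < s / n" "0 < t / n" using s t n by auto
  have tanh_meas [measurable]: "(tanh :: real \<Rightarrow> real) \<in> borel_measurable borel"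
    by (intro borel_measurable_continuous_onI continuous_intros) (auto simp: cosh_real_nonzero)
  have pn: "0 \<le> poisson (s / n * exp y) \<theta>" "0 \<le> poisson (t / n * exp y) \<theta>" for y
    by (rule poisson_nonneg[OF mult_pos_pos[OF sn(1) exp_gt_zero]], rule poisson_nonneg[OF mult_pos_pos[OF sn(2) exp_gt_zero]])
  have int_a: "integrable P a"
  proof (rule Bochner_Integration.integrable_bound[OF integrable_poisson[OF sn(1)]])
    show "AE y in P. norm (a y) \<le> norm (poisson (s / n * exp y) \<theta>)"
      using pn s tanh_real_lt_1 by (intro AE_I2) (auto simp: a_def abs_mult less_imp_le intro!: mult_left_le_one_le)
  qed (unfold a_def[abs_def], measurable)
  have int_b: "integrable P b"
  proof (rule Bochner_Integration.integrable_bound)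
    show "integrable P (\<lambda>y. poisson (t / n * exp y) \<theta> / tanh (t * exp (- W) / 2))"
      using integrable_poisson[OF sn(2)] by simp
    show "AE y in P. norm (b y) \<le> norm (poisson (t / n * exp y) \<theta> / tanh (t * exp (- W) / 2))"
      using AE_scale_ge[OF t]
      by eventually_elim (use pn t in \<open>auto simp: b_def intro!: divide_left_mono\<close>)
  qed (unfold b_def[abs_def], measurable)
  have a_ge: "\<rho>\<^sup>2 * (\<integral>y. poisson (s / n * exp y) \<theta> \<partial>P) \<le> (\<integral>y. a y \<partial>P)"
    unfolding integral_mult_right_zero[symmetric]
  proof (rule integral_mono_AE)
    show "AE y in P. \<rho>\<^sup>2 * poisson (s / n * exp y) \<theta> \<le> a y"
      using AE_scale_ge[OF s]
    proof eventually_elim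
      case (elim y)
      then have "M \<le> s * exp y" using M by linarith
      then have "tanh (M / 2) \<le> tanh (s * exp y / 2)" by simp
      with \<rho> have "\<rho>\<^sup>2 \<le> tanh (s * exp y / 2)" by linarith
      then show ?case unfolding a_def using pn(1) by (rule mult_right_mono)
    qed
  qed (use int_a integrable_poisson[OF sn(1)] in auto)
  have b_ge: "(\<integral>y. poisson (t / n * exp y) \<theta> \<partial>P) \<le> (\<integral>y. b y \<partial>P)"
  proof (rule integral_mono_AE)
    show "AE y in P. poisson (t / n * exp y) \<theta> \<le> b y"
    proof (rule AE_I2)
      fix y
      have "poisson (t / n * exp y) \<theta> / 1 \<le> poisson (t / n * exp y) \<theta> / tanh (t * exp y / 2)"
        using pn t tanh_real_lt_1[of "t * exp y / 2"] by (intro divide_left_mono) auto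
      then show "poisson (t / n * exp y) \<theta> \<le> b y" by (simp add: b_def)
    qed
  qed (use int_b integrable_poisson[OF sn(2)] in auto)
  have A0: "0 \<le> (\<integral>y. poisson (s / n * exp y) \<theta> \<partial>P)" "0 \<le> (\<integral>y. poisson (t / n * exp y) \<theta> \<partial>P)"
    using pn by (auto intro!: integral_nonneg_AE)
  have a0: "0 \<le> (\<integral>y. a y \<partial>P)" using a_ge mult_nonneg_nonneg[OF zero_le_power2[of \<rho>] A0(1)] by linarith
  have b0: "0 \<le> (\<integral>y. b y \<partial>P)" using b_ge A0 by simp
  have "(\<integral>y. e y \<partial>P)\<^sup>2 \<le> 4 * ((\<rho>\<^sup>2 * (\<integral>y. poisson (s / n * exp y) \<theta> \<partial>P)) * (\<integral>y. poisson (t / n * exp y) \<theta> \<partial>P))"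
    using bound[of \<theta>] by (simp add: e_def mult_ac)
  also have "\<dots> \<le> 4 * ((\<integral>y. a y \<partial>P) * (\<integral>y. b y \<partial>P))"
    using a_ge b_ge a0 A0 by (intro mult_left_mono mult_mono) auto
  finally have "(\<integral>y. e y \<partial>P)\<^sup>2 \<le> 4 * (\<integral>y. a y \<partial>P) * (\<integral>y. b y \<partial>P)" by (simp add: mult.assoc)
  from quadratic_form_nonneg[OF a0 b0 this, of C S]
  have "0 \<le> (\<integral>y. a y \<partial>P) * (1 + C) + (\<integral>y. b y \<partial>P) * (1 - C) + (\<integral>y. e y \<partial>P) * S"
    by (simp add: C_def S_def)
  also have "\<dots> = (\<integral>y. a y * (1 + C) + b y * (1 - C) + e y * S \<partial>P)"
    using int_a int_b int[of \<theta>] by (simp add: e_def)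
  also have "\<dots> = (\<integral>y. 2 * cos_sum n (\<lambda>j. packet_s n (ennreal s * ennreal (exp y)) j
      + packet_a n (ennreal t * ennreal (exp y)) j) \<theta> \<partial>P)"
  proof (rule Bochner_Integration.integral_cong)
    fix y
    have "2 * kernel_s n (s * exp y) \<theta> + 2 * kernel_a n (t * exp y) \<theta> = a y * (1 + C) + b y * (1 - C) + e y * S"
      using s t n by (subst kernel_poisson, simp, simp)+ (simp add: a_def b_def e_def C_def S_def algebra_simps)
    then show "a y * (1 + C) + b y * (1 - C) + e y * S = 2 * cos_sum n (\<lambda>j. packet_s n (ennreal s * ennreal (exp y)) j
        + packet_a n (ennreal t * ennreal (exp y)) j) \<theta>"
      unfolding cos_sum_packets[OF s t] by simp
  qed simp
  finally show "0 \<le> (\<integral>y. cos_sum n (\<lambda>j. packet_s n (ennreal s * ennreal (exp y)) j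
      + packet_a n (ennreal t * ennreal (exp y)) j) \<theta> \<partial>P)" by simp
qed

lemma Gamma_ge_overlap:
  assumes n: "1 \<le> n" and M: "0 < M" "M * exp W \<le> a" and d: "0 \<le> d"
    and \<rho>: "\<rho>\<^sup>2 \<le> tanh (M / 2)"
    and overlap: "\<And>x. \<bar>frak_b h x - frak_b h (x - d)\<bar> \<le> 2 * \<rho> * sqrt (frak_a h x * frak_a h (x - d))"
  shows "ennreal (a * exp d) \<le> Gamma_S n h (ennreal a)" "ennreal (a * exp d) \<le> Gamma_A n h (ennreal a)"
proof -
  have a: "0 < a" using M mult_pos_pos[OF M(1) exp_gt_zero[of W]] by linarith
  have Ma: "M \<le> a * exp (- W)"
    using M(2) by (simp add: exp_minus field_simps)
  have le: "a \<le> a * exp d" using a d by simp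
  have le': "ennreal a \<le> ennreal (a * exp d)" using le by (intro ennreal_leI)
  have Md: "M \<le> a * exp d * exp (- W)"
    using Ma mult_right_mono[OF le, of "exp (- W)"] by simp
  \<comment> \<open>\<open>\<rho>\<close> may be negative; its positive part still satisfies the
    overlap bound and the tanh condition.\<close>
  define r where "r = max \<rho> 0"
  have r: "0 \<le> r" "r\<^sup>2 \<le> tanh (M / 2)" using \<rho> M by (auto simp: r_def max_def)
  have ov: "\<bar>frak_b h x - frak_b h (x - d)\<bar> \<le> 2 * r * sqrt (frak_a h x * frak_a h (x - d))" for x
  proof -
    have "0 \<le> frak_a h x" for x
      using h_nonneg by (auto simp: frak_a_def intro!: Bochner_Integration.integral_nonneg)
    then have "2 * \<rho> * sqrt (frak_a h x * frak_a h (x - d)) \<le> 2 * r * sqrt (frak_a h x * frak_a h (x - d))"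
      by (intro mult_right_mono) (auto simp: r_def)
    with overlap[of x] show ?thesis by simp
  qed
  have an: "0 < a / n" using a n by simp
  note OP = overlap_poisson[OF an r(1) ov]
  have e: "a * exp d / real n * exp y = a / real n * exp d * exp y" for y by simp
  show "ennreal (a * exp d) \<le> Gamma_A n h (ennreal a)"
  proof (rule Gamma_A_ge[OF le'])
    show "nonneg_on_circle (laurent n (SA_coeff n h (ennreal a) (ennreal (a * exp d))))"
      by (rule SA_nonneg_if_overlap[OF n a _ M(1) Ma r(2)]) (use a OP in \<open>auto simp only: e mult_pos_pos exp_gt_zero\<close>)
  qed simp
  \<comment> \<open>In a symmetric step the larger scale belongs to S, so the difference of
    conjugate kernels changes sign while its square does not.\<close>
  have swap: "conj_poisson (a / real n * exp d * exp y) \<theta> - conj_poisson (a / real n * exp y) \<theta>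
      = - (conj_poisson (a / real n * exp y) \<theta> - conj_poisson (a / real n * exp d * exp y) \<theta>)" for y \<theta>
    by simp
  show "ennreal (a * exp d) \<le> Gamma_S n h (ennreal a)"
  proof (rule Gamma_S_ge[OF le'])
    show "nonneg_on_circle (laurent n (SA_coeff n h (ennreal (a * exp d)) (ennreal a)))"
    proof (rule SA_nonneg_if_overlap[OF n _ a M(1) Md r(2)])
      show "0 < a * exp d" using a by simp
      fix \<theta>
      show "integrable P (\<lambda>y. conj_poisson (a * exp d / real n * exp y) \<theta> - conj_poisson (a / real n * exp y) \<theta>)"
        unfolding e swap by (rule Bochner_Integration.integrable_minus[OF OP(1)])
      show "(\<integral>y. conj_poisson (a * exp d / real n * exp y) \<theta> - conj_poisson (a / real n * exp y) \<theta> \<partial>P)\<^sup>2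
        \<le> 4 * r\<^sup>2 * (\<integral>y. poisson (a * exp d / real n * exp y) \<theta> \<partial>P) * (\<integral>y. poisson (a / real n * exp y) \<theta> \<partial>P)"
        unfolding e swap Bochner_Integration.integral_minus power2_minus using OP(2)[of \<theta>] by (simp only: mult_ac)
    qed
  qed simp
qed

lemma sum_abs_mixed_le:
  assumes n: "0 < n" and K: "0 < K" "ennreal K \<le> \<alpha>"
  shows "(\<Sum>j\<in>{1..<n}. \<bar>mixed_S n h \<alpha> j\<bar>) \<le> real n * exp W / K"
    and "(\<Sum>j\<in>{1..<n}. \<bar>mixed_A n h \<alpha> j\<bar>) \<le> real n * exp W / K"
proof -
  \<comment> \<open>The least scale that occurs when \<alpha> \<ge> K and |Y| < W.\<close>
  define L where "L = K * exp (- W)"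
  have L: "0 < L" using K by (simp add: L_def)
  define B where "B j = (exp (- (L / n * real j)) + exp (- (L / n * real (n - j)))) / 2" for j
  have packet: "\<bar>packet_s n (\<alpha> * ennreal (exp y)) j\<bar> \<le> B j \<and> \<bar>packet_a n (\<alpha> * ennreal (exp y)) j\<bar> \<le> B j"
    if y: "\<bar>y\<bar> < W" and j: "j \<in> {1..<n}" for y j
  proof (cases \<alpha>)
    case (real a)
    have "K \<le> a" using K real by (simp add: ennreal_le_iff)
    then have "L \<le> a * exp y" using K y unfolding L_def by (intro mult_mono) auto
    then show ?thesis
      using abs_packet_decay[OF L, of "a * exp y" j n] j n real by (simp add: B_def flip: ennreal_mult')
  next
    case top
    then show ?thesis by (simp add: ennreal_top_mult packet_s_def packet_a_def B_def add_nonneg_nonneg)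
  qed
  have mixed: "\<bar>mixed_S n h \<alpha> j\<bar> \<le> B j" "\<bar>mixed_A n h \<alpha> j\<bar> \<le> B j" if j: "j \<in> {1..<n}" for j
  proof -
    have "\<bar>\<integral>y. f y \<partial>P\<bar> \<le> B j" if f: "integrable P f" and le: "AE y in P. \<bar>f y\<bar> \<le> B j" for f
    proof -
      have "\<bar>\<integral>y. f y \<partial>P\<bar> \<le> (\<integral>y. \<bar>f y\<bar> \<partial>P)" by simp
      also have "\<dots> \<le> (\<integral>y. B j \<partial>P)" using f le by (intro integral_mono_AE) auto
      finally show ?thesis by (simp add: measure_P)
    qed
    note * = this
    show "\<bar>mixed_S n h \<alpha> j\<bar> \<le> B j"
      unfolding mixed_eq using AE_P packet j
      by (intro *[OF integrable_packet(1)[OF j]]) (auto elim!: eventually_mono)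
    show "\<bar>mixed_A n h \<alpha> j\<bar> \<le> B j"
      unfolding mixed_eq using AE_P packet j
      by (intro *[OF integrable_packet(2)[OF j]]) (auto elim!: eventually_mono)
  qed
  have refl: "(\<Sum>j\<in>{1..<n}. exp (- (L / n * real (n - j)))) = (\<Sum>j\<in>{1..<n}. exp (- (L / n * real j)))"
    by (rule sum.reindex_bij_witness[of _ "\<lambda>j. n - j" "\<lambda>j. n - j"]) auto
  have "(\<Sum>j\<in>{1..<n}. B j) = (\<Sum>j\<in>{1..<n}. exp (- (L / n * real j)))"
    unfolding B_def by (simp only: sum_divide_distrib[symmetric] sum.distrib refl) simp
  also have "\<dots> \<le> 1 / (L / n)" using L n by (intro geometric_exp_sum_le) simp
  also have "\<dots> = real n * exp W / K" by (simp add: L_def exp_minus field_simps)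
  finally have B: "(\<Sum>j\<in>{1..<n}. B j) \<le> real n * exp W / K" .
  show "(\<Sum>j\<in>{1..<n}. \<bar>mixed_S n h \<alpha> j\<bar>) \<le> real n * exp W / K"
    by (rule order_trans[OF sum_mono[OF mixed(1)] B])
  show "(\<Sum>j\<in>{1..<n}. \<bar>mixed_A n h \<alpha> j\<bar>) \<le> real n * exp W / K"
    by (rule order_trans[OF sum_mono[OF mixed(2)] B])
qed

text \<open>With the constant 5 each of the two families has absolute sum at most 1/5, so twice the
  total is at most 4/5.\<close>

lemma exactifiable_SA:
  assumes n: "0 < n" and "ennreal (5 * real n * exp W) \<le> \<alpha>" "ennreal (5 * real n * exp W) \<le> \<beta>"
  shows "exactifiable n (SA_coeff n h \<alpha> \<beta>)"
proof -
  have K: "0 < 5 * real n * exp W" using n by simp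
  have "(\<Sum>j\<in>{1..<n}. \<bar>SA_coeff n h \<alpha> \<beta> j\<bar>) \<le> (\<Sum>j\<in>{1..<n}. \<bar>mixed_S n h \<alpha> j\<bar> + \<bar>mixed_A n h \<beta> j\<bar>)"
    unfolding SA_coeff_def by (intro sum_mono abs_triangle_ineq)
  also have "\<dots> \<le> real n * exp W / (5 * real n * exp W) + real n * exp W / (5 * real n * exp W)"
    unfolding sum.distrib using sum_abs_mixed_le[OF n K] assms by (intro add_mono) auto
  also have "\<dots> = 2 / 5" using n by simp
  finally show ?thesis by (simp add: exactifiable_def)
qed

section \<open>Symmetry and positivity along the greedy path\<close>

lemma mixed_reverse:
  assumes j: "j \<in> {1..<n}"
  shows "mixed_S n h \<alpha> (n - j) = mixed_S n h \<alpha> j" "mixed_A n h \<alpha> (n - j) = - mixed_A n h \<alpha> j"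
proof -
  have c: "1 / 2 - real (n - j) / real n = - (1 / 2 - real j / real n)"
    using j by (simp add: of_nat_diff field_simps)
  have "packet_s n l (n - j) = packet_s n l j" "packet_a n l (n - j) = - packet_a n l j" for l
    unfolding packet_s_def packet_a_def c mult_minus_right cosh_minus sinh_minus by auto
  then show "mixed_S n h \<alpha> (n - j) = mixed_S n h \<alpha> j" "mixed_A n h \<alpha> (n - j) = - mixed_A n h \<alpha> j"
    unfolding mixed_eq by auto
qed

lemma SA_coeff_zero: "SA_coeff n h 0 0 j = 1 - real j / real n"
proof -
  have "packet_s n (0 * ennreal (exp y)) j = 1 / 2" "packet_a n (0 * ennreal (exp y)) j = 1 / 2 - real j / real n" for y
    by (simp_all add: packet_s_def packet_a_def)
  then show ?thesis by (simp add: SA_coeff_def mixed_eq measure_P)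
qed

text \<open>S_0 + A_0 has the Fejer coefficients, and 0 - 1 = 0 in the natural numbers, so the start
  is the even case at t = 0 and needs no separate treatment.\<close>

lemma greedy_coeff_eq:
  "greedy_coeff n h t = (if odd t then SA_coeff n h (greedy_scale n h t) (greedy_scale n h (t - 1))
     else SA_coeff n h (greedy_scale n h (t - 1)) (greedy_scale n h t))"
  by (cases t) (auto simp: greedy_coeff_def SA_coeff_zero fun_eq_iff)

lemma greedy_nonneg:
  assumes n: "1 \<le> n"
  shows "nonneg_on_circle (laurent n (greedy_coeff n h t))"
  using SA_nonneg_same[OF n, of 0] Gamma_nonneg[OF n]
  unfolding greedy_coeff_eq by (cases t) auto

text \<open>Consecutive polynomials share one of their two parts: going to an odd index changes only
  S, which is symmetric under reversal, going to an even index only A, which is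
  antisymmetric.\<close>

lemma greedy_step:
  assumes j: "j \<in> {1..<n}"
  shows "greedy_coeff n h (Suc t) (n - j) - greedy_coeff n h t (n - j)
    = (- 1) ^ t * (greedy_coeff n h (Suc t) j - greedy_coeff n h t j)"
  unfolding greedy_coeff_eq SA_coeff_def by (cases "odd t") (simp_all add: mixed_reverse[OF j])

text \<open>Only a lower bound x of the current scale is known, and no monotonicity of the greedy
  maps is available; the gain c is therefore required at every a \<ge> x. An infinite scale stays
  infinite.\<close>

lemma greedy_scale_growth:
  assumes n: "1 \<le> n" and x: "0 < x" "ennreal x \<le> greedy_scale n h t" and c: "1 \<le> c"
    and S: "\<And>a. x \<le> a \<Longrightarrow> ennreal (c * a) \<le> Gamma_S n h (ennreal a)"
    and A: "\<And>a. x \<le> a \<Longrightarrow> ennreal (c * a) \<le> Gamma_A n h (ennreal a)"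
  shows "ennreal (c * x) \<le> greedy_scale n h (Suc t)"
proof (cases "greedy_scale n h t")
  case (real a)
  have xa: "x \<le> a" using x real by (simp add: ennreal_le_iff)
  have "ennreal (c * x) \<le> ennreal (c * a)" using xa c by (intro ennreal_leI mult_left_mono) auto
  also have "\<dots> \<le> greedy_scale n h (Suc t)" using S[OF xa] A[OF xa] real by simp
  finally show ?thesis .
next
  case top
  then show ?thesis by (simp add: Gamma_S_def Gamma_A_def)
qed

lemma greedy_scale_ge_doubling:
  assumes n: "1 \<le> n"
  shows "ennreal (2 ^ t * exp (- W)) \<le> greedy_scale n h (Suc t)"
proof (induction t)
  case 0
  show ?case using Gamma_S_zero_ge[OF n] by simp
next
  case (Suc t)
  have "ennreal (2 * (2 ^ t * exp (- W))) \<le> greedy_scale n h (Suc (Suc t))"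
  proof (rule greedy_scale_growth[OF n _ Suc])
    show "0 < 2 ^ t * exp (- W)" by simp
    fix a assume "2 ^ t * exp (- W) \<le> a"
    moreover have "0 < 2 ^ t * exp (- W)" by simp
    ultimately have "0 < a" by linarith
    then show "ennreal (2 * a) \<le> Gamma_S n h (ennreal a)" "ennreal (2 * a) \<le> Gamma_A n h (ennreal a)"
      using Gamma_ge_double[OF n] by auto
  qed simp
  then show ?case by (simp only: power_Suc mult.assoc)
qed

text \<open>The first step reaches exp(-W), u doublings lead to M exp(W), and v overlap steps gain a
  factor exp(v d) \<ge> 5n. A greedy polynomial involves two consecutive scales, and both must be
  large, so one further step is taken: u + v + 2 in all.\<close>

lemma exactifiable_greedy:
  assumes n: "1 \<le> n" and M: "1 \<le> M" and d: "0 < d"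
    and \<rho>: "\<rho>\<^sup>2 \<le> tanh (M / 2)"
    and overlap: "\<And>x. \<bar>frak_b h x - frak_b h (x - d)\<bar> \<le> 2 * \<rho> * sqrt (frak_a h x * frak_a h (x - d))"
    and u: "2 * W + ln M \<le> real u * ln 2" and v: "ln (5 * real n) \<le> real v * d"
  shows "exactifiable n (greedy_coeff n h (u + v + 2))"
proof -
  have "M * exp W = exp (2 * W + ln M) * exp (- W)"
  proof -
    have "exp (2 * W + ln M) * exp (- W) = exp (W + ln M)" by (simp flip: exp_add)
    then show ?thesis using M by (simp add: exp_add)
  qed
  also have "\<dots> \<le> exp (real u * ln 2) * exp (- W)" using u by simp
  also have "exp (real u * ln 2) = (2::real) ^ u" by (simp add: exp_of_nat_mult)
  finally have "ennreal (M * exp W) \<le> ennreal (2 ^ u * exp (- W))" by (rule ennreal_leI)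
  then have base: "ennreal (M * exp W) \<le> greedy_scale n h (Suc u)"
    using greedy_scale_ge_doubling[OF n] by (rule order_trans)
  have "ennreal (exp (real k * d) * (M * exp W)) \<le> greedy_scale n h (Suc u + k)" for k
  proof (induction k)
    case 0
    then show ?case using base by simp
  next
    case (Suc k)
    have x: "M * exp W \<le> exp (real k * d) * (M * exp W)" using M d by simp
    have "ennreal (exp d * (exp (real k * d) * (M * exp W))) \<le> greedy_scale n h (Suc (Suc u + k))"
    proof (rule greedy_scale_growth[OF n _ Suc])
      show "0 < exp (real k * d) * (M * exp W)" using M by simp
      show "1 \<le> exp d" using d by simp
      fix a assume "exp (real k * d) * (M * exp W) \<le> a"
      then have a: "M * exp W \<le> a" using x by simp
      have "0 < M" "0 \<le> d" using M d by auto
      from Gamma_ge_overlap[OF n this(1) a this(2) \<rho> overlap]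
      show "ennreal (exp d * a) \<le> Gamma_S n h (ennreal a)" "ennreal (exp d * a) \<le> Gamma_A n h (ennreal a)"
        by (auto simp: mult.commute)
    qed
    moreover have "exp d * (exp (real k * d) * (M * exp W)) = exp (real (Suc k) * d) * (M * exp W)"
    proof -
      have "real (Suc k) * d = d + real k * d" by (simp add: algebra_simps)
      then show ?thesis unfolding exp_add[symmetric] by (simp only: exp_add mult_ac)
    qed
    ultimately show ?case by simp
  qed
  moreover have large: "5 * real n * exp W \<le> exp (real k * d) * (M * exp W)" if "v \<le> k" for k
  proof -
    have "5 * real n = exp (ln (5 * real n))" using n by simp
    also have "\<dots> \<le> exp (real v * d)" using v by simp
    also have "\<dots> \<le> exp (real k * d)" using that d by simp
    also have "\<dots> \<le> exp (real k * d) * M" using M by simp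
    finally show ?thesis by (simp add: mult.assoc[symmetric])
  qed
  ultimately have ge: "ennreal (5 * real n * exp W) \<le> greedy_scale n h (Suc u + k)" if "v \<le> k" for k
    using that by (meson ennreal_leI order_trans)
  have "ennreal (5 * real n * exp W) \<le> greedy_scale n h (u + v + 2)"
    "ennreal (5 * real n * exp W) \<le> greedy_scale n h (u + v + 2 - 1)"
    using ge[of v] ge[of "Suc v"] by simp_all
  then show ?thesis
    unfolding greedy_coeff_eq using n by (auto intro!: exactifiable_SA)
qed

end

section \<open>The greedy path\<close>

lemma geometric_sum_norm:
  assumes z: "cmod z = 1"
  shows "(\<Sum>i<n. z ^ i) * cnj (\<Sum>i<n. z ^ i)
    = of_nat n + (\<Sum>j\<in>{1..<n}. of_nat (n - j) * (z ^ j + inverse z ^ j))"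
proof (induction n)
  case (Suc n)
  define D where "D = (\<Sum>i<n. z ^ i)"
  have z0: "z \<noteq> 0" using z by auto
  have zc: "cnj z = inverse z" using cmod1_cnj[OF z] z0 by (simp add: field_simps)
  have inv: "z ^ n * inverse z ^ i = z ^ (n - i)" "inverse z ^ n * z ^ i = inverse z ^ (n - i)" if "i < n" for i
    using that z0 by (simp_all add: power_diff field_simps)
  have "(\<Sum>i<Suc n. z ^ i) * cnj (\<Sum>i<Suc n. z ^ i) = D * cnj D + z ^ n * cnj D + cnj (z ^ n) * D + z ^ n * cnj (z ^ n)"
    by (simp add: D_def algebra_simps)
  also have "z ^ n * cnj (z ^ n) = 1"
    using cmod1_cnj[OF z] by (simp flip: power_mult_distrib)
  also have "z ^ n * cnj D = (\<Sum>i<n. z ^ (n - i))"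
    by (simp add: D_def sum_distrib_left zc inv)
  also have "\<dots> = (\<Sum>j\<in>{1..<Suc n}. z ^ j)"
    by (rule sum.reindex_bij_witness[of _ "\<lambda>j. n - j" "\<lambda>i. n - i"]) auto
  also have "cnj (z ^ n) * D = (\<Sum>i<n. inverse z ^ (n - i))"
    by (simp add: D_def sum_distrib_left zc inv)
  also have "\<dots> = (\<Sum>j\<in>{1..<Suc n}. inverse z ^ j)"
    by (rule sum.reindex_bij_witness[of _ "\<lambda>j. n - j" "\<lambda>i. n - i"]) auto
  also have "D * cnj D = of_nat n + (\<Sum>j\<in>{1..<n}. of_nat (n - j) * (z ^ j + inverse z ^ j))"
    unfolding D_def by (rule Suc.IH)
  also have "(\<Sum>j\<in>{1..<n}. of_nat (n - j) * (z ^ j + inverse z ^ j))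
      = (\<Sum>j\<in>{1..<Suc n}. of_nat (n - j) * (z ^ j + inverse z ^ j))"
    by (intro sum.mono_neutral_left) auto
  also have "of_nat n + (\<Sum>j\<in>{1..<Suc n}. of_nat (n - j) * (z ^ j + inverse z ^ j)) + (\<Sum>j\<in>{1..<Suc n}. z ^ j)
      + (\<Sum>j\<in>{1..<Suc n}. inverse z ^ j) + 1
      = of_nat (Suc n) + (\<Sum>j\<in>{1..<Suc n}. of_nat (Suc n - j) * (z ^ j + inverse z ^ j))"
  proof -
    have "(\<Sum>j\<in>{1..<Suc n}. of_nat (Suc n - j) * (z ^ j + inverse z ^ j))
        = (\<Sum>j\<in>{1..<Suc n}. of_nat (n - j) * (z ^ j + inverse z ^ j) + z ^ j + inverse z ^ j)"
      by (intro sum.cong) (auto simp: Suc_diff_le algebra_simps)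
    then show ?thesis by (simp add: sum.distrib)
  qed
  finally show ?case .
qed simp

lemma laurent_fejer:
  assumes n: "0 < n" and z: "cmod z = 1"
  shows "laurent n (\<lambda>j. 1 - real j / real n) z = of_real (fejer n z)"
proof -
  have "of_real (fejer n z) = (\<Sum>i<n. z ^ i) * cnj (\<Sum>i<n. z ^ i) / of_nat n"
    unfolding fejer_def of_real_divide complex_norm_square by simp
  also have "\<dots> = 1 + (\<Sum>j\<in>{1..<n}. of_nat (n - j) / of_nat n * (z ^ j + inverse z ^ j))"
    unfolding geometric_sum_norm[OF z] using n by (simp add: add_divide_distrib sum_divide_distrib)
  also have "\<dots> = laurent n (\<lambda>j. 1 - real j / real n) z"
    unfolding laurent_def using n by (intro arg_cong2[of _ _ _ _ "(+)"] sum.cong) (auto simp: of_nat_diff field_simps)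
  finally show ?thesis ..
qed

section \<open>Small coefficients and reversal projections\<close>

lemma nonneg_if_small:
  assumes "(\<Sum>j\<in>{1..<n}. \<bar>a j\<bar>) \<le> 1 / 2"
  shows "nonneg_on_circle (laurent n a)"
  unfolding nonneg_on_circle_iff
proof
  fix \<theta>
  have "\<bar>\<Sum>j\<in>{1..<n}. a j * (2 * cos (real j * \<theta>))\<bar> \<le> (\<Sum>j\<in>{1..<n}. \<bar>a j\<bar> * 2)"
    by (rule order_trans[OF sum_abs]) (auto intro!: sum_mono mult_left_mono simp: abs_mult)
  also have "\<dots> \<le> 1" using assms by (simp flip: sum_distrib_right)
  finally show "0 \<le> cos_sum n a \<theta>" by (simp add: cos_sum_def)
qed

lemma sum_abs_proj_le:
  "(\<Sum>j\<in>{1..<n}. \<bar>proj_plus n a j\<bar>) \<le> (\<Sum>j\<in>{1..<n}. \<bar>a j\<bar>)"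
  "(\<Sum>j\<in>{1..<n}. \<bar>proj_minus n a j\<bar>) \<le> (\<Sum>j\<in>{1..<n}. \<bar>a j\<bar>)"
proof -
  have rev: "(\<Sum>j\<in>{1..<n}. \<bar>a (n - j)\<bar>) = (\<Sum>j\<in>{1..<n}. \<bar>a j\<bar>)"
    by (rule sum.reindex_bij_witness[of _ "\<lambda>j. n - j" "\<lambda>j. n - j"]) auto
  have half: "(\<Sum>j\<in>{1..<n}. (\<bar>a j\<bar> + \<bar>a (n - j)\<bar>) / 2) = (\<Sum>j\<in>{1..<n}. \<bar>a j\<bar>)"
    unfolding sum_divide_distrib[symmetric] sum.distrib rev by simp
  show "(\<Sum>j\<in>{1..<n}. \<bar>proj_plus n a j\<bar>) \<le> (\<Sum>j\<in>{1..<n}. \<bar>a j\<bar>)"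
    unfolding half[symmetric] by (intro sum_mono) (auto simp: proj_plus_def coeff_rev_def)
  show "(\<Sum>j\<in>{1..<n}. \<bar>proj_minus n a j\<bar>) \<le> (\<Sum>j\<in>{1..<n}. \<bar>a j\<bar>)"
    unfolding half[symmetric] by (intro sum_mono) (auto simp: proj_minus_def coeff_rev_def)
qed

lemma proj_reverse:
  assumes "j \<in> {1..<n}"
  shows "proj_plus n a (n - j) = proj_plus n a j" "proj_minus n a (n - j) = - proj_minus n a j"
    "proj_plus n a j + proj_minus n a j = a j"
  using assms by (auto simp: proj_plus_def proj_minus_def coeff_rev_def field_simps)

context scale_density
begin

lemma path_coeff_0: "path_coeff n h 0 = (\<lambda>j. 1 - real j / real n)"
  by (simp add: path_coeff_def greedy_coeff_def)

lemma path_coeff_end: "path_coeff n h (path_length n h) = (\<lambda>j. 0)"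
  by (simp add: path_coeff_def path_length_def)

text \<open>Reversal preserves the sum of absolute values, so projecting does not increase it, and
  the stopping criterion keeps the projected polynomial dominated by its constant coefficient
  1.\<close>

lemma path_nonneg:
  assumes n: "1 \<le> n" and ex: "\<exists>t. exactifiable n (greedy_coeff n h t)"
  shows "nonneg_on_circle (laurent n (path_coeff n h t))"
proof -
  define \<tau> where "\<tau> = stop_index n h"
  have "exactifiable n (greedy_coeff n h \<tau>)" unfolding \<tau>_def stop_index_def by (rule LeastI_ex[OF ex])
  then have small: "(\<Sum>j\<in>{1..<n}. \<bar>greedy_coeff n h \<tau> j\<bar>) \<le> 1 / 2" by (simp add: exactifiable_def)
  have "nonneg_on_circle (laurent n (proj_plus n (greedy_coeff n h \<tau>)))"
    "nonneg_on_circle (laurent n (proj_minus n (greedy_coeff n h \<tau>)))"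
    "nonneg_on_circle (laurent n (\<lambda>j. 0))"
    using order_trans[OF sum_abs_proj_le(1) small] order_trans[OF sum_abs_proj_le(2) small]
    by (auto intro: nonneg_if_small)
  then show ?thesis
    using greedy_nonneg[OF n] by (simp add: path_coeff_def \<tau>_def[symmetric] Let_def)
qed

text \<open>The parity rule of the exactifier lets the first extra step remove the part with the
  reversal symmetry required at that index. The projection left over has the opposite symmetry,
  which is the one required when it is removed in the last step.\<close>

lemma path_step:
  assumes t: "t < path_length n h" and j: "j \<in> {1..<n}"
  shows "path_coeff n h (Suc t) (n - j) - path_coeff n h t (n - j)
    = (- 1) ^ t * (path_coeff n h (Suc t) j - path_coeff n h t j)"
proof -
  define \<tau> where "\<tau> = stop_index n h"
  define a where "a = greedy_coeff n h \<tau>"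
  have nj: "n - j \<in> {1..<n}" "n - (n - j) = j" using j by auto
  note pr = proj_reverse(1,2)[OF j, of a]
  note split = proj_reverse(3)[OF j, of a] proj_reverse(3)[OF nj(1), of a]
  consider "Suc t \<le> \<tau>" | "t = \<tau>" | "t = Suc \<tau>" using t by (fastforce simp: path_length_def \<tau>_def)
  then show ?thesis
  proof cases
    case 1
    then show ?thesis using greedy_step[OF j, of t] by (simp add: path_coeff_def \<tau>_def[symmetric] Let_def)
  next
    case 2
    then show ?thesis
      using pr split by (cases "odd \<tau>") (auto simp: path_coeff_def \<tau>_def[symmetric] Let_def a_def[symmetric])
  next
    case 3
    then show ?thesis
      using pr by (cases "odd \<tau>") (auto simp: path_coeff_def \<tau>_def[symmetric] Let_def a_def[symmetric])
  qed
qed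

lemma exact_ordered_search_path:
  assumes "1 \<le> n" "\<exists>t. exactifiable n (greedy_coeff n h t)"
  shows "exact_ordered_search n (path_length n h)"
proof (rule exact_ordered_search_if_path[where q = "path_coeff n h"])
  show "path_coeff n h 0 j + path_coeff n h 0 (n - j) = 1" if "j \<in> {1..<n}" for j
    using that by (simp add: path_coeff_0 of_nat_diff field_simps)
qed (use assms path_nonneg path_step in \<open>auto simp: path_coeff_end\<close>)

lemma path_length_ge:
  assumes "1 \<le> n" "\<exists>t. exactifiable n (greedy_coeff n h t)"
  shows "ln (real n) \<le> pi * real (path_length n h) + 3"
  by (rule path_length_lower_bound[where q = "path_coeff n h"])
    (use assms path_nonneg path_step in \<open>auto simp: path_coeff_0 path_coeff_end\<close>)

lemma path_length_le:
  assumes n: "2 \<le> n" and M: "1 \<le> M" and d: "0 < d"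
    and \<rho>: "\<rho>\<^sup>2 \<le> tanh (M / 2)"
    and overlap: "\<And>x. \<bar>frak_b h x - frak_b h (x - d)\<bar> \<le> 2 * \<rho> * sqrt (frak_a h x * frak_a h (x - d))"
  shows "\<exists>t. exactifiable n (greedy_coeff n h t)"
    and "real (path_length n h) \<le> ln (real n) / d + 4 * (W + ln M) + 2 / d + 6"
proof -
  \<comment> \<open>Both step counts are rounded up. The 6 in the bound is 2 for the two ceilings, 2
    for the additional greedy steps and 2 for the exactifier; 1/ln 2 \<le> 2 and ln 5 \<le> 2 give
    the other constants.\<close>
  define u where "u = nat \<lceil>(2 * W + ln M) / ln 2\<rceil>"
  define v where "v = nat \<lceil>ln (5 * real n) / d\<rceil>"
  have lnM: "0 \<le> ln M" using M by simp
  have ln2: "1 / 2 \<le> ln (2::real)"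
  proof -
    have "ln (1 / 2 :: real) \<le> 1 / 2 - 1" by (rule ln_le_minus_one) simp
    then show ?thesis by (simp add: ln_div)
  qed
  have ln5: "ln (5::real) \<le> 2"
  proof -
    \<comment> \<open>From e \<ge> 1 + 1 + 1/2 follows e^2 \<ge> 25/4 > 5.\<close>
    have "(5::real) \<le> (1 + 1 + 1\<^sup>2 / 2)\<^sup>2" by (simp add: power2_eq_square)
    also have "\<dots> \<le> (exp 1)\<^sup>2" by (intro power_mono exp_lower_Taylor_quadratic) auto
    also have "\<dots> = exp 2" by (simp add: power2_eq_square flip: exp_add)
    finally have "ln (5::real) \<le> ln (exp 2)" by (subst ln_le_cancel_iff) auto
    then show ?thesis by simp
  qed
  have num: "0 \<le> (2 * W + ln M) / ln 2" using W_pos lnM by simp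
  have u_ge: "(2 * W + ln M) / ln 2 \<le> real u" unfolding u_def by linarith
  have u_le: "real u \<le> (2 * W + ln M) / ln 2 + 1" using num unfolding u_def by linarith
  have v0: "0 \<le> ln (5 * real n) / d" using n d by simp
  have v_ge: "ln (5 * real n) / d \<le> real v" unfolding v_def by linarith
  have v_le: "real v \<le> ln (5 * real n) / d + 1" using v0 unfolding v_def by linarith
  have ex: "exactifiable n (greedy_coeff n h (u + v + 2))"
    by (rule exactifiable_greedy[OF _ M d \<rho> overlap])
      (use n d u_ge v_ge in \<open>auto simp: field_simps\<close>)
  then show "\<exists>t. exactifiable n (greedy_coeff n h t)" by blast
  have "stop_index n h \<le> u + v + 2" unfolding stop_index_def using ex by (rule Least_le)
  then have "real (path_length n h) \<le> real u + real v + 4" by (simp add: path_length_def)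
  also have "\<dots> \<le> (2 * W + ln M) / ln 2 + ln (5 * real n) / d + 6" using u_le v_le by simp
  also have "(2 * W + ln M) / ln 2 \<le> (2 * W + ln M) / (1 / 2)"
    using ln2 W_pos lnM by (intro divide_left_mono) auto
  also have "ln (5 * real n) / d \<le> (2 + ln (real n)) / d"
    using ln5 n d by (intro divide_right_mono) (auto simp: ln_mult)
  finally show "real (path_length n h) \<le> ln (real n) / d + 4 * (W + ln M) + 2 / d + 6"
    using lnM by (simp add: add_divide_distrib)
qed

end

section \<open>Choice of the density for each n and asymptotics of the length\<close>

theorem theorem4p14:
  fixes W d \<rho> M N :: "nat \<Rightarrow> real" and h :: "nat \<Rightarrow> real \<Rightarrow> real" and k :: "nat \<Rightarrow> nat"
  assumes W_pos: "\<And>m. 1 \<le> m \<Longrightarrow> 0 < W m"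
    and W_lim: "filterlim W at_top sequentially"
    and d_range: "\<And>m. 1 \<le> m \<Longrightarrow> 0 < d m \<and> d m < pi"
    and d_mono: "mono_on {1..} d"
    and d_lim: "d \<longlonglongrightarrow> pi"
    and rho_less: "\<And>m. 1 \<le> m \<Longrightarrow> \<rho> m < 1"
    and overlap: "\<And>m x. 1 \<le> m \<Longrightarrow>
        \<bar>frak_b (cos4_density (W m)) x - frak_b (cos4_density (W m)) (x - d m)\<bar>
          \<le> 2 * \<rho> m * sqrt (frak_a (cos4_density (W m)) x * frak_a (cos4_density (W m)) (x - d m))"
    and M_ge: "\<And>m. 1 \<le> m \<Longrightarrow> 1 \<le> M m"
    and M_tanh: "\<And>m. 1 \<le> m \<Longrightarrow> (\<rho> m)\<^sup>2 < tanh (M m / 2)"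
    and N_mono: "mono_on {1..} N"
    and N_lim: "filterlim N at_top sequentially"
    and N_M: "\<And>m. 1 \<le> m \<Longrightarrow> M m \<le> 2 * N m"
    and N_log: "\<And>m n. 1 \<le> m \<Longrightarrow> N m \<le> real n \<Longrightarrow>
        (W m + ln (M m) + 1) / ln (real n) \<le> 1 / real m"
    and h_def: "\<And>n. N 1 \<le> real n \<Longrightarrow>
        h n = cos4_density (W (GREATEST m. 1 \<le> m \<and> N m \<le> real n))"
    and k_def: "\<And>n. k n = path_length n (h n)"
  shows
    "(\<forall>\<^sub>F n in sequentially.
        (\<exists>t. exactifiable n (greedy_coeff n (h n) t)) \<and>
        (\<forall>t\<le>k n. nonneg_on_circle (laurent n (path_coeff n (h n) t))) \<and>
        (\<forall>z. cmod z = 1 \<longrightarrow> laurent n (path_coeff n (h n) 0) z = of_real (fejer n z)) \<and>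
        (\<forall>z. cmod z = 1 \<longrightarrow> laurent n (path_coeff n (h n) (k n)) z = 1) \<and>
        (\<forall>t\<in>{1..k n}. \<forall>j\<in>{1..<n}.
           coeff_rev n (\<lambda>i. path_coeff n (h n) t i - path_coeff n (h n) (t - 1) i) j
             = (- 1) ^ (t + 1) * (path_coeff n (h n) t j - path_coeff n (h n) (t - 1) j))) \<and>
     (\<lambda>n. real (k n) - ln (real n) / pi) \<in> o(\<lambda>n. ln (real n)) \<and>
     (\<forall>\<^sub>F n in sequentially. exact_ordered_search n (k n))"
proof -
  define m where "m n = (GREATEST m. 1 \<le> m \<and> N m \<le> real n)" for n :: nat
  \<comment> \<open>Divergence of the thresholds bounds the admissible indices, without which
    \<open>GREATEST\<close> would have no specified value.\<close>
  have bounded: "\<exists>b. \<forall>i. 1 \<le> i \<and> N i \<le> real n \<longrightarrow> i \<le> b" for n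
  proof -
    have "eventually (\<lambda>i. real n < N i) sequentially"
      using N_lim by (simp add: filterlim_at_top_dense)
    then obtain b where "\<And>i. b \<le> i \<Longrightarrow> real n < N i" by (auto simp: eventually_sequentially)
    then have "i \<le> b" if "1 \<le> i \<and> N i \<le> real n" for i
      using that by (cases "b \<le> i") force+
    then show ?thesis by blast
  qed
  have m_props: "1 \<le> m n \<and> N (m n) \<le> real n" if "N 1 \<le> real n" for n
  proof -
    obtain b where "\<forall>i. 1 \<le> i \<and> N i \<le> real n \<longrightarrow> i \<le> b" using bounded by blast
    moreover have "\<exists>i. 1 \<le> i \<and> N i \<le> real n" using that by blast
    ultimately show ?thesis
      unfolding m_def using GreatestI_ex_nat[of "\<lambda>i. 1 \<le> i \<and> N i \<le> real n" b] by blast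
  qed
  have m_ge: "i \<le> m n" if "1 \<le> i" "N i \<le> real n" for i n
  proof -
    obtain b where "\<forall>i. 1 \<le> i \<and> N i \<le> real n \<longrightarrow> i \<le> b" using bounded by blast
    then show ?thesis
      unfolding m_def using Greatest_le_nat[of "\<lambda>i. 1 \<le> i \<and> N i \<le> real n" i b] that by blast
  qed
  have m_lim: "filterlim m at_top sequentially"
    unfolding filterlim_at_top
  proof
    fix i
    have "eventually (\<lambda>n. N (max 1 i) \<le> real n) sequentially"
      using filterlim_real_sequentially by (simp add: filterlim_at_top)
    then show "eventually (\<lambda>n. i \<le> m n) sequentially"
      by eventually_elim (use m_ge[of "max 1 i"] in auto)
  qed
  have large: "eventually (\<lambda>n. N 1 \<le> real n \<and> 3 \<le> n) sequentially"
    using filterlim_real_sequentially eventually_ge_at_top[of 3]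
    by (auto simp: filterlim_at_top intro: eventually_conj)
  have density: "scale_density (h n) (W (m n))" and h_eq: "h n = cos4_density (W (m n))" if "N 1 \<le> real n" for n
    using h_def[OF that] scale_density_cos4[OF W_pos] m_props[OF that] by (simp_all add: m_def)
  have core: "\<exists>t. exactifiable n (greedy_coeff n (h n) t)"
    "real (k n) \<le> ln (real n) / d (m n) + 4 * (W (m n) + ln (M (m n))) + 2 / d (m n) + 6"
    if n: "N 1 \<le> real n" "3 \<le> n" for n
  proof -
    interpret scale_density "h n" "W (m n)" by (rule density[OF n(1)])
    have m1: "1 \<le> m n" using m_props[OF n(1)] by simp
    have "2 \<le> n" "0 < d (m n)" "(\<rho> (m n))\<^sup>2 \<le> tanh (M (m n) / 2)"
      using n d_range[OF m1] M_tanh[OF m1] by auto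
    note * = path_length_le[OF this(1) M_ge[OF m1] this(2,3) overlap[OF m1, folded h_eq[OF n(1)]]]
    show "\<exists>t. exactifiable n (greedy_coeff n (h n) t)"
      "real (k n) \<le> ln (real n) / d (m n) + 4 * (W (m n) + ln (M (m n))) + 2 / d (m n) + 6"
      using * by (auto simp: k_def)
  qed
  have path: "eventually (\<lambda>n. (\<exists>t. exactifiable n (greedy_coeff n (h n) t)) \<and>
        (\<forall>t\<le>k n. nonneg_on_circle (laurent n (path_coeff n (h n) t))) \<and>
        (\<forall>z. cmod z = 1 \<longrightarrow> laurent n (path_coeff n (h n) 0) z = of_real (fejer n z)) \<and>
        (\<forall>z. cmod z = 1 \<longrightarrow> laurent n (path_coeff n (h n) (k n)) z = 1) \<and>
        (\<forall>t\<in>{1..k n}. \<forall>j\<in>{1..<n}.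
           coeff_rev n (\<lambda>i. path_coeff n (h n) t i - path_coeff n (h n) (t - 1) i) j
             = (- 1) ^ (t + 1) * (path_coeff n (h n) t j - path_coeff n (h n) (t - 1) j))) sequentially"
    using large
  proof eventually_elim
    case (elim n)
    interpret scale_density "h n" "W (m n)" using density elim by auto
    note ex = core(1)[of n]
    have step: "coeff_rev n (\<lambda>i. path_coeff n (h n) t i - path_coeff n (h n) (t - 1) i) j
        = (- 1) ^ (t + 1) * (path_coeff n (h n) t j - path_coeff n (h n) (t - 1) j)"
      if t: "t \<in> {1..k n}" and j: "j \<in> {1..<n}" for t j
    proof -
      obtain s where s: "t = Suc s" "s < path_length n (h n)" using t by (cases t) (auto simp: k_def)
      then show ?thesis using path_step[OF s(2) j] by (simp add: coeff_rev_def)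
    qed
    show ?case
      using elim ex path_nonneg[OF _ ex] laurent_fejer[of n] step
      by (auto simp: path_coeff_0 path_coeff_end k_def laurent_def)
  qed
  have alg: "eventually (\<lambda>n. exact_ordered_search n (k n)) sequentially"
    using large
  proof eventually_elim
    case (elim n)
    interpret scale_density "h n" "W (m n)" using density elim by auto
    show ?case unfolding k_def using elim core(1) by (intro exact_ordered_search_path) auto
  qed
  \<comment> \<open>The lower estimate is the bound valid for all paths. In the upper one W + ln M
    is at most ln n / m(n) by the choice of the thresholds, and 1/d(m(n)) tends to 1/pi because m(n)
    tends to infinity.\<close>
  have "((\<lambda>n. (real (k n) - ln (real n) / pi) / ln (real n)) \<longlonglongrightarrow> 0)"
  proof (rule tendsto_sandwich[where f = "\<lambda>n. - (3 / pi) / ln (real n)"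
        and h = "\<lambda>n. 1 / d (m n) - 1 / pi + 4 / real (m n) + (2 / d 1 + 6) / ln (real n)"])
    have "(\<lambda>n. 1 / d (m n) - 1 / pi + 4 / real (m n) + (2 / d 1 + 6) / ln (real n)) \<longlonglongrightarrow> 1 / pi - 1 / pi + 0 + 0"
    proof (intro tendsto_add tendsto_diff tendsto_divide tendsto_const)
      show "(\<lambda>n. d (m n)) \<longlonglongrightarrow> pi" by (rule filterlim_compose[OF d_lim m_lim])
      show "(\<lambda>n. 4 / real (m n)) \<longlonglongrightarrow> 0"
        by (rule filterlim_compose[OF _ m_lim]) real_asymp
      show "(\<lambda>n. (2 / d 1 + 6) / ln (real n)) \<longlonglongrightarrow> 0" by real_asymp
    qed (simp_all add: pi_neq_zero)
    then show "(\<lambda>n. 1 / d (m n) - 1 / pi + 4 / real (m n) + (2 / d 1 + 6) / ln (real n)) \<longlonglongrightarrow> 0" by simp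
    show "(\<lambda>n. - (3 / pi) / ln (real n)) \<longlonglongrightarrow> 0" by real_asymp
    show "eventually (\<lambda>n. - (3 / pi) / ln (real n) \<le> (real (k n) - ln (real n) / pi) / ln (real n)) sequentially"
      using large
    proof eventually_elim
      case (elim n)
      interpret scale_density "h n" "W (m n)" using density elim by auto
      have "ln (real n) \<le> pi * real (k n) + 3" unfolding k_def using elim core(1) by (intro path_length_ge) auto
      then have "- (3 / pi) \<le> real (k n) - ln (real n) / pi" by (simp add: field_simps)
      then show ?case using elim by (intro divide_right_mono) auto
    qed
    show "eventually (\<lambda>n. (real (k n) - ln (real n) / pi) / ln (real n)
        \<le> 1 / d (m n) - 1 / pi + 4 / real (m n) + (2 / d 1 + 6) / ln (real n)) sequentially"
      using large
    proof eventually_elim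
      case (elim n)
      have ln_pos: "0 < ln (real n)" using elim by simp
      have m1: "1 \<le> m n" "N (m n) \<le> real n" using m_props elim by auto
      \<comment> \<open>Monotonicity of d bounds the term 2/d(m(n)) by the constant 2/d(1), which
        vanishes after division by ln n.\<close>
      have d1: "0 < d 1" "d 1 \<le> d (m n)"
        using d_range[of 1] mono_onD[OF d_mono, of 1 "m n"] m1 by auto
      have "(W (m n) + ln (M (m n)) + 1) \<le> ln (real n) / real (m n)"
        using N_log[OF m1] ln_pos by (simp add: field_simps)
      moreover have "2 / d (m n) \<le> 2 / d 1" using d1 by (intro divide_left_mono) auto
      ultimately have "real (k n) \<le> ln (real n) / d (m n) + 4 * (ln (real n) / real (m n)) + 2 / d 1 + 6"
        using core(2)[of n] elim by auto
      then have "(real (k n) - ln (real n) / pi) / ln (real n)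
          \<le> (ln (real n) / d (m n) + 4 * (ln (real n) / real (m n)) + 2 / d 1 + 6 - ln (real n) / pi) / ln (real n)"
        using ln_pos by (intro divide_right_mono) auto
      also have "\<dots> = 1 / d (m n) - 1 / pi + 4 / real (m n) + (2 / d 1 + 6) / ln (real n)"
        using ln_pos by (simp add: add_divide_distrib diff_divide_distrib)
      finally show ?case .
    qed
  qed
  then have "(\<lambda>n. real (k n) - ln (real n) / pi) \<in> o(\<lambda>n. ln (real n))"
    by (rule smalloI_tendsto) (use large in \<open>auto elim!: eventually_mono\<close>)
  with path alg show ?thesis by blast
qed

end
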